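(* Let $\sigma:\Omega\otimes_{\mathcal{B}}\Omega\to\Omega\otimes_{\mathcal{B}}\Omega$ be the generalized braiding and $\wedge:\Omega\otimes_{\mathcal{B}}\Omega\to\Omega^2$ the product of one-forms in the universal differential calculus $\Omega^\bullet$ of the Heckenberger–Kolb first-order calculus $\Omega$ on the quantum projective space. Then $\wedge\circ(\mathrm{id}+\sigma)=0$.
   Context: **Quantum group data.** Fix an integer $r\ge 1$, a real number $0<q<1$ and $s\in\{1,r\}$. $U_q(\mathfrak{sl}_{r+1})$ is the quantized enveloping algebra with generators $K_i^{\pm1},E_i,F_i$, $1\le i\le r$ (Klimyk–Schmüdgen conventions: $\Delta(K_i)=K_i\otimes K_i$, $\Delta(E_i)=E_i\otimes K_i+1\otimes E_i$, $\Delta(F_i)=F_i\otimes 1+K_i^{-1}\otimes F_i$; $K_i$ acts on a vector of weight $\mu$ by $q^{(\alpha_i,\mu)}$). Here $\alpha_i$ are the simple roots, $\omega_i$ the fundamental weights, $\rho=\sum_i\omega_i$, $w_0$ the longest Weyl group element, $(\cdot,\cdot)$ the invariant form with $(\alpha_i,\alpha_i)=2$. Put $a=(\alpha_s,\alpha_s)=2$, $w=(\omega_s,\omega_s)$, $m=(\omega_s,2\rho)=r$. $V(\lambda)$ is the simple type 1 module of highest weight $\lambda$, $V=V(\omega_s)$, and $V^*$ is its dual with $(Xf)(v)=f(S(X)v)$, $S$ the antipode. $\hat{R}_{X,Y}:X\otimes Y\to Y\otimes X$ is the braiding on finite-dimensional type 1 modules determined by being a module map with $\hat{R}_{V(\lambda),V(\mu)}(v\otimes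 u)=q^{(\lambda,w_0\mu)}u\otimes v$ for $v$ a highest weight vector of $V(\lambda)$ and $u$ a lowest weight vector of $V(\mu)$. Let $(v_i)$ be a weight basis of $V$ with weights $\lambda_i$ and dual basis $(f^i)$ of $V^*$. Define $\mathsf{E}:V^*\otimes V\to\mathbb{C}$, $\mathsf{E}(f^i\otimes v_j)=\delta_{ij}$, and $\mathsf{E}':V\otimes V^*\to\mathbb{C}$, $\mathsf{E}'(v_i\otimes f^j)=q^{(\lambda_i,2\rho)}\delta_{ij}$. Subscripts indicate the tensor legs on which a map acts; products of maps are compositions (rightmost first), legs being renumbered after each contraction. Put $$\mathsf{S}_{123}=(\hat{R}_{V,V^*})_{23}(\hat{R}_{V,V})_{12}(\hat{R}_{V,V^*}^{-1})_{23},\quad \tilde{\mathsf{S}}_{234}=(\hat{R}_{V,V^*})_{23}(\hat{R}_{V^*,V^*}^{-1})_{34}(\hat{R}_{V,V^*}^{-1})_{23},\quad \mathsf{T}_{1234}=\mathsf{S}_{123}\tilde{\mathsf{S}}_{234}=\tilde{\mathsf{S}}_{234}\mathsf{S}_{123}$$ (acting on $V\otimes V^*\otimes V$, $V^*\otimes V\otimes V^*$, $V\otimes V^*\otimes V\otimes V^*$ at the indicated legs). **Index-free notation.** A family $x=(x^{ij})_{1\le i,j\le r+1}$ is identified with $\sum_{i,j}v_i\otimes f^j\otimes x^{ij}$; products of families $xy$ (also $x\otimes y$, $x\wedge y$) denote $\sum v_i\otimes f^j\otimes v_k\otimes f^l\otimes x^{ij}y^{kl}$ (resp. with $\otimes_{\mathcal{B}}$,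 $\wedge$), and similarly for more factors. The maps above act on the $V,V^*$ legs; other maps act on components. Elements such as $g_{+-}$ below carry no legs. **Algebra and first-order calculus.** $\mathcal{B}$ is the unital algebra generated by $p^{ij}$, $1\le i,j\le r+1$, with relations $\mathsf{S}_{123}pp=q^{w}pp$, $\tilde{\mathsf{S}}_{234}pp=q^{-w}pp$, $\mathsf{E}'_{12}p=q^{m}$. The Heckenberger–Kolb first-order differential calculus is $\Omega=\Omega_+\oplus\Omega_-$, with $\Omega_+,\Omega_-$ generated as left $\mathcal{B}$-modules by $\partial p^{ij}$, resp. $\bar\partial p^{ij}$, with relations $$\tilde{\mathsf{S}}_{234}p\,\partial p=q^{-w}p\,\partial p,\quad \mathsf{E}'_{12}\partial p=0,\qquad \mathsf{S}_{123}p\,\bar\partial p=q^{w}p\,\bar\partial p,\quad \mathsf{E}'_{12}\bar\partial p=0,$$ right module structure $\partial p\,p=q^{a}\mathsf{T}_{1234}p\,\partial p$, $\bar\partial p\,p=q^{-a}\mathsf{T}_{1234}p\,\bar\partial p$, and differential $\mathrm{d}=\partial+\bar\partial$, where $\partial,\bar\partial:\mathcal{B}\to\Omega_\pm$ are the derivations with $p^{ij}\mapsto\partial p^{ij},\bar\partial p^{ij}$. **Universal calculus.** $\Omega^\bullet$ is the quotient of the tensor algebra $T_{\mathcal{B}}(\Omega)$ by the two-sided ideal generated by $\{\sum_i\mathrm{d}a_i\otimes\mathrm{d}b_i:\sum_i a_i\mathrm{d}b_i=0\}\subset\Omega\otimes_{\mathcal{B}}\Omega$; its product is $\wedge$. **Metric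 components.** $g_{+-}=\mathsf{E}'_{12}\mathsf{E}_{23}\,\partial p\otimes\bar\partial p$ and $g_{-+}=\mathsf{E}'_{12}\mathsf{E}_{23}\,\bar\partial p\otimes\partial p$ in $\Omega\otimes_{\mathcal{B}}\Omega$ (central elements). **Generalized braiding.** $\sigma$ is the (well-defined) $\mathcal{B}$-bimodule map $\Omega\otimes_{\mathcal{B}}\Omega\to\Omega\otimes_{\mathcal{B}}\Omega$ given by $$\sigma(\partial p\otimes\partial p)=q^{a}\mathsf{S}_{123}\tilde{\mathsf{S}}_{234}\,\partial p\otimes\partial p,\qquad \sigma(\bar\partial p\otimes\bar\partial p)=q^{-a}\mathsf{S}_{123}\tilde{\mathsf{S}}_{234}\,\bar\partial p\otimes\bar\partial p,$$ $$\sigma(\partial p\otimes\bar\partial p)=q^{2a-2w}\mathsf{S}_{123}\tilde{\mathsf{S}}_{234}^{-1}\,\bar\partial p\otimes\partial p+(1-q^{a})q^{a}q^{-m}\,p\,g_{-+}\,p,$$ $$\sigma(\bar\partial p\otimes\partial p)=q^{2w-2a}\mathsf{S}_{123}^{-1}\tilde{\mathsf{S}}_{234}\,\partial p\otimes\bar\partial p+(1-q^{-a})q^{-m}\,p\,g_{+-}\,p.$$ *)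

theory Defs
  imports "HOL-Analysis.Analysis" "HOL-Library.Poly_Mapping"
begin

section \<open>Algebras, modules and quotients given by generators and relations\<close>

definition additive_map :: "('x::ab_group_add \<Rightarrow> 'y::ab_group_add) \<Rightarrow> bool" where
  "additive_map f \<longleftrightarrow> (\<forall>x y. f (x + y) = f x + f y)"

definition ring_map :: "('x::ring_1 \<Rightarrow> 'y::ring_1) \<Rightarrow> bool" where
  "ring_map f \<longleftrightarrow> additive_map f \<and> (\<forall>x y. f (x * y) = f x * f y) \<and> f 1 = 1"

definition additive_subgroup :: "'x::ab_group_add set \<Rightarrow> bool" where
  "additive_subgroup H \<longleftrightarrow> 0 \<in> H \<and> (\<forall>x\<in>H. \<forall>y\<in>H. x + y \<in> H) \<and> (\<forall>x\<in>H. - x \<in> H)"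

definition two_sided_ideal :: "'x::ring_1 set \<Rightarrow> bool" where
  "two_sided_ideal J \<longleftrightarrow> additive_subgroup J \<and> (\<forall>x\<in>J. \<forall>t. t * x \<in> J \<and> x * t \<in> J)"

text \<open>A complex algebra is a ring with a ring homomorphism from the complex numbers to its centre.\<close>

definition complex_algebra :: "(complex \<Rightarrow> 'b::ring_1) \<Rightarrow> bool" where
  "complex_algebra c \<longleftrightarrow> ring_map c \<and> (\<forall>z b. c z * b = b * c z)"

text \<open>Words form the free monoid, so \<open>'x list \<Rightarrow>\<^sub>0 complex\<close> is the free unital algebra on \<open>'x\<close>.\<close>

instantiation list :: (type) monoid_add
begin
definition zero_list_def: "0 = []"
definition plus_list_def: "xs + ys = xs @ ys"
instance by standard (simp_all add: zero_list_def plus_list_def)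
end

type_synonym 'x free_alg = "'x list \<Rightarrow>\<^sub>0 complex"

definition free_gen :: "'x \<Rightarrow> 'x free_alg" where
  "free_gen x = Poly_Mapping.single [x] 1"

definition free_const :: "complex \<Rightarrow> 'x free_alg" where
  "free_const z = Poly_Mapping.single [] z"

definition free_eval :: "(complex \<Rightarrow> 'b::ring_1) \<Rightarrow> ('x \<Rightarrow> 'b) \<Rightarrow> 'x free_alg \<Rightarrow> 'b" where
  "free_eval c gen f =
     (\<Sum>xs\<in>Poly_Mapping.keys f. c (Poly_Mapping.lookup f xs) * prod_list (map gen xs))"

definition presented_algebra ::
    "(complex \<Rightarrow> 'b::ring_1) \<Rightarrow> ('x \<Rightarrow> 'b) \<Rightarrow> 'x free_alg set \<Rightarrow> bool" where
  "presented_algebra c gen rels \<longleftrightarrow>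
     complex_algebra c \<and>
     (\<forall>b. \<exists>f. b = free_eval c gen f) \<and>
     (\<forall>f. free_eval c gen f = 0 \<longleftrightarrow> f \<in> two_sided_ideal hull rels)"

definition left_module :: "('b::ring_1 \<Rightarrow> 'x::ab_group_add \<Rightarrow> 'x) \<Rightarrow> bool" where
  "left_module l \<longleftrightarrow>
     (\<forall>b x y. l b (x + y) = l b x + l b y) \<and> (\<forall>b b' x. l (b + b') x = l b x + l b' x) \<and>
     (\<forall>b b' x. l (b * b') x = l b (l b' x)) \<and> (\<forall>x. l 1 x = x)"

definition right_module :: "('x::ab_group_add \<Rightarrow> 'b::ring_1 \<Rightarrow> 'x) \<Rightarrow> bool" where
  "right_module \<rho> \<longleftrightarrow>
     (\<forall>x y b. \<rho> (x + y) b = \<rho> x b + \<rho> y b) \<and> (\<forall>x b b'. \<rho> x (b + b') = \<rho> x b + \<rho> x b') \<and>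
     (\<forall>x b b'. \<rho> x (b * b') = \<rho> (\<rho> x b) b') \<and> (\<forall>x. \<rho> x 1 = x)"

text \<open>Bimodules over a complex algebra; scalars act in the same way from both sides.\<close>

definition bimodule ::
    "(complex \<Rightarrow> 'b::ring_1) \<Rightarrow> ('b \<Rightarrow> 'x::ab_group_add \<Rightarrow> 'x) \<Rightarrow> ('x \<Rightarrow> 'b \<Rightarrow> 'x) \<Rightarrow> bool" where
  "bimodule c l \<rho> \<longleftrightarrow> left_module l \<and> right_module \<rho> \<and>
     (\<forall>b x b'. \<rho> (l b x) b' = l b (\<rho> x b')) \<and> (\<forall>z x. l (c z) x = \<rho> x (c z))"

definition left_submodule :: "('b::ring_1 ^ 'g) set \<Rightarrow> bool" where
  "left_submodule M \<longleftrightarrow> additive_subgroup M \<and> (\<forall>b. \<forall>v\<in>M. b *s v \<in> M)"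

text \<open>The relations are vectors in the free left module \<open>'b ^ 'g\<close>.\<close>

definition presented_left_module ::
    "('b::ring_1 \<Rightarrow> 'x::ab_group_add \<Rightarrow> 'x) \<Rightarrow> ('g::finite \<Rightarrow> 'x) \<Rightarrow> ('b ^ 'g) set \<Rightarrow> bool" where
  "presented_left_module l gen rels \<longleftrightarrow>
     left_module l \<and>
     (\<forall>x. \<exists>v. x = (\<Sum>g\<in>UNIV. l (v $ g) (gen g))) \<and>
     (\<forall>v. (\<Sum>g\<in>UNIV. l (v $ g) (gen g)) = 0 \<longleftrightarrow> v \<in> left_submodule hull rels)"

definition derivation ::
    "(complex \<Rightarrow> 'b::ring_1) \<Rightarrow> ('b \<Rightarrow> 'x::ab_group_add \<Rightarrow> 'x) \<Rightarrow> ('x \<Rightarrow> 'b \<Rightarrow> 'x) \<Rightarrow> ('b \<Rightarrow> 'x) \<Rightarrow> bool" where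
  "derivation c l \<rho> D \<longleftrightarrow> additive_map D \<and> (\<forall>z. D (c z) = 0) \<and>
     (\<forall>b b'. D (b * b') = \<rho> (D b) b' + l b (D b'))"

text \<open>
  The tensor algebra of a bimodule with left action \<open>l\<close> and right action \<open>\<rho>\<close>.  The pair
  \<open>(b, [x\<^sub>1, \<dots>, x\<^sub>n])\<close> stands for the tensor \<open>b x\<^sub>1 \<otimes> x\<^sub>2 \<otimes> \<dots> \<otimes> x\<^sub>n\<close> of degree \<open>n\<close> (for the
  element \<open>b\<close> of the base ring if \<open>n = 0\<close>), and \<open>tensor_rels\<close> lists the defining relations of the
  balanced tensor powers inside the free abelian group on these pairs.
\<close>

abbreviation pure_tensor :: "'b \<Rightarrow> 'o list \<Rightarrow> ('b \<times> 'o list \<Rightarrow>\<^sub>0 int)" where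
  "pure_tensor b xs \<equiv> Poly_Mapping.single (b, xs) 1"

definition tensor_rels ::
    "('b::ring_1 \<Rightarrow> 'o::ab_group_add \<Rightarrow> 'o) \<Rightarrow> ('o \<Rightarrow> 'b \<Rightarrow> 'o) \<Rightarrow> ('b \<times> 'o list \<Rightarrow>\<^sub>0 int) set" where
  "tensor_rels l \<rho> =
     {pure_tensor (b + b') xs - pure_tensor b xs - pure_tensor b' xs | b b' xs. True} \<union>
     {pure_tensor b (xs @ (x + y) # ys) - pure_tensor b (xs @ x # ys) - pure_tensor b (xs @ y # ys)
        | b xs x y ys. True} \<union>
     {pure_tensor b (l b' x # xs) - pure_tensor (b * b') (x # xs) | b b' x xs. True} \<union>
     {pure_tensor b (xs @ \<rho> x b' # y # ys) - pure_tensor b (xs @ x # l b' y # ys)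
        | b b' xs x y ys. True}"

definition tensor_eval ::
    "('b::ring_1 \<Rightarrow> 't::ring_1) \<Rightarrow> ('o::ab_group_add \<Rightarrow> 't) \<Rightarrow> ('b \<times> 'o list \<Rightarrow>\<^sub>0 int) \<Rightarrow> 't" where
  "tensor_eval emb0 emb1 f =
     (\<Sum>(b, xs)\<in>Poly_Mapping.keys f.
        of_int (Poly_Mapping.lookup f (b, xs)) * (emb0 b * prod_list (map emb1 xs)))"

definition tensor_algebra ::
    "('b::ring_1 \<Rightarrow> 'o::ab_group_add \<Rightarrow> 'o) \<Rightarrow> ('o \<Rightarrow> 'b \<Rightarrow> 'o) \<Rightarrow> ('b \<Rightarrow> 't::ring_1) \<Rightarrow> ('o \<Rightarrow> 't) \<Rightarrow> bool" where
  "tensor_algebra l \<rho> emb0 emb1 \<longleftrightarrow>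
     ring_map emb0 \<and> additive_map emb1 \<and>
     (\<forall>b x. emb1 (l b x) = emb0 b * emb1 x) \<and> (\<forall>x b. emb1 (\<rho> x b) = emb1 x * emb0 b) \<and>
     (\<forall>t. \<exists>f. t = tensor_eval emb0 emb1 f) \<and>
     (\<forall>f. tensor_eval emb0 emb1 f = 0 \<longleftrightarrow> f \<in> additive_subgroup hull tensor_rels l \<rho>)"

definition tensor_square :: "('o \<Rightarrow> 't::ring_1) \<Rightarrow> 't set" where
  "tensor_square emb1 = additive_subgroup hull {emb1 x * emb1 y | x y. True}"

definition quotient_ring_map :: "('t::ring_1 \<Rightarrow> 'w::ring_1) \<Rightarrow> 't set \<Rightarrow> bool" where
  "quotient_ring_map proj gens \<longleftrightarrow>
     ring_map proj \<and> surj proj \<and> (\<forall>t. proj t = 0 \<longleftrightarrow> t \<in> two_sided_ideal hull gens)"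


section \<open>Weights of $\mathfrak{sl}_{r+1}$\<close>

text \<open>
  The (real) dual Cartan subalgebra is realised as the vectors of coordinate sum zero in
  $\mathbb{R}^{r+1}$, with coordinates numbered $1, \dots, r+1$ and the standard inner product.
  The Weyl group permutes the coordinates, and its longest element reverses their order.
\<close>

type_synonym weight = "nat \<Rightarrow> real"

definition weight_space :: "nat \<Rightarrow> weight set" where
  "weight_space r = {\<mu>. (\<forall>k. k \<notin> {1..r+1} \<longrightarrow> \<mu> k = 0) \<and> (\<Sum>k\<in>{1..r+1}. \<mu> k) = 0}"

definition wt_form :: "nat \<Rightarrow> weight \<Rightarrow> weight \<Rightarrow> real" where
  "wt_form r \<mu> \<nu> = (\<Sum>k\<in>{1..r+1}. \<mu> k * \<nu> k)"

definition simple_root :: "nat \<Rightarrow> weight" where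
  "simple_root i k = (if k = i then 1 else if k = i + 1 then -1 else 0)"

definition fund_weight :: "nat \<Rightarrow> nat \<Rightarrow> weight" where
  "fund_weight r i k =
     (if k \<in> {1..r+1} then (if k \<le> i then 1 else 0) - real i / real (r + 1) else 0)"

definition rho_weight :: "nat \<Rightarrow> weight" where
  "rho_weight r k = (\<Sum>i\<in>{1..r}. fund_weight r i k)"

definition w0_act :: "nat \<Rightarrow> weight \<Rightarrow> weight" where
  "w0_act r \<mu> k = (if k \<in> {1..r+1} then \<mu> (r + 2 - k) else 0)"

definition neg_weight :: "weight \<Rightarrow> weight" where
  "neg_weight \<mu> k = - \<mu> k"

lemma wt_form_simple_root:
  assumes "i \<in> {1..r}"
  shows "wt_form r (simple_root i) \<mu> = \<mu> i - \<mu> (i + 1)"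
proof -
  have "wt_form r (simple_root i) \<mu> = (\<Sum>k\<in>{1..r+1}. (if k = i then \<mu> k else 0) - (if k = i + 1 then \<mu> k else 0))"
    unfolding wt_form_def by (rule sum.cong) (auto simp: simple_root_def)
  then show ?thesis
    using assms by (simp add: sum_subtractf)
qed

lemma wt_form_simple_root_fund_weight:
  assumes "i \<in> {1..r}"
  shows "wt_form r (simple_root i) (fund_weight r k) = (if i = k then 1 else 0)"
  using assms by (auto simp: wt_form_simple_root fund_weight_def)


section \<open>Modules over $U_q(\mathfrak{sl}_{r+1})$\<close>

text \<open>
  A module structure on \<open>complex ^ 'i\<close> is given by the matrices of the generators
  $K_i, K_i^{-1}, E_i, F_i$, where $1 \le i \le r$.
\<close>

record ('i::finite) uq_mod =
  uK :: "nat \<Rightarrow> complex ^ 'i ^ 'i"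
  uKinv :: "nat \<Rightarrow> complex ^ 'i ^ 'i"
  uE :: "nat \<Rightarrow> complex ^ 'i ^ 'i"
  uF :: "nat \<Rightarrow> complex ^ 'i ^ 'i"

definition uq_module :: "nat \<Rightarrow> real \<Rightarrow> ('i::finite) uq_mod \<Rightarrow> bool" where
  "uq_module r q X \<longleftrightarrow> (\<forall>i\<in>{1..r}.
     uK X i ** uKinv X i = mat 1 \<and> uKinv X i ** uK X i = mat 1 \<and>
     (\<forall>j\<in>{1..r}.
        uK X i ** uK X j = uK X j ** uK X i \<and>
        uK X i ** uE X j ** uKinv X i
          = q powr wt_form r (simple_root i) (simple_root j) *\<^sub>R uE X j \<and>
        uK X i ** uF X j ** uKinv X i
          = q powr (- wt_form r (simple_root i) (simple_root j)) *\<^sub>R uF X j \<and>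
        uE X i ** uF X j - uF X j ** uE X i
          = (if i = j then (1 / (q - 1 / q)) *\<^sub>R (uK X i - uKinv X i) else 0) \<and>
        (i = j + 1 \<or> j = i + 1 \<longrightarrow>
           uE X i ** uE X i ** uE X j - (q + 1 / q) *\<^sub>R (uE X i ** uE X j ** uE X i)
             + uE X j ** uE X i ** uE X i = 0 \<and>
           uF X i ** uF X i ** uF X j - (q + 1 / q) *\<^sub>R (uF X i ** uF X j ** uF X i)
             + uF X j ** uF X i ** uF X i = 0) \<and>
        (i > j + 1 \<or> j > i + 1 \<longrightarrow>
           uE X i ** uE X j = uE X j ** uE X i \<and> uF X i ** uF X j = uF X j ** uF X i)))"

text \<open>Matrix of \<open>A \<otimes> B\<close>; the index of \<open>x\<^sub>i \<otimes> y\<^sub>j\<close> is \<open>(i, j)\<close>.\<close>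

definition kron :: "complex ^ 'i ^ 'i \<Rightarrow> complex ^ 'j ^ 'j \<Rightarrow> complex ^ ('i \<times> 'j) ^ ('i \<times> 'j)" where
  "kron A B = (\<chi> a b. A $ fst a $ fst b * B $ snd a $ snd b)"

definition tensor_vec :: "complex ^ 'i \<Rightarrow> complex ^ 'j \<Rightarrow> complex ^ ('i \<times> 'j)" where
  "tensor_vec x y = (\<chi> a. x $ fst a * y $ snd a)"

definition uq_tensor :: "('i::finite) uq_mod \<Rightarrow> ('j::finite) uq_mod \<Rightarrow> ('i \<times> 'j) uq_mod" where
  "uq_tensor X Y =
     \<lparr> uK = \<lambda>i. kron (uK X i) (uK Y i),
       uKinv = \<lambda>i. kron (uKinv X i) (uKinv Y i),
       uE = \<lambda>i. kron (uE X i) (uK Y i) + kron (mat 1) (uE Y i),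
       uF = \<lambda>i. kron (uF X i) (mat 1) + kron (uKinv X i) (uF Y i) \<rparr>"

text \<open>
  The dual module in the dual basis, where an algebra element acts by the transpose of its
  antipode: $S(K_i) = K_i^{-1}$, $S(E_i) = -E_i K_i^{-1}$, $S(F_i) = -K_i F_i$.
\<close>

definition uq_dual :: "('i::finite) uq_mod \<Rightarrow> 'i uq_mod" where
  "uq_dual X =
     \<lparr> uK = \<lambda>i. transpose (uKinv X i),
       uKinv = \<lambda>i. transpose (uK X i),
       uE = \<lambda>i. transpose (- (uE X i ** uKinv X i)),
       uF = \<lambda>i. transpose (- (uK X i ** uF X i)) \<rparr>"

definition weight_vector ::
    "nat \<Rightarrow> real \<Rightarrow> ('i::finite) uq_mod \<Rightarrow> weight \<Rightarrow> complex ^ 'i \<Rightarrow> bool" where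
  "weight_vector r q X \<mu> v \<longleftrightarrow> v \<noteq> 0 \<and>
     (\<forall>i\<in>{1..r}. uK X i *v v = complex_of_real (q powr wt_form r (simple_root i) \<mu>) *s v)"

definition highest_weight_vector ::
    "nat \<Rightarrow> real \<Rightarrow> ('i::finite) uq_mod \<Rightarrow> weight \<Rightarrow> complex ^ 'i \<Rightarrow> bool" where
  "highest_weight_vector r q X \<mu> v \<longleftrightarrow> weight_vector r q X \<mu> v \<and> (\<forall>i\<in>{1..r}. uE X i *v v = 0)"

definition lowest_weight_vector ::
    "nat \<Rightarrow> real \<Rightarrow> ('i::finite) uq_mod \<Rightarrow> weight \<Rightarrow> complex ^ 'i \<Rightarrow> bool" where
  "lowest_weight_vector r q X \<mu> v \<longleftrightarrow> weight_vector r q X \<mu> v \<and> (\<forall>i\<in>{1..r}. uF X i *v v = 0)"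

definition simple_uq_module :: "nat \<Rightarrow> real \<Rightarrow> ('i::finite) uq_mod \<Rightarrow> bool" where
  "simple_uq_module r q X \<longleftrightarrow> uq_module r q X \<and>
     (\<forall>W. vec.subspace W \<and>
        (\<forall>i\<in>{1..r}. \<forall>v\<in>W. uK X i *v v \<in> W \<and> uKinv X i *v v \<in> W \<and> uE X i *v v \<in> W \<and> uF X i *v v \<in> W)
        \<longrightarrow> W = {0} \<or> W = UNIV)"

text \<open>
  The module is the simple type 1 module of highest weight \<open>\<mu>\<close> up to isomorphism; type 1 is
  part of \<open>weight_vector\<close>, where $K_i$ has the positive eigenvalue $q^{(\alpha_i, \mu)}$.
\<close>

definition is_simple_hw_module :: "nat \<Rightarrow> real \<Rightarrow> weight \<Rightarrow> ('i::finite) uq_mod \<Rightarrow> bool" where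
  "is_simple_hw_module r q \<mu> X \<longleftrightarrow>
     simple_uq_module r q X \<and> (\<exists>v. highest_weight_vector r q X \<mu> v)"

definition uq_module_map ::
    "nat \<Rightarrow> ('i::finite) uq_mod \<Rightarrow> ('j::finite) uq_mod \<Rightarrow> complex ^ 'i ^ 'j \<Rightarrow> bool" where
  "uq_module_map r X Y A \<longleftrightarrow> (\<forall>i\<in>{1..r}.
     A ** uK X i = uK Y i ** A \<and> A ** uKinv X i = uKinv Y i ** A \<and>
     A ** uE X i = uE Y i ** A \<and> A ** uF X i = uF Y i ** A)"

text \<open>
  The braiding \<open>X \<otimes> Y \<rightarrow> Y \<otimes> X\<close> of simple modules \<open>X\<close>, \<open>Y\<close> of highest weights \<open>\<mu>\<close>, \<open>\<nu>\<close>.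
\<close>

definition braiding ::
    "nat \<Rightarrow> real \<Rightarrow> weight \<Rightarrow> ('i::finite) uq_mod \<Rightarrow> weight \<Rightarrow> ('j::finite) uq_mod
     \<Rightarrow> complex ^ ('i \<times> 'j) ^ ('j \<times> 'i)" where
  "braiding r q \<mu> X \<nu> Y = (THE R. uq_module_map r (uq_tensor X Y) (uq_tensor Y X) R \<and>
     (\<forall>v u. highest_weight_vector r q X \<mu> v \<longrightarrow> lowest_weight_vector r q Y (w0_act r \<nu>) u \<longrightarrow>
        R *v tensor_vec v u
          = complex_of_real (q powr wt_form r \<mu> (w0_act r \<nu>)) *s tensor_vec u v))"


section \<open>Leg notation\<close>

definition leg12 :: "complex ^ ('n::finite \<times> 'n) ^ ('n \<times> 'n) \<Rightarrow> complex ^ ('n \<times> 'n \<times> 'n) ^ ('n \<times> 'n \<times> 'n)" where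
  "leg12 A = (\<chi> x y. case (x, y) of ((i, j, k), (i', j', k')) \<Rightarrow>
                 A $ (i, j) $ (i', j') * (if k = k' then 1 else 0))"

definition leg23 :: "complex ^ ('n::finite \<times> 'n) ^ ('n \<times> 'n) \<Rightarrow> complex ^ ('n \<times> 'n \<times> 'n) ^ ('n \<times> 'n \<times> 'n)" where
  "leg23 A = (\<chi> x y. case (x, y) of ((i, j, k), (i', j', k')) \<Rightarrow>
                 (if i = i' then 1 else 0) * A $ (j, k) $ (j', k'))"

text \<open>
  A family \<open>x\<close> with four indices stands for $\sum v_i \otimes f^j \otimes v_k \otimes f^l \otimes x^{ijkl}$.
  Operators on three of the legs act on such families; \<open>sc\<close> is the scalar multiplication of
  the space in which the components live.
\<close>

type_synonym ('n, 'm) fam2 = "'n \<Rightarrow> 'n \<Rightarrow> 'm"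
type_synonym ('n, 'm) fam4 = "'n \<Rightarrow> 'n \<Rightarrow> 'n \<Rightarrow> 'n \<Rightarrow> 'm"

definition act123 ::
    "(complex \<Rightarrow> 'm \<Rightarrow> 'm::ab_group_add) \<Rightarrow> complex ^ ('n::finite \<times> 'n \<times> 'n) ^ ('n \<times> 'n \<times> 'n)
     \<Rightarrow> ('n, 'm) fam4 \<Rightarrow> ('n, 'm) fam4" where
  "act123 sc A x = (\<lambda>i j k l. \<Sum>(i', j', k')\<in>UNIV. sc (A $ (i, j, k) $ (i', j', k')) (x i' j' k' l))"

definition act234 ::
    "(complex \<Rightarrow> 'm \<Rightarrow> 'm::ab_group_add) \<Rightarrow> complex ^ ('n::finite \<times> 'n \<times> 'n) ^ ('n \<times> 'n \<times> 'n)
     \<Rightarrow> ('n, 'm) fam4 \<Rightarrow> ('n, 'm) fam4" where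
  "act234 sc A x = (\<lambda>i j k l. \<Sum>(j', k', l')\<in>UNIV. sc (A $ (j, k, l) $ (j', k', l')) (x i j' k' l'))"

text \<open>Contraction of the second and third leg by the evaluation pairing $V^* \otimes V \to \mathbb{C}$.\<close>

definition contractE23 :: "('n::finite, 'm::ab_group_add) fam4 \<Rightarrow> ('n, 'm) fam2" where
  "contractE23 x = (\<lambda>i l. \<Sum>j\<in>UNIV. x i j j l)"


section \<open>The quantized algebra of functions\<close>

text \<open>
  \<open>V\<close> is $V(\omega_s)$, written in a weight basis indexed by the type \<open>'n\<close> with \<open>r + 1\<close> elements;
  \<open>lam i\<close> is the weight of the basis vector \<open>i\<close>.
\<close>

locale qps_data =
  fixes r s :: nat and q :: real and V :: "('n::finite) uq_mod" and lam :: "'n \<Rightarrow> weight"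
  assumes r_ge_1: "1 \<le> r"
    and s_cases: "s \<in> {1, r}"
    and q_pos: "0 < q" and q_less_1: "q < 1"
    and card_index: "CARD('n) = r + 1"
    and V_simple: "is_simple_hw_module r q (fund_weight r s) V"
    and lam_mem: "lam i \<in> weight_space r"
    and basis_weight: "weight_vector r q V (lam i) (axis i 1)"
begin

definition a :: real where "a = wt_form r (simple_root s) (simple_root s)"
definition w :: real where "w = wt_form r (fund_weight r s) (fund_weight r s)"
definition m :: real where "m = 2 * wt_form r (fund_weight r s) (rho_weight r)"

definition qexp :: "real \<Rightarrow> complex" where "qexp e = complex_of_real (q powr e)"

text \<open>The highest weight of the dual module \<open>uq_dual V\<close>.\<close>

definition dual_hw :: weight where "dual_hw = neg_weight (w0_act r (fund_weight r s))"

definition R_VV :: "complex ^ ('n \<times> 'n) ^ ('n \<times> 'n)" where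
  "R_VV = braiding r q (fund_weight r s) V (fund_weight r s) V"

definition R_VD :: "complex ^ ('n \<times> 'n) ^ ('n \<times> 'n)" where
  "R_VD = braiding r q (fund_weight r s) V dual_hw (uq_dual V)"

definition R_DD :: "complex ^ ('n \<times> 'n) ^ ('n \<times> 'n)" where
  "R_DD = braiding r q dual_hw (uq_dual V) dual_hw (uq_dual V)"

definition S :: "complex ^ ('n \<times> 'n \<times> 'n) ^ ('n \<times> 'n \<times> 'n)" where
  "S = leg23 R_VD ** leg12 R_VV ** leg23 (matrix_inv R_VD)"

text \<open>The three legs of \<open>St\<close> are numbered 2, 3, 4 in its applications.\<close>

definition St :: "complex ^ ('n \<times> 'n \<times> 'n) ^ ('n \<times> 'n \<times> 'n)" where
  "St = leg12 R_VD ** leg23 (matrix_inv R_DD) ** leg12 (matrix_inv R_VD)"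

definition actT :: "(complex \<Rightarrow> 'm \<Rightarrow> 'm::ab_group_add) \<Rightarrow> ('n, 'm) fam4 \<Rightarrow> ('n, 'm) fam4" where
  "actT sc x = act123 sc S (act234 sc St x)"

definition contractE' :: "(complex \<Rightarrow> 'm \<Rightarrow> 'm::ab_group_add) \<Rightarrow> ('n, 'm) fam2 \<Rightarrow> 'm" where
  "contractE' sc x = (\<Sum>i\<in>UNIV. sc (qexp (2 * wt_form r (lam i) (rho_weight r))) (x i i))"

definition free_scale :: "complex \<Rightarrow> ('n \<times> 'n) free_alg \<Rightarrow> ('n \<times> 'n) free_alg" where
  "free_scale z f = free_const z * f"

definition alg_rels :: "('n \<times> 'n) free_alg set" where
  "alg_rels =
     (let P = (\<lambda>i j. free_gen (i, j)); PP = (\<lambda>i j k l. P i j * P k l) in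
      {act123 free_scale S PP i j k l - free_scale (qexp w) (PP i j k l) | i j k l. True} \<union>
      {act234 free_scale St PP i j k l - free_scale (qexp (- w)) (PP i j k l) | i j k l. True} \<union>
      {contractE' free_scale P - free_const (qexp m)})"

end

section \<open>The first-order calculus\<close>

text \<open>
  The algebra $\mathcal B$ is any algebra \<open>'b\<close> with the given presentation, hence it is fixed up to
  isomorphism; the modules, tensor algebra and universal calculus below are treated likewise.
\<close>

locale qps_algebra = qps_data r s q V lam
  for r s :: nat and q :: real and V :: "('n::finite) uq_mod" and lam :: "'n \<Rightarrow> weight" +
  fixes c :: "complex \<Rightarrow> 'b::ring_1" and p :: "'n \<Rightarrow> 'n \<Rightarrow> 'b"
  assumes B_presented: "presented_algebra c (\<lambda>(i, j). p i j) alg_rels"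
begin

text \<open>
  Relations of the two left modules, as vectors in the free left module with basis
  \<open>form_gen i j\<close>, which is mapped to the generator $\partial p^{ij}$ (or $\bar\partial p^{ij}$).
\<close>

definition form_gen :: "'n \<Rightarrow> 'n \<Rightarrow> 'b ^ ('n \<times> 'n)" where
  "form_gen i j = axis (i, j) 1"

definition form_scale :: "complex \<Rightarrow> 'b ^ ('n \<times> 'n) \<Rightarrow> 'b ^ ('n \<times> 'n)" where
  "form_scale z v = c z *s v"

definition plus_rels :: "('b ^ ('n \<times> 'n)) set" where
  "plus_rels =
     (let PD = (\<lambda>i j k l. p i j *s form_gen k l) in
      {act234 form_scale St PD i j k l - form_scale (qexp (- w)) (PD i j k l) | i j k l. True} \<union>
      {contractE' form_scale form_gen})"

definition minus_rels :: "('b ^ ('n \<times> 'n)) set" where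
  "minus_rels =
     (let PD = (\<lambda>i j k l. p i j *s form_gen k l) in
      {act123 form_scale S PD i j k l - form_scale (qexp w) (PD i j k l) | i j k l. True} \<union>
      {contractE' form_scale form_gen})"

end

text \<open>
  The right actions \<open>rP\<close>, \<open>rM\<close> and the derivations \<open>dP\<close>, \<open>dM\<close> are unique, since the values
  \<open>p i j\<close> generate the algebra.
\<close>

locale hk_calculus = qps_algebra r s q V lam c p
  for r s :: nat and q :: real and V :: "('n::finite) uq_mod" and lam :: "'n \<Rightarrow> weight"
    and c :: "complex \<Rightarrow> 'b::ring_1" and p :: "'n \<Rightarrow> 'n \<Rightarrow> 'b" +
  fixes lP :: "'b \<Rightarrow> 'u::ab_group_add \<Rightarrow> 'u" and rP :: "'u \<Rightarrow> 'b \<Rightarrow> 'u" and dP :: "'b \<Rightarrow> 'u"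
    and lM :: "'b \<Rightarrow> 'v::ab_group_add \<Rightarrow> 'v" and rM :: "'v \<Rightarrow> 'b \<Rightarrow> 'v" and dM :: "'b \<Rightarrow> 'v"
  assumes plus_presented: "presented_left_module lP (\<lambda>(i, j). dP (p i j)) plus_rels"
    and plus_bimodule: "bimodule c lP rP"
    and plus_right: "rP (dP (p i j)) (p k l)
           = lP (c (qexp a)) (actT (\<lambda>z. lP (c z)) (\<lambda>i j k l. lP (p i j) (dP (p k l))) i j k l)"
    and plus_derivation: "derivation c lP rP dP"
    and minus_presented: "presented_left_module lM (\<lambda>(i, j). dM (p i j)) minus_rels"
    and minus_bimodule: "bimodule c lM rM"
    and minus_right: "rM (dM (p i j)) (p k l)
           = lM (c (qexp (- a))) (actT (\<lambda>z. lM (c z)) (\<lambda>i j k l. lM (p i j) (dM (p k l))) i j k l)"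
    and minus_derivation: "derivation c lM rM dM"
begin

text \<open>The bimodule $\Omega = \Omega_+ \oplus \Omega_-$ and $\mathrm{d} = \partial + \bar\partial$.\<close>

definition lO :: "'b \<Rightarrow> 'u \<times> 'v \<Rightarrow> 'u \<times> 'v" where "lO b x = (lP b (fst x), lM b (snd x))"
definition rO :: "'u \<times> 'v \<Rightarrow> 'b \<Rightarrow> 'u \<times> 'v" where "rO x b = (rP (fst x) b, rM (snd x) b)"
definition del :: "'b \<Rightarrow> 'u \<times> 'v" where "del b = (dP b, 0)"
definition delbar :: "'b \<Rightarrow> 'u \<times> 'v" where "delbar b = (0, dM b)"
definition d :: "'b \<Rightarrow> 'u \<times> 'v" where "d b = del b + delbar b"

end


section \<open>The universal calculus and the generalized braiding\<close>

text \<open>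
  \<open>'t\<close> is the tensor algebra of $\Omega$, with embeddings \<open>emb0\<close> of the base algebra and \<open>emb1\<close> of
  $\Omega$; its degree two part \<open>tensor_square emb1\<close> is $\Omega \otimes_{\mathcal B} \Omega$.
  The map \<open>proj\<close> is the projection onto the universal calculus \<open>'w\<close>, so its restriction to
  \<open>tensor_square emb1\<close> is the product \<open>\<and>\<close> of one-forms.
\<close>

locale universal_calculus = hk_calculus r s q V lam c p lP rP dP lM rM dM
  for r s :: nat and q :: real and V :: "('n::finite) uq_mod" and lam :: "'n \<Rightarrow> weight"
    and c :: "complex \<Rightarrow> 'b::ring_1" and p :: "'n \<Rightarrow> 'n \<Rightarrow> 'b"
    and lP :: "'b \<Rightarrow> 'u::ab_group_add \<Rightarrow> 'u" and rP :: "'u \<Rightarrow> 'b \<Rightarrow> 'u" and dP :: "'b \<Rightarrow> 'u"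
    and lM :: "'b \<Rightarrow> 'v::ab_group_add \<Rightarrow> 'v" and rM :: "'v \<Rightarrow> 'b \<Rightarrow> 'v" and dM :: "'b \<Rightarrow> 'v" +
  fixes emb0 :: "'b \<Rightarrow> 't::ring_1" and emb1 :: "'u \<times> 'v \<Rightarrow> 't" and proj :: "'t \<Rightarrow> 'w::ring_1"
  assumes T_tensor_algebra: "tensor_algebra lO rO emb0 emb1"
    and pi_quotient: "quotient_ring_map proj
          {\<Sum>(x, y)\<leftarrow>xs. emb1 (d x) * emb1 (d y) | xs. (\<Sum>(x, y)\<leftarrow>xs. lO x (d y)) = 0}"
begin

definition t_scale :: "complex \<Rightarrow> 't \<Rightarrow> 't" where "t_scale z x = emb0 (c z) * x"

definition del_del :: "('n, 't) fam4" where
  "del_del = (\<lambda>i1 i2 i3 i4. emb1 (del (p i1 i2)) * emb1 (del (p i3 i4)))"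
definition delbar_delbar :: "('n, 't) fam4" where
  "delbar_delbar = (\<lambda>i1 i2 i3 i4. emb1 (delbar (p i1 i2)) * emb1 (delbar (p i3 i4)))"
definition del_delbar :: "('n, 't) fam4" where
  "del_delbar = (\<lambda>i1 i2 i3 i4. emb1 (del (p i1 i2)) * emb1 (delbar (p i3 i4)))"
definition delbar_del :: "('n, 't) fam4" where
  "delbar_del = (\<lambda>i1 i2 i3 i4. emb1 (delbar (p i1 i2)) * emb1 (del (p i3 i4)))"

definition g_plus_minus :: 't where
  "g_plus_minus = contractE' t_scale (contractE23 del_delbar)"
definition g_minus_plus :: 't where
  "g_minus_plus = contractE' t_scale (contractE23 delbar_del)"

end

locale generalized_braiding =
  universal_calculus r s q V lam c p lP rP dP lM rM dM emb0 emb1 proj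
  for r s :: nat and q :: real and V :: "('n::finite) uq_mod" and lam :: "'n \<Rightarrow> weight"
    and c :: "complex \<Rightarrow> 'b::ring_1" and p :: "'n \<Rightarrow> 'n \<Rightarrow> 'b"
    and lP :: "'b \<Rightarrow> 'u::ab_group_add \<Rightarrow> 'u" and rP :: "'u \<Rightarrow> 'b \<Rightarrow> 'u" and dP :: "'b \<Rightarrow> 'u"
    and lM :: "'b \<Rightarrow> 'v::ab_group_add \<Rightarrow> 'v" and rM :: "'v \<Rightarrow> 'b \<Rightarrow> 'v" and dM :: "'b \<Rightarrow> 'v"
    and emb0 :: "'b \<Rightarrow> 't::ring_1" and emb1 :: "'u \<times> 'v \<Rightarrow> 't" and proj :: "'t \<Rightarrow> 'w::ring_1" +
  fixes \<sigma> :: "'t \<Rightarrow> 't"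
  assumes sigma_mem: "\<xi> \<in> tensor_square emb1 \<Longrightarrow> \<sigma> \<xi> \<in> tensor_square emb1"
    and sigma_add: "\<xi> \<in> tensor_square emb1 \<Longrightarrow> \<eta> \<in> tensor_square emb1 \<Longrightarrow> \<sigma> (\<xi> + \<eta>) = \<sigma> \<xi> + \<sigma> \<eta>"
    and sigma_left: "\<xi> \<in> tensor_square emb1 \<Longrightarrow> \<sigma> (emb0 x * \<xi>) = emb0 x * \<sigma> \<xi>"
    and sigma_right: "\<xi> \<in> tensor_square emb1 \<Longrightarrow> \<sigma> (\<xi> * emb0 x) = \<sigma> \<xi> * emb0 x"
    and sigma_del_del: "\<sigma> (del_del i1 i2 i3 i4)
          = t_scale (qexp a) (act123 t_scale S (act234 t_scale St del_del) i1 i2 i3 i4)"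
    and sigma_delbar_delbar: "\<sigma> (delbar_delbar i1 i2 i3 i4)
          = t_scale (qexp (- a)) (act123 t_scale S (act234 t_scale St delbar_delbar) i1 i2 i3 i4)"
    and sigma_del_delbar: "\<sigma> (del_delbar i1 i2 i3 i4)
          = t_scale (qexp (2 * a - 2 * w))
              (act123 t_scale S (act234 t_scale (matrix_inv St) delbar_del) i1 i2 i3 i4)
            + t_scale ((1 - qexp a) * qexp a * qexp (- m)) (emb0 (p i1 i2) * g_minus_plus * emb0 (p i3 i4))"
    and sigma_delbar_del: "\<sigma> (delbar_del i1 i2 i3 i4)
          = t_scale (qexp (2 * w - 2 * a))
              (act123 t_scale (matrix_inv S) (act234 t_scale St del_delbar) i1 i2 i3 i4)
            + t_scale ((1 - qexp (- a)) * qexp (- m)) (emb0 (p i1 i2) * g_plus_minus * emb0 (p i3 i4))"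

end

theory Submission
  imports Defs "HOL-Library.Function_Algebras"
begin

text \<open>
  Write \<open>p\<close>, \<open>\<partial>p\<close>, \<open>\<partial>'p\<close> for the families of generators, \<open>\<partial>'\<close> being the antiholomorphic derivation, and
  \<open>E\<^sub>2\<^sub>3\<close> for the evaluation of the second leg on the third.  The idea is that contraction with \<open>p\<close>
  tells the two types of one-forms apart: \<open>E\<^sub>2\<^sub>3 p \<partial>'p = \<partial>'p\<close> and \<open>E\<^sub>2\<^sub>3 p \<partial>p = 0\<close>, while from the right
  \<open>E\<^sub>2\<^sub>3 \<partial>p p = \<partial>p\<close> and \<open>E\<^sub>2\<^sub>3 \<partial>'p p = 0\<close>.  In particular \<open>\<partial>'p = E\<^sub>2\<^sub>3 p dp\<close>, so that \<open>\<Theta> = E\<^sub>2\<^sub>3 dp dp\<close> is the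
  differential of \<open>\<partial>'p\<close> and \<open>- \<Theta>\<close> that of \<open>\<partial>p\<close>.

  In the universal calculus every relation between one-forms may be differentiated.  This gives
  relations between two-forms of mixed type.  Since \<open>S'\<close> (the operator \<open>St\<close>) acts on legs 2, 3, 4, it
  commutes with contraction of the first leg with \<open>p\<close>, and \<open>S\<close> commutes with contraction of the
  fourth leg; these contractions split the relations by type.  With \<open>\<alpha> = E\<^sub>2\<^sub>3 \<partial>p \<partial>'p\<close> and
  \<open>\<beta> = E\<^sub>2\<^sub>3 \<partial>'p \<partial>p\<close> one gets \<open>\<Theta> = \<alpha> + \<beta>\<close> and expresses \<open>\<partial>p \<partial>'p\<close> through \<open>S p \<alpha>\<close> and also through the
  inverse of \<open>S'\<close> applied to \<open>\<alpha> p\<close>.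

  What is left are two identities, each equating an expression in \<open>\<partial>p \<partial>p\<close> (or \<open>\<partial>'p \<partial>'p\<close>) with one in
  \<open>\<partial>'p \<partial>p\<close>, \<open>\<alpha>\<close>, \<open>\<beta>\<close>.  To see that both sides vanish one uses the identity
  \<open>E\<^sub>2\<^sub>3 S\<^sub>3\<^sub>4\<^sub>5 = E\<^sub>4\<^sub>5 S'\<^sub>2\<^sub>3\<^sub>4\<^sup>-\<^sup>1\<close> together with the Hecke relations of \<open>S\<close> and \<open>S'\<close>.  It first yields
  \<open>p \<beta> = \<beta> p\<close>, whence \<open>\<beta>\<close> is a multiple of \<open>p g\<close> with the metric component \<open>g\<close>, and then a
  formula for \<open>\<partial>'p \<partial>p\<close>; the four formulas defining \<open>\<sigma>\<close> are exactly the resulting relations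
  (\<open>hk_relations.wedge_UU\<close>, \<open>wedge_WW\<close>, \<open>wedge_UW\<close>, \<open>wedge_WU\<close>).

  The properties of \<open>S\<close> and \<open>S'\<close> come from explicit braidings.  The vectors obtained from the highest
  weight vector of \<open>V\<close> by a chain of \<open>F\<close>s have \<open>r + 1\<close> different weights, so they exhaust \<open>V\<close>
  (\<open>qps_data.V_chain\<close>).  A highest weight vector tensored with a lowest weight vector generates the
  tensor product, hence a braiding is known once some module map with the right value there
  is found (\<open>braiding_eqI\<close>).  This identifies the braidings on \<open>V \<otimes> V\<close> and \<open>V* \<otimes> V*\<close> with Hecke
  matrices, and the inverse of the one on \<open>V \<otimes> V*\<close> with a partial transpose of them.
\<close>

section \<open>Families and their contractions\<close>

text \<open>
  Scalars act on the components of a family through a ring homomorphism into the ring of components.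
\<close>
abbreviation left_mult :: "(complex \<Rightarrow> 'm::ring_1) \<Rightarrow> complex \<Rightarrow> 'm \<Rightarrow> 'm" where
  "left_mult sc \<equiv> (\<lambda>z. (*) (sc z))"

definition tens :: "('n, 'm::ring_1) fam2 \<Rightarrow> ('n, 'm) fam2 \<Rightarrow> ('n, 'm) fam4" where
  "tens x y = (\<lambda>i j k l. x i j * y k l)"

text \<open>
  Index-free, \<open>left_contract x X\<close> is \<open>E\<^sub>2\<^sub>3 x X\<close> with the legs 1, 4, 5, 6 left over, and
  \<open>right_contract X y\<close> is \<open>E\<^sub>4\<^sub>5 X y\<close> with the legs 1, 2, 3, 6 left over.
\<close>

definition left_contract :: "('n::finite, 'm::ring_1) fam2 \<Rightarrow> ('n, 'm) fam4 \<Rightarrow> ('n, 'm) fam4" where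
  "left_contract x X = (\<lambda>i j k l. \<Sum>h\<in>UNIV. x i h * X h j k l)"

definition right_contract :: "('n::finite, 'm::ring_1) fam4 \<Rightarrow> ('n, 'm) fam2 \<Rightarrow> ('n, 'm) fam4" where
  "right_contract X y = (\<lambda>i j k l. \<Sum>h\<in>UNIV. X i j k h * y h l)"

lemma left_contract_tens: "left_contract x (tens y z) = tens (contractE23 (tens x y)) z"
  by (simp add: tens_def left_contract_def contractE23_def sum_distrib_right mult.assoc)

lemma right_contract_tens: "right_contract (tens x y) z = tens x (contractE23 (tens y z))"
  by (simp add: tens_def right_contract_def contractE23_def sum_distrib_left mult.assoc)

lemma contract_contract:
  "contractE23 (tens (contractE23 (tens x y)) z) = contractE23 (tens x (contractE23 (tens y z)))"
proof (intro ext)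
  fix i l
  show "contractE23 (tens (contractE23 (tens x y)) z) i l = contractE23 (tens x (contractE23 (tens y z))) i l"
    unfolding tens_def contractE23_def sum_distrib_left sum_distrib_right mult.assoc
    by (rule sum.swap)
qed

lemma left_contract_linear:
  "left_contract x (X + Y) = left_contract x X + left_contract x Y"
  "left_contract x (X - Y) = left_contract x X - left_contract x Y"
  by (auto simp: left_contract_def fun_eq_iff algebra_simps sum.distrib sum_subtractf)

lemma right_contract_linear:
  "right_contract (X + Y) y = right_contract X y + right_contract Y y"
  "right_contract (X - Y) y = right_contract X y - right_contract Y y"
  by (auto simp: right_contract_def fun_eq_iff algebra_simps sum.distrib sum_subtractf)

lemma contractE23_linear:
  "contractE23 (X + Y) = contractE23 X + contractE23 Y"
  "contractE23 (X - Y) = contractE23 X - contractE23 Y"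
  by (auto simp: contractE23_def fun_eq_iff sum.distrib sum_subtractf)

lemma tens_linear:
  "tens (x + y) z = tens x z + tens y z" "tens (x - y) z = tens x z - tens y z"
  "tens x (y + z) = tens x y + tens x z" "tens x (y - z) = tens x y - tens x z"
  "tens 0 z = 0" "tens x 0 = 0"
  by (auto simp: tens_def fun_eq_iff algebra_simps)

lemma ring_map_simps:
  assumes "ring_map sc"
  shows "sc (x + y) = sc x + sc y" "sc (x * y) = sc x * sc y" "sc 1 = 1" "sc 0 = 0"
    "sc (- x) = - sc x" "sc (x - y) = sc x - sc y" "sc (sum f A) = (\<Sum>a\<in>A. sc (f a))"
proof -
  show *: "sc (x + y) = sc x + sc y" "sc (x * y) = sc x * sc y" "sc 1 = 1" for x y
    using assms by (auto simp: ring_map_def additive_map_def)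
  show 0: "sc 0 = 0" using *(1)[of 0 0] by simp
  show m: "sc (- x) = - sc x" for x using *(1)[of x "- x"] 0 by (simp add: eq_neg_iff_add_eq_0 add.commute)
  show "sc (x - y) = sc x - sc y" using *(1)[of x "- y"] m by simp
  show "sc (sum f A) = (\<Sum>a\<in>A. sc (f a))"
    by (induction A rule: infinite_finite_induct) (auto simp: * 0)
qed

lemma act123_comp:
  fixes X :: "('n::finite, 'm::ring_1) fam4"
  assumes "ring_map sc"
  shows "act123 (left_mult sc) A (act123 (left_mult sc) B X) = act123 (left_mult sc) (A ** B) X"
proof (intro ext)
  fix i j k l
  let ?Y = "\<lambda>y. X (fst y) (fst (snd y)) (snd (snd y)) l"
  have "act123 (left_mult sc) A (act123 (left_mult sc) B X) i j k l
      = (\<Sum>x\<in>UNIV. \<Sum>y\<in>UNIV. sc (A $ (i, j, k) $ x) * (sc (B $ x $ y) * ?Y y))"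
    by (simp add: act123_def case_prod_unfold sum_distrib_left)
  also have "\<dots> = (\<Sum>y\<in>UNIV. \<Sum>x\<in>UNIV. sc (A $ (i, j, k) $ x) * (sc (B $ x $ y) * ?Y y))"
    by (rule sum.swap)
  also have "\<dots> = act123 (left_mult sc) (A ** B) X i j k l"
    by (simp add: act123_def case_prod_unfold matrix_matrix_mult_def ring_map_simps[OF assms]
        sum_distrib_right mult.assoc)
  finally show "act123 (left_mult sc) A (act123 (left_mult sc) B X) i j k l
      = act123 (left_mult sc) (A ** B) X i j k l" .
qed

lemma act234_comp:
  fixes X :: "('n::finite, 'm::ring_1) fam4"
  assumes "ring_map sc"
  shows "act234 (left_mult sc) A (act234 (left_mult sc) B X) = act234 (left_mult sc) (A ** B) X"
proof (intro ext)
  fix i j k l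
  let ?Y = "\<lambda>y. X i (fst y) (fst (snd y)) (snd (snd y))"
  have "act234 (left_mult sc) A (act234 (left_mult sc) B X) i j k l
      = (\<Sum>x\<in>UNIV. \<Sum>y\<in>UNIV. sc (A $ (j, k, l) $ x) * (sc (B $ x $ y) * ?Y y))"
    by (simp add: act234_def case_prod_unfold sum_distrib_left)
  also have "\<dots> = (\<Sum>y\<in>UNIV. \<Sum>x\<in>UNIV. sc (A $ (j, k, l) $ x) * (sc (B $ x $ y) * ?Y y))"
    by (rule sum.swap)
  also have "\<dots> = act234 (left_mult sc) (A ** B) X i j k l"
    by (simp add: act234_def case_prod_unfold matrix_matrix_mult_def ring_map_simps[OF assms]
        sum_distrib_right mult.assoc)
  finally show "act234 (left_mult sc) A (act234 (left_mult sc) B X) i j k l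
      = act234 (left_mult sc) (A ** B) X i j k l" .
qed

lemma sum_delta_triple:
  fixes f :: "'n::finite \<times> 'n \<times> 'n \<Rightarrow> 'm::comm_monoid_add"
  shows "(\<Sum>y\<in>UNIV. if i = fst y \<and> j = fst (snd y) \<and> k = snd (snd y) then f y else 0) = f (i, j, k)"
proof -
  have "(\<Sum>y\<in>UNIV. if i = fst y \<and> j = fst (snd y) \<and> k = snd (snd y) then f y else 0)
      = (\<Sum>y\<in>UNIV. if y = (i, j, k) then f y else 0)"
    by (rule sum.cong) auto
  then show ?thesis by simp
qed

lemma sum_triple:
  "(\<Sum>y\<in>UNIV. f y) = (\<Sum>i\<in>UNIV. \<Sum>j\<in>UNIV. \<Sum>k\<in>UNIV. f (i :: 'n::finite, j :: 'n, k :: 'n))"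
  unfolding UNIV_Times_UNIV[symmetric]
  by (subst sum.cartesian_product', subst sum.cartesian_product') simp

lemma act_mat1:
  fixes X :: "('n::finite, 'm::ring_1) fam4"
  assumes "ring_map sc"
  shows "act123 (left_mult sc) (mat 1) X = X" "act234 (left_mult sc) (mat 1) X = X"
proof -
  have d: "sc (if b then 1 else 0) * y = (if b then y else 0)" for b y
    by (simp add: ring_map_simps[OF assms])
  show "act123 (left_mult sc) (mat 1) X = X" "act234 (left_mult sc) (mat 1) X = X"
    by (auto simp: act123_def act234_def mat_def fun_eq_iff case_prod_unfold d sum_delta_triple)
qed

section \<open>Three-leg operators of Hecke type\<close>

text \<open>
  All that is used about the operators \<open>S\<close> and \<open>St\<close>.  Here \<open>qw\<close>, \<open>q2\<close>, \<open>qm\<close> are \<open>q\<close> to the powers \<open>w\<close>,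
  \<open>a\<close>, \<open>m\<close>, and \<open>e\<close> contains the weights of the pairing \<open>E'\<close>.  The Hecke relation of \<open>S\<close> has the roots
  \<open>qw\<close> and \<open>- qw / q2\<close>, that of \<open>St\<close> their inverses; both are stated by solving for an inverse.
  The assumption \<open>rotation\<close> is the identity \<open>E\<^sub>2\<^sub>3 S\<^sub>3\<^sub>4\<^sub>5 = E\<^sub>4\<^sub>5 St\<^sub>2\<^sub>3\<^sub>4\<^sup>-\<^sup>1\<close> for maps from
  \<open>V* \<otimes> V \<otimes> V* \<otimes> V\<close> to \<open>V* \<otimes> V\<close>, compared entry by entry.  The assumptions on traces say that
  \<open>E'\<^sub>1\<^sub>2 S = qw qm E\<^sub>2\<^sub>3\<close> and \<open>E\<^sub>2\<^sub>3 St = (qw qm)\<^sup>-\<^sup>1 E'\<^sub>3\<^sub>4\<close>.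
\<close>

locale hk_matrices =
  fixes S St :: "complex ^ ('n::finite \<times> 'n \<times> 'n) ^ ('n \<times> 'n \<times> 'n)"
    and e :: "'n \<Rightarrow> complex" and qw q2 qm :: complex
  assumes nonzero: "qw \<noteq> 0" "q2 \<noteq> 0" "qm \<noteq> 0"
    and S_inv: "S ** matrix_inv S = mat 1" "matrix_inv S ** S = mat 1"
    and St_inv: "St ** matrix_inv St = mat 1" "matrix_inv St ** St = mat 1"
    and S_hecke: "matrix_inv S $ x $ y = q2 / qw\<^sup>2 * S $ x $ y - (if x = y then (q2 - 1) / qw else 0)"
    and St_hecke: "St $ x $ y = q2 / qw\<^sup>2 * matrix_inv St $ x $ y - (if x = y then (q2 - 1) / qw else 0)"
    and rotation: "S $ (j, b, c) $ (j', b', c') = matrix_inv St $ (b, c, c') $ (j, j', b')"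
    and trace_S: "(\<Sum>k\<in>UNIV. e k * S $ (k, k, i) $ (i', j', k'))
                     = (if j' = k' \<and> i = i' then qw * qm else 0)"
    and trace_St: "(\<Sum>j\<in>UNIV. St $ (j, j, l) $ (j', k', l'))
                     = (if k' = l' \<and> l = j' then e k' / (qw * qm) else 0)"

context hk_matrices
begin

text \<open>
  On an eigenvector of \<open>S\<close> the evaluation of the inner legs 2, 3 is therefore proportional to the
  contraction \<open>E'\<^sub>1\<^sub>2\<close>, which is known for the generators.  Stated for an arbitrary space of components,
  since it is needed in the algebra, in the one-forms and in the two-forms.
\<close>

lemma contract_S_eigen:
  fixes sc :: "complex \<Rightarrow> 'm \<Rightarrow> 'm::ab_group_add" and X :: "('n, 'm) fam4"
  assumes "vector_space sc" and eigen: "\<And>i j k l. act123 sc S X i j k l = sc qw (X i j k l)"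
  shows "contractE23 X i l = sc (1 / qm) (\<Sum>k\<in>UNIV. sc (e k) (X k k i l))"
proof -
  interpret vector_space sc by fact
  let ?Y = "\<lambda>y. X (fst y) (fst (snd y)) (snd (snd y)) l"
  have "(\<Sum>k\<in>UNIV. sc (e k) (act123 sc S X k k i l)) = (\<Sum>k\<in>UNIV. \<Sum>y\<in>UNIV. sc (e k * S $ (k, k, i) $ y) (?Y y))"
    by (simp add: act123_def case_prod_unfold scale_sum_right)
  also have "\<dots> = (\<Sum>y\<in>UNIV. \<Sum>k\<in>UNIV. sc (e k * S $ (k, k, i) $ y) (?Y y))"
    by (rule sum.swap)
  also have "\<dots> = (\<Sum>y\<in>UNIV. sc (\<Sum>k\<in>UNIV. e k * S $ (k, k, i) $ y) (?Y y))"
    by (simp add: scale_sum_left)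
  also have "\<dots> = (\<Sum>i'\<in>UNIV. \<Sum>j'\<in>UNIV. \<Sum>k'\<in>UNIV. sc (if j' = k' \<and> i = i' then qw * qm else 0) (X i' j' k' l))"
    by (subst sum_triple) (simp only: trace_S fst_conv snd_conv)
  also have "\<dots> = (\<Sum>i'\<in>UNIV. if i = i' then \<Sum>j'\<in>UNIV. sc (qw * qm) (X i' j' j' l) else 0)"
  proof (rule sum.cong)
    fix i'
    have "sc (if b then x else 0) y = (if b then sc x y else 0)" for b x y by simp
    then show "(\<Sum>j'\<in>UNIV. \<Sum>k'\<in>UNIV. sc (if j' = k' \<and> i = i' then qw * qm else 0) (X i' j' k' l))
        = (if i = i' then \<Sum>j'\<in>UNIV. sc (qw * qm) (X i' j' j' l) else 0)"
      by (cases "i = i'") simp_all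
  qed simp
  also have "\<dots> = sc (qw * qm) (contractE23 X i l)"
    by (simp add: contractE23_def scale_sum_right)
  finally have "sc (qw * qm) (contractE23 X i l) = sc qw (\<Sum>k\<in>UNIV. sc (e k) (X k k i l))"
    by (simp add: eigen scale_sum_right mult.commute)
  then have "sc (1 / (qw * qm)) (sc (qw * qm) (contractE23 X i l)) = sc (1 / (qw * qm)) (sc qw (\<Sum>k\<in>UNIV. sc (e k) (X k k i l)))"
    by simp
  then show ?thesis using nonzero by simp
qed

lemma contract_St_eigen:
  fixes sc :: "complex \<Rightarrow> 'm \<Rightarrow> 'm::ab_group_add" and X :: "('n, 'm) fam4"
  assumes "vector_space sc" and eigen: "\<And>i j k l. act234 sc St X i j k l = sc (1 / qw) (X i j k l)"
  shows "contractE23 X i l = sc (1 / qm) (\<Sum>k\<in>UNIV. sc (e k) (X i l k k))"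
proof -
  interpret vector_space sc by fact
  let ?Y = "\<lambda>y. X i (fst y) (fst (snd y)) (snd (snd y))"
  have "(\<Sum>j\<in>UNIV. act234 sc St X i j j l) = (\<Sum>j\<in>UNIV. \<Sum>y\<in>UNIV. sc (St $ (j, j, l) $ y) (?Y y))"
    by (simp add: act234_def case_prod_unfold)
  also have "\<dots> = (\<Sum>y\<in>UNIV. \<Sum>j\<in>UNIV. sc (St $ (j, j, l) $ y) (?Y y))"
    by (rule sum.swap)
  also have "\<dots> = (\<Sum>y\<in>UNIV. sc (\<Sum>j\<in>UNIV. St $ (j, j, l) $ y) (?Y y))"
    by (simp add: scale_sum_left)
  also have "\<dots> = (\<Sum>j'\<in>UNIV. \<Sum>k'\<in>UNIV. \<Sum>l'\<in>UNIV. sc (if k' = l' \<and> l = j' then e k' / (qw * qm) else 0) (X i j' k' l'))"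
    by (subst sum_triple) (simp only: trace_St fst_conv snd_conv)
  also have "\<dots> = (\<Sum>j'\<in>UNIV. if l = j' then \<Sum>k'\<in>UNIV. sc (e k' / (qw * qm)) (X i j' k' k') else 0)"
  proof (rule sum.cong)
    fix j'
    have "sc (if b then x else 0) y = (if b then sc x y else 0)" for b x y by simp
    then show "(\<Sum>k'\<in>UNIV. \<Sum>l'\<in>UNIV. sc (if k' = l' \<and> l = j' then e k' / (qw * qm) else 0) (X i j' k' l'))
        = (if l = j' then \<Sum>k'\<in>UNIV. sc (e k' / (qw * qm)) (X i j' k' k') else 0)"
      by (cases "l = j'") simp_all
  qed simp
  finally have "sc (1 / qw) (contractE23 X i l) = sc (1 / (qw * qm)) (\<Sum>k\<in>UNIV. sc (e k) (X i l k k))"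
    by (simp add: eigen contractE23_def scale_sum_right)
  then have "sc qw (sc (1 / qw) (contractE23 X i l)) = sc qw (sc (1 / (qw * qm)) (\<Sum>k\<in>UNIV. sc (e k) (X i l k k)))"
    by simp
  then show ?thesis using nonzero by simp
qed

end

text \<open>
  The families \<open>P\<close>, \<open>U\<close>, \<open>W\<close> are the images of \<open>p\<close>, \<open>\<partial>p\<close>, \<open>\<partial>'p\<close> in a ring of forms, where scalars act
  through \<open>sc\<close>.
\<close>

locale hk_two_forms = hk_matrices S St e qw q2 qm
  for S St :: "complex ^ ('n::finite \<times> 'n \<times> 'n) ^ ('n \<times> 'n \<times> 'n)"
    and e :: "'n \<Rightarrow> complex" and qw q2 qm :: complex +
  fixes sc :: "complex \<Rightarrow> 'w::ring_1" and P U W :: "('n, 'w) fam2"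
  assumes sc_ring: "ring_map sc"
    and sc_commute: "sc z * P i j = P i j * sc z" "sc z * U i j = U i j * sc z" "sc z * W i j = W i j * sc z"
    and commute: "\<And>X. act123 (left_mult sc) S (act234 (left_mult sc) St X)
                   = act234 (left_mult sc) St (act123 (left_mult sc) S X)"
begin

definition smul :: "complex \<Rightarrow> ('n, 'w) fam4 \<Rightarrow> ('n, 'w) fam4" where
  "smul z X = (\<lambda>i j k l. sc z * X i j k l)"

lemmas sc_simps = ring_map_simps[OF sc_ring]

sublocale fam: vector_space smul
  by standard (auto simp: smul_def fun_eq_iff sc_simps algebra_simps)

abbreviation opS :: "('n, 'w) fam4 \<Rightarrow> ('n, 'w) fam4" where
  "opS \<equiv> act123 (left_mult sc) S"
abbreviation opSi :: "('n, 'w) fam4 \<Rightarrow> ('n, 'w) fam4" where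
  "opSi \<equiv> act123 (left_mult sc) (matrix_inv S)"
abbreviation opSt :: "('n, 'w) fam4 \<Rightarrow> ('n, 'w) fam4" where
  "opSt \<equiv> act234 (left_mult sc) St"
abbreviation opSti :: "('n, 'w) fam4 \<Rightarrow> ('n, 'w) fam4" where
  "opSti \<equiv> act234 (left_mult sc) (matrix_inv St)"

lemma act123_linear:
  fixes A :: "complex ^ ('n \<times> 'n \<times> 'n) ^ ('n \<times> 'n \<times> 'n)" and X Y :: "('n, 'w) fam4"
  shows "act123 (left_mult sc) A (X + Y) = act123 (left_mult sc) A X + act123 (left_mult sc) A Y"
    "act123 (left_mult sc) A (X - Y) = act123 (left_mult sc) A X - act123 (left_mult sc) A Y"
    "act123 (left_mult sc) A (- X) = - act123 (left_mult sc) A X"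
    "act123 (left_mult sc) A (smul z X) = smul z (act123 (left_mult sc) A X)"
     apply (auto simp: act123_def fun_eq_iff algebra_simps sum.distrib sum_subtractf sum_negf case_prod_unfold)
  apply (simp add: smul_def sum_distrib_left mult.assoc[symmetric] sc_simps(2)[symmetric] mult.commute[of z])
  done

lemma act234_linear:
  fixes A :: "complex ^ ('n \<times> 'n \<times> 'n) ^ ('n \<times> 'n \<times> 'n)" and X Y :: "('n, 'w) fam4"
  shows "act234 (left_mult sc) A (X + Y) = act234 (left_mult sc) A X + act234 (left_mult sc) A Y"
    "act234 (left_mult sc) A (X - Y) = act234 (left_mult sc) A X - act234 (left_mult sc) A Y"
    "act234 (left_mult sc) A (- X) = - act234 (left_mult sc) A X"
    "act234 (left_mult sc) A (smul z X) = smul z (act234 (left_mult sc) A X)"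
     apply (auto simp: act234_def fun_eq_iff algebra_simps sum.distrib sum_subtractf sum_negf case_prod_unfold)
  apply (simp add: smul_def sum_distrib_left mult.assoc[symmetric] sc_simps(2)[symmetric] mult.commute[of z])
  done

lemma inv_ops: "opS (opSi X) = X" "opSi (opS X) = X" "opSt (opSti X) = X" "opSti (opSt X) = X"
  by (simp_all add: act123_comp[OF sc_ring] act234_comp[OF sc_ring] S_inv St_inv act_mat1[OF sc_ring])

lemma act_shift:
  assumes "\<And>x y. A $ x $ y = z * B $ x $ y - (if x = y then c else 0)"
  shows "act123 (left_mult sc) A X = smul z (act123 (left_mult sc) B X) - smul c X"
    "act234 (left_mult sc) A X = smul z (act234 (left_mult sc) B X) - smul c X"
proof -
  have d: "sc (a - (if b then c else 0)) * y = sc a * y - (if b then sc c * y else 0)" for a b c y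
    by (simp add: sc_simps algebra_simps)
  show "act123 (left_mult sc) A X = smul z (act123 (left_mult sc) B X) - smul c X"
    "act234 (left_mult sc) A X = smul z (act234 (left_mult sc) B X) - smul c X"
    by (auto simp: act123_def act234_def fun_eq_iff case_prod_unfold smul_def d assms sum_subtractf
        sum_distrib_left sum_delta_triple sc_simps(2) mult.assoc)
qed

lemmas hecke_ops = act_shift(1)[OF S_hecke] act_shift(2)[OF St_hecke]

definition trace12 :: "('n, 'w) fam4 \<Rightarrow> ('n, 'w) fam2" where
  "trace12 X = (\<lambda>k l. \<Sum>i\<in>UNIV. sc (e i) * X i i k l)"
definition trace34 :: "('n, 'w) fam4 \<Rightarrow> ('n, 'w) fam2" where
  "trace34 X = (\<lambda>i j. \<Sum>k\<in>UNIV. sc (e k) * X i j k k)"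
definition smul2 :: "complex \<Rightarrow> ('n, 'w) fam2 \<Rightarrow> ('n, 'w) fam2" where
  "smul2 z x = (\<lambda>i j. sc z * x i j)"

text \<open>
  Families with components commuting with scalars; they can be moved past the entries of \<open>S\<close> and \<open>St\<close>.
\<close>

definition central_fam :: "('n, 'w) fam2 \<Rightarrow> bool" where
  "central_fam x \<longleftrightarrow> (\<forall>z i j. x i j * sc z = sc z * x i j)"

lemma central_PUW: "central_fam P" "central_fam U" "central_fam W"
  using sc_commute by (auto simp: central_fam_def)

lemma central_swap: "central_fam x \<Longrightarrow> x i j * (sc z * y) = sc z * (x i j * y)"
  unfolding central_fam_def by (metis mult.assoc)

lemma central_contract: "central_fam x \<Longrightarrow> central_fam y \<Longrightarrow> central_fam (contractE23 (tens x y))"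
  by (simp add: tens_def central_fam_def contractE23_def sum_distrib_left sum_distrib_right mult.assoc
      central_swap[unfolded central_fam_def])

lemma left_contract_smul:
  assumes "central_fam x"
  shows "left_contract x (smul z X) = smul z (left_contract x X)"
    "left_contract x (opSt X) = opSt (left_contract x X)"
proof -
  show "left_contract x (smul z X) = smul z (left_contract x X)"
    by (simp add: left_contract_def smul_def central_swap[OF assms] sum_distrib_left)
  have "left_contract x (act234 (left_mult sc) A X) = act234 (left_mult sc) A (left_contract x X)" for A
    unfolding left_contract_def act234_def case_prod_unfold sum_distrib_left central_swap[OF assms]
    by (intro ext sum.swap)
  then show "left_contract x (opSt X) = opSt (left_contract x X)" by auto
qed

lemma right_contract_smul:
  "right_contract (smul z X) x = smul z (right_contract X x)"
  "right_contract (opS X) x = opS (right_contract X x)"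
  "right_contract (opSi X) x = opSi (right_contract X x)"
proof -
  show "right_contract (smul z X) x = smul z (right_contract X x)"
    by (simp add: right_contract_def smul_def sum_distrib_left mult.assoc)
  have "right_contract (act123 (left_mult sc) A X) x = act123 (left_mult sc) A (right_contract X x)" for A
    unfolding right_contract_def act123_def case_prod_unfold sum_distrib_left sum_distrib_right mult.assoc
    by (intro ext sum.swap)
  then show "right_contract (opS X) x = opS (right_contract X x)"
    "right_contract (opSi X) x = opSi (right_contract X x)"
    by auto
qed

text \<open>
  The assumption \<open>rotation\<close> in operator form: a contraction which interferes with \<open>S\<close> is traded for
  one on the other side, which interferes with the inverse of \<open>St\<close>.
\<close>

lemma rotation_ops:
  assumes "central_fam x"
  shows "left_contract x (opS (tens y z)) = right_contract (opSti (tens x y)) z"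
proof (intro ext)
  fix i b c d
  have "left_contract x (opS (tens y z)) i b c d = (\<Sum>h\<in>UNIV. \<Sum>j'\<in>UNIV. \<Sum>b'\<in>UNIV. \<Sum>c'\<in>UNIV.
     sc (S $ (h, b, c) $ (j', b', c')) * (x i h * (y j' b' * z c' d)))"
    by (simp add: tens_def left_contract_def act123_def sum_triple sum_distrib_left central_swap[OF assms])
  also have "\<dots> = (\<Sum>h\<in>UNIV. \<Sum>j'\<in>UNIV. \<Sum>c'\<in>UNIV. \<Sum>b'\<in>UNIV.
     sc (S $ (h, b, c) $ (j', b', c')) * (x i h * (y j' b' * z c' d)))"
    by (intro sum.cong refl sum.swap)
  also have "\<dots> = (\<Sum>h\<in>UNIV. \<Sum>c'\<in>UNIV. \<Sum>j'\<in>UNIV. \<Sum>b'\<in>UNIV.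
     sc (S $ (h, b, c) $ (j', b', c')) * (x i h * (y j' b' * z c' d)))"
    by (intro sum.cong[OF refl] sum.swap)
  also have "\<dots> = (\<Sum>c'\<in>UNIV. \<Sum>h\<in>UNIV. \<Sum>j'\<in>UNIV. \<Sum>b'\<in>UNIV.
     sc (S $ (h, b, c) $ (j', b', c')) * (x i h * (y j' b' * z c' d)))"
    by (rule sum.swap)
  also have "\<dots> = right_contract (opSti (tens x y)) z i b c d"
    by (simp add: tens_def right_contract_def act234_def sum_triple rotation sum_distrib_right mult.assoc)
  finally show "left_contract x (opS (tens y z)) i b c d = right_contract (opSti (tens x y)) z i b c d" .
qed

text \<open>
  For the inverse of \<open>S\<close> the Hecke relations turn this into an identity with a correction by the
  contractions that do not involve \<open>S\<close> at all.
\<close>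

lemma rotation_inverse_ops:
  assumes "central_fam x"
  shows "left_contract x (opSi (tens y z)) = right_contract (opSt (tens x y)) z
     + smul ((q2 - 1) / qw) (tens x (contractE23 (tens y z)) - tens (contractE23 (tens x y)) z)"
  by (simp add: hecke_ops left_contract_linear right_contract_linear left_contract_smul[OF assms]
      right_contract_smul rotation_ops[OF assms] left_contract_tens right_contract_tens fam.scale_right_diff_distrib)

end

context hk_two_forms
begin

lemma trace_tens:
  assumes "central_fam x"
  shows "trace12 (tens y z) = (\<lambda>k l. (\<Sum>i\<in>UNIV. sc (e i) * y i i) * z k l)"
    "trace34 (tens x y) = (\<lambda>i j. x i j * (\<Sum>k\<in>UNIV. sc (e k) * y k k))"
  by (simp_all add: trace12_def trace34_def tens_def sum_distrib_left sum_distrib_right mult.assoc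
      central_swap[OF assms])

lemma smul2_smul2: "smul2 z (smul2 z' x) = smul2 (z * z') x" "smul2 1 x = x"
  by (simp_all add: smul2_def mult.assoc sc_simps)

lemma sc_vector_space: "vector_space (left_mult sc)"
  by standard (simp_all add: sc_simps algebra_simps)

lemma contract_opS_eigen:
  assumes "opS X = smul qw X"
  shows "contractE23 X = smul2 (1 / qm) (trace12 X)"
proof (intro ext)
  fix i l
  show "contractE23 X i l = smul2 (1 / qm) (trace12 X) i l"
    using contract_S_eigen[OF sc_vector_space, of X i l] assms by (simp add: smul_def smul2_def trace12_def)
qed

lemma contract_opSt_eigen:
  assumes "opSt X = smul (1 / qw) X"
  shows "contractE23 X = smul2 (1 / qm) (trace34 X)"
proof (intro ext)
  fix i l
  show "contractE23 X i l = smul2 (1 / qm) (trace34 X) i l"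
    using contract_St_eigen[OF sc_vector_space, of X i l] assms by (simp add: smul_def smul2_def trace34_def)
qed

end

section \<open>Relations between two-forms\<close>

text \<open>
  The relations of the algebra and of the first-order calculus, and the differentials of the latter,
  where \<open>\<Theta>\<close> stands for the differential of \<open>W\<close> and \<open>- \<Theta>\<close> for that of \<open>U\<close>.
\<close>

locale hk_relations = hk_two_forms S St e qw q2 qm sc P U W
  for S St :: "complex ^ ('n::finite \<times> 'n \<times> 'n) ^ ('n \<times> 'n \<times> 'n)"
    and e :: "'n \<Rightarrow> complex" and qw q2 qm :: complex
    and sc :: "complex \<Rightarrow> 'w::ring_1" and P U W :: "('n, 'w) fam2" +
  fixes \<Theta> :: "('n, 'w) fam2"
  assumes S_PP: "opS (tens P P) = smul qw (tens P P)"
    and trace_P: "(\<Sum>i\<in>UNIV. sc (e i) * P i i) = sc qm"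
    and trace_U: "(\<Sum>i\<in>UNIV. sc (e i) * U i i) = 0"
    and trace_W: "(\<Sum>i\<in>UNIV. sc (e i) * W i i) = 0"
    and trace_Theta: "(\<Sum>i\<in>UNIV. sc (e i) * \<Theta> i i) = 0"
    and St_PU: "opSt (tens P U) = smul (1 / qw) (tens P U)"
    and S_PW: "opS (tens P W) = smul qw (tens P W)"
    and U_P: "tens U P = smul q2 (opS (opSt (tens P U)))"
    and W_P: "tens W P = smul (1 / q2) (opS (opSt (tens P W)))"
    and leibniz_U: "contractE23 (tens U P) + contractE23 (tens P U) = U"
    and leibniz_W: "contractE23 (tens W P) + contractE23 (tens P W) = W"
    and d_St_PU: "opSt (tens (U + W) U - tens P \<Theta>) = smul (1 / qw) (tens (U + W) U - tens P \<Theta>)"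
    and d_S_PW: "opS (tens (U + W) W + tens P \<Theta>) = smul qw (tens (U + W) W + tens P \<Theta>)"
    and d_U_P: "- tens \<Theta> P - tens U (U + W) = smul q2 (opS (opSt (tens (U + W) U - tens P \<Theta>)))"
    and d_W_P: "tens \<Theta> P - tens W (U + W) = smul (1 / q2) (opS (opSt (tens (U + W) W + tens P \<Theta>)))"
    and Theta_eq: "\<Theta> = contractE23 (tens (U + W) (U + W))"
begin

lemma contract_PP: "contractE23 (tens P P) = P"
proof -
  have "contractE23 (tens P P) = smul2 (1 / qm) (smul2 qm P)"
    using contract_opS_eigen[OF S_PP] by (simp add: trace_tens[OF central_PUW(1)] trace_P smul2_def)
  then show ?thesis using nonzero by (simp add: smul2_smul2)
qed

lemma contract_PW: "contractE23 (tens P W) = W"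
proof -
  have "contractE23 (tens P W) = smul2 (1 / qm) (smul2 qm W)"
    using contract_opS_eigen[OF S_PW] by (simp add: trace_tens[OF central_PUW(1)] trace_P smul2_def)
  then show ?thesis using nonzero by (simp add: smul2_smul2)
qed

lemma contract_PU: "contractE23 (tens P U) = 0"
  using contract_opSt_eigen[OF St_PU]
  by (simp add: trace_tens[OF central_PUW(1)] trace_U smul2_def fun_eq_iff)

lemma contract_UP: "contractE23 (tens U P) = U"
  using leibniz_U contract_PU by simp

lemma contract_WP: "contractE23 (tens W P) = 0"
  using leibniz_W contract_PW by simp

lemmas contract_simps = contract_PP contract_PW contract_PU contract_UP contract_WP

lemma eigen_diff:
  "opS X = smul z X \<Longrightarrow> opS Y = smul z Y \<Longrightarrow> opS (X - Y) = smul z (X - Y)"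
  "opSt X = smul z X \<Longrightarrow> opSt Y = smul z Y \<Longrightarrow> opSt (X - Y) = smul z (X - Y)"
  by (simp_all add: act123_linear act234_linear fam.scale_right_diff_distrib)

lemma eigen_commuting:
  "opS X = smul z X \<Longrightarrow> opS (smul y (opS (opSt X))) = smul z (smul y (opS (opSt X)))"
  "opSt X = smul z X \<Longrightarrow> opSt (smul y (opS (opSt X))) = smul z (smul y (opS (opSt X)))"
proof -
  show "opS (smul y (opS (opSt X))) = smul z (smul y (opS (opSt X)))" if "opS X = smul z X"
    by (simp add: that act123_linear(4) act234_linear(4) commute mult.commute)
  show "opSt (smul y (opS (opSt X))) = smul z (smul y (opS (opSt X)))" if "opSt X = smul z X"
    by (simp add: that act123_linear(4) act234_linear(4) commute[symmetric] mult.commute)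
qed

lemma S_WP: "opS (tens W P) = smul qw (tens W P)"
  unfolding W_P by (rule eigen_commuting(1)[OF S_PW])

lemma d_S_WP: "opS (tens \<Theta> P - tens W (U + W)) = smul qw (tens \<Theta> P - tens W (U + W))"
  unfolding d_W_P by (rule eigen_commuting(1)[OF d_S_PW])

lemma d_St_UP: "opSt (tens \<Theta> P + tens U (U + W)) = smul (1 / qw) (tens \<Theta> P + tens U (U + W))"
proof -
  have "tens \<Theta> P + tens U (U + W) = - (- tens \<Theta> P - tens U (U + W))" by simp
  also have "\<dots> = smul (- q2) (opS (opSt (tens (U + W) U - tens P \<Theta>)))"
    by (simp only: d_U_P fam.scale_minus_left)
  finally show ?thesis by (simp only: eigen_commuting(2)[OF d_St_PU])
qed

text \<open>
  Contraction with \<open>P\<close> from the left is a projection: it keeps families that begin with \<open>P\<close> or \<open>W\<close> and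
  kills those that begin with \<open>U\<close>.  From the right the roles of \<open>U\<close> and \<open>W\<close> are exchanged.
\<close>

lemma left_contract_P:
  "left_contract P (tens P y) = tens P y" "left_contract P (tens U y) = 0" "left_contract P (tens W y) = tens W y"
  by (simp_all add: left_contract_tens contract_simps tens_linear)

lemma right_contract_P:
  "right_contract (tens y P) P = tens y P" "right_contract (tens y U) P = tens y U" "right_contract (tens y W) P = 0"
  by (simp_all add: right_contract_tens contract_simps tens_linear)

text \<open>
  The two parts of the curvature \<open>\<Theta>\<close>.
\<close>

definition alpha where "alpha = contractE23 (tens U W)"
definition beta where "beta = contractE23 (tens W U)"

lemma central_alpha_beta: "central_fam alpha" "central_fam beta"
  by (simp_all add: alpha_def beta_def central_contract central_PUW)

text \<open>
  In the differentiated relation of \<open>P U\<close>, contraction from the left with \<open>P\<close>, which commutes with \<open>St\<close>,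
  removes exactly \<open>U U\<close>; the difference is the relation for \<open>U U\<close> alone.
\<close>

lemma St_UU: "opSt (tens U U) = smul (1 / qw) (tens U U)"
proof -
  have "left_contract P (opSt (tens (U + W) U - tens P \<Theta>))
      = left_contract P (smul (1 / qw) (tens (U + W) U - tens P \<Theta>))"
    by (simp only: d_St_PU)
  then have "opSt (tens W U - tens P \<Theta>) = smul (1 / qw) (tens W U - tens P \<Theta>)"
    by (simp add: left_contract_smul[OF central_PUW(1)] tens_linear left_contract_linear left_contract_P)
  from eigen_diff(2)[OF d_St_PU this] show ?thesis by (simp add: tens_linear)
qed

text \<open>
  Here the relation of \<open>W P\<close> is contracted from the right, which is compatible with \<open>S\<close>.
\<close>

lemma S_WW: "opS (tens W W) = smul qw (tens W W)"
proof -
  have "right_contract (opS (tens \<Theta> P - tens W (U + W))) P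
      = right_contract (smul qw (tens \<Theta> P - tens W (U + W))) P"
    by (simp only: d_S_WP)
  then have 1: "opS (tens \<Theta> P - tens W U) = smul qw (tens \<Theta> P - tens W U)"
    by (simp add: right_contract_smul tens_linear right_contract_linear right_contract_P)
  show ?thesis
    using eigen_diff(1)[OF 1 d_S_WP] by (simp add: tens_linear)
qed

lemma contract_UU: "contractE23 (tens U U) = 0"
  using contract_opSt_eigen[OF St_UU]
  by (simp add: trace_tens[OF central_PUW(2)] trace_U smul2_def fun_eq_iff)

lemma contract_WW: "contractE23 (tens W W) = 0"
  using contract_opS_eigen[OF S_WW]
  by (simp add: trace_tens[OF central_PUW(1)] trace_W smul2_def fun_eq_iff)

lemma Theta_alpha_beta: "\<Theta> = alpha + beta"
  by (simp add: Theta_eq alpha_def beta_def tens_linear contractE23_linear contract_UU contract_WW add.commute)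

lemma contract_alpha_beta:
  "contractE23 (tens P alpha) = 0" "contractE23 (tens P beta) = beta"
  "contractE23 (tens alpha P) = 0" "contractE23 (tens beta P) = beta"
proof -
  have z: "contractE23 0 = (0::('n, 'w) fam2)" using contractE23_linear(2)[of 0 0] by simp
  show "contractE23 (tens P alpha) = 0" "contractE23 (tens P beta) = beta"
    by (simp_all add: alpha_def beta_def contract_contract[symmetric] contract_simps tens_linear z)
  show "contractE23 (tens alpha P) = 0" "contractE23 (tens beta P) = beta"
    by (simp_all add: alpha_def beta_def contract_contract contract_simps tens_linear z)
qed

lemma contract_Theta: "contractE23 (tens P \<Theta>) = beta" "contractE23 (tens \<Theta> P) = beta"
  by (simp_all add: Theta_alpha_beta tens_linear contractE23_linear contract_alpha_beta)

text \<open>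
  Contracting the differentiated relation of \<open>P W\<close> from the right leaves only \<open>P \<Theta>\<close>, and
  \<open>E\<^sub>2\<^sub>3 \<Theta> P = \<beta>\<close>.
\<close>

lemma S_P_beta: "opS (tens P beta) = smul qw (tens P beta)"
proof -
  have "right_contract (opS (tens (U + W) W + tens P \<Theta>)) P = right_contract (smul qw (tens (U + W) W + tens P \<Theta>)) P"
    by (simp only: d_S_PW)
  then show ?thesis
    by (simp add: right_contract_smul tens_linear right_contract_linear right_contract_P)
      (simp add: right_contract_tens contract_Theta)
qed

lemma St_beta_P: "opSt (tens beta P) = smul (1 / qw) (tens beta P)"
proof -
  have "left_contract P (opSt (tens \<Theta> P + tens U (U + W))) = left_contract P (smul (1 / qw) (tens \<Theta> P + tens U (U + W)))"
    by (simp only: d_St_UP)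
  then show ?thesis
    by (simp add: left_contract_smul[OF central_PUW(1)] tens_linear left_contract_linear left_contract_P)
      (simp add: left_contract_tens contract_Theta)
qed

text \<open>
  The differentiated right module structure.  The operator \<open>St\<close> has been evaluated as an eigenvalue,
  so only \<open>S\<close> is left, which commutes with contraction from the right.
\<close>

lemma two_forms_UP: "tens \<Theta> P + tens U U + tens U W = smul (- (q2 / qw)) (opS (tens U U + tens W U - tens P \<Theta>))"
proof -
  have "tens \<Theta> P + tens U U + tens U W = - (- tens \<Theta> P - tens U (U + W))"
    by (simp add: tens_linear)
  also have "\<dots> = smul (- q2) (opS (opSt (tens (U + W) U - tens P \<Theta>)))"
    by (simp only: d_U_P fam.scale_minus_left)
  finally show ?thesis
    by (simp add: d_St_PU act123_linear(4)) (simp add: tens_linear)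
qed

lemma two_forms_WP: "tens \<Theta> P - tens W U - tens W W = smul (qw / q2) (opSt (tens U W + tens W W + tens P \<Theta>))"
  using d_W_P by (simp add: commute d_S_PW) (simp add: act234_linear tens_linear algebra_simps)

lemma two_forms_UP_contracted: "tens \<Theta> P + tens U U = smul (- (q2 / qw)) (opS (tens U U + tens W U - tens P beta))"
proof -
  have "right_contract (tens \<Theta> P + tens U U + tens U W) P
      = right_contract (smul (- (q2 / qw)) (opS (tens U U + tens W U - tens P \<Theta>))) P"
    by (simp only: two_forms_UP)
  then show ?thesis
    by (simp add: right_contract_smul right_contract_linear right_contract_P
        right_contract_tens[of P \<Theta>] contract_Theta del: fam.scale_minus_left)
qed

lemma two_forms_WP_contracted: "tens beta P - tens W U - tens W W = smul (qw / q2) (opSt (tens W W + tens P \<Theta>))"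
proof -
  have "left_contract P (tens \<Theta> P - tens W U - tens W W)
      = left_contract P (smul (qw / q2) (opSt (tens U W + tens W W + tens P \<Theta>)))"
    by (simp only: two_forms_WP)
  then show ?thesis
    by (simp add: left_contract_smul[OF central_PUW(1)] left_contract_linear left_contract_P
        left_contract_tens[of P \<Theta>] contract_Theta)
qed

text \<open>
  Contraction from the right removes \<open>U W\<close> from the relation \<open>two_forms_UP\<close> and changes \<open>\<Theta>\<close> to \<open>\<beta>\<close> in its
  right hand side; the difference expresses \<open>U W\<close> through \<open>\<Theta> - \<beta> = \<alpha>\<close>.
\<close>

lemma UW_eq: "tens U W = smul (q2 / qw) (opS (tens P alpha))"
proof -
  have "tens U W = (tens \<Theta> P + tens U U + tens U W) - (tens \<Theta> P + tens U U)" by simp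
  also have "\<dots> = smul (- (q2 / qw)) (opS (tens U U + tens W U - tens P \<Theta>) - opS (tens U U + tens W U - tens P beta))"
    by (simp only: fam.scale_right_diff_distrib two_forms_UP[symmetric] two_forms_UP_contracted[symmetric])
  also have "\<dots> = smul (- (q2 / qw)) (opS (- tens P alpha))"
    by (simp only: act123_linear(2)[symmetric] Theta_alpha_beta tens_linear) simp
  also have "\<dots> = smul (q2 / qw) (opS (tens P alpha))"
    by (simp only: act123_linear(3) fam.scale_minus_left fam.scale_minus_right minus_minus)
  finally show ?thesis .
qed

lemma alpha_P_eq: "tens alpha P = smul (qw / q2) (opSt (tens U W))"
proof -
  \<comment> \<open>As in \<open>UW_eq\<close>, \<open>two_forms_WP\<close> minus its contraction, which turns \<open>\<Theta>\<close> into \<open>\<beta>\<close> and removes \<open>U W\<close>.\<close>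
  have "tens alpha P = (tens \<Theta> P - tens W U - tens W W) - (tens beta P - tens W U - tens W W)"
    by (simp add: Theta_alpha_beta tens_linear)
  also have "\<dots> = smul (qw / q2) (opSt (tens U W + tens W W + tens P \<Theta>) - opSt (tens W W + tens P \<Theta>))"
    by (simp only: fam.scale_right_diff_distrib two_forms_WP[symmetric] two_forms_WP_contracted[symmetric])
  also have "\<dots> = smul (qw / q2) (opSt (tens U W))"
    by (simp only: act234_linear(2)[symmetric]) simp
  finally show ?thesis .
qed

lemma alpha_P_eq': "tens alpha P = opS (opSt (tens P alpha))"
  using nonzero by (simp add: alpha_P_eq UW_eq act234_linear commute)

lemma Si_alpha_P: "opSi (tens alpha P) = opSt (tens P alpha)"
  by (simp add: alpha_P_eq' inv_ops)

text \<open>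
  Both sides vanish (see \<open>WW_eq\<close>): the left hand side says that \<open>W W\<close> is an eigenvector of \<open>St\<close>, while
  the right hand side is a relation of mixed type.  The same holds in \<open>UU_deviation\<close> below.
\<close>

lemma WW_deviation: "tens W W + smul (qw / q2) (opSt (tens W W)) = tens beta P - tens W U - smul (qw / q2) (opSt (tens P \<Theta>))"
proof -
  have "tens beta P - tens W U - smul (qw / q2) (opSt (tens P \<Theta>))
      = tens W W + (tens beta P - tens W U - tens W W) - smul (qw / q2) (opSt (tens P \<Theta>))"
    by simp
  also have "\<dots> = tens W W + smul (qw / q2) (opSt (tens W W))"
    by (simp only: two_forms_WP_contracted act234_linear fam.scale_right_distrib) simp
  finally show ?thesis by simp
qed

lemma UU_deviation: "tens U U + smul (q2 / qw) (opS (tens U U))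
    = smul q2 (tens P beta) - tens \<Theta> P - smul (q2 / qw) (opS (tens W U))"
proof -
  have "smul q2 (tens P beta) - tens \<Theta> P - smul (q2 / qw) (opS (tens W U))
      = smul (- (q2 / qw)) (opS (tens U U + tens W U - tens P beta)) - tens \<Theta> P + smul (q2 / qw) (opS (tens U U))"
    using nonzero by (simp add: act123_linear S_P_beta fam.scale_right_distrib fam.scale_right_diff_distrib)
  also have "\<dots> = tens U U + smul (q2 / qw) (opS (tens U U))"
    by (simp only: two_forms_UP_contracted[symmetric]) simp
  finally show ?thesis by simp
qed

lemma Si_eigen: "opS X = smul qw X \<Longrightarrow> opSi X = smul (1 / qw) X"
  using inv_ops(2)[of X] nonzero act123_linear(4)[of "matrix_inv S" qw X]
  by (metis fam.scale_scale fam.scale_one nonzero_divide_eq_eq)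

text \<open>
  The contraction does not commute with \<open>St\<close>, but by rotation it becomes a contraction of \<open>W\<close> with an
  eigenvector of \<open>S\<close>, and \<open>E\<^sub>2\<^sub>3 W W = 0\<close>.
\<close>

lemma right_contract_St_WW: "right_contract (opSt (tens W W)) P = 0"
proof -
  have "right_contract (opSt (tens W W)) P = left_contract W (opSi (tens W P))"
    by (simp add: rotation_inverse_ops[OF central_PUW(3)] contract_simps contract_WW tens_linear)
  also have "\<dots> = 0"
    by (simp add: Si_eigen[OF S_WP] left_contract_smul[OF central_PUW(3)] left_contract_tens contract_WW tens_linear)
  finally show ?thesis .
qed

text \<open>
  By rotation and \<open>St_PU\<close>, everything is reduced to \<open>E\<^sub>2\<^sub>3 U U = 0\<close>.
\<close>

lemma left_contract_Si_UU: "left_contract P (opSi (tens U U)) = 0"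
  by (simp add: rotation_inverse_ops[OF central_PUW(1)] contract_simps contract_UU tens_linear St_PU
      right_contract_smul right_contract_tens)

lemma right_St_PTheta: "right_contract (opSt (tens P \<Theta>)) P = smul (q2 / qw) (tens beta P - tens W U)"
proof -
  have "right_contract (tens W W + smul (qw / q2) (opSt (tens W W))) P
     = right_contract (tens beta P - tens W U - smul (qw / q2) (opSt (tens P \<Theta>))) P"
    by (simp only: WW_deviation)
  then have "tens beta P - tens W U = smul (qw / q2) (right_contract (opSt (tens P \<Theta>)) P)"
    by (simp add: right_contract_linear right_contract_smul right_contract_P right_contract_St_WW)
  then show ?thesis using nonzero by simp
qed

lemma left_Si_ThetaP: "left_contract P (opSi (tens \<Theta> P)) = smul (q2 / qw) (tens P beta - tens W U)"
proof -
  have "left_contract P (opSi (tens U U + smul (q2 / qw) (opS (tens U U))))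
     = left_contract P (opSi (smul q2 (tens P beta) - tens \<Theta> P - smul (q2 / qw) (opS (tens W U))))"
    by (simp only: UU_deviation)
  then have "0 = smul (q2 / qw) (tens P beta) - left_contract P (opSi (tens \<Theta> P)) - smul (q2 / qw) (tens W U)"
    by (simp add: act123_linear inv_ops left_contract_linear left_contract_smul[OF central_PUW(1)] left_contract_Si_UU
        left_contract_P Si_eigen[OF S_P_beta])
  then show ?thesis
    by (simp add: fam.scale_right_diff_distrib algebra_simps)
qed

text \<open>
  Rotation relates the values of \<open>left_Si_ThetaP\<close> and \<open>right_St_PTheta\<close>, in which \<open>W U\<close> cancels.  What
  remains is a nonzero multiple of \<open>P \<beta> - \<beta> P\<close>.
\<close>

lemma P_beta_commute: "tens P beta = tens beta P"
proof -
  have "smul (q2 / qw) (tens P beta - tens W U) = smul (q2 / qw) (tens beta P - tens W U)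
      + smul ((q2 - 1) / qw) (tens P beta - tens beta P)"
    using left_Si_ThetaP rotation_inverse_ops[OF central_PUW(1), of \<Theta> P] 
    by (simp add: right_St_PTheta contract_Theta)
  then have "smul (q2 / qw) (tens P beta) - smul (q2 / qw) (tens beta P) = smul ((q2 - 1) / qw) (tens P beta - tens beta P)"
    by (simp add: fam.scale_right_diff_distrib algebra_simps)
  then have "smul (q2 / qw) (tens P beta - tens beta P) - smul ((q2 - 1) / qw) (tens P beta - tens beta P) = 0"
    by (simp add: fam.scale_right_diff_distrib)
  then have "smul (q2 / qw - (q2 - 1) / qw) (tens P beta - tens beta P) = 0"
    by (simp only: fam.scale_left_diff_distrib)
  moreover have "q2 / qw - (q2 - 1) / qw \<noteq> 0" using nonzero by (simp add: diff_divide_distrib)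
  ultimately show ?thesis by (simp only: fam.scale_eq_0_iff) simp
qed

text \<open>
  By \<open>Si_alpha_P\<close> the inverse of \<open>S\<close> maps \<open>\<alpha> P\<close> to a family to which \<open>St\<close> has been applied, hence
  contraction from the left fixes it.  This evaluates \<open>left_Si_ThetaP\<close>.
\<close>

lemma WU_eq: "tens W U = smul (1 - 1 / q2) (tens beta P) - smul (qw / q2) (opSt (tens P alpha))"
proof -
  have "left_contract P (opSi (tens \<Theta> P)) = left_contract P (opSt (tens P alpha)) + smul (1 / qw) (tens beta P)"
    using Si_eigen[OF S_P_beta]
    by (simp add: Theta_alpha_beta tens_linear act123_linear Si_alpha_P left_contract_linear P_beta_commute left_contract_smul[OF central_PUW(1)])
      (simp add: left_contract_tens contract_alpha_beta)
  also have "\<dots> = opSt (tens P alpha) + smul (1 / qw) (tens beta P)"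
    by (simp add: left_contract_smul[OF central_PUW(1)] left_contract_P)
  finally have "smul (qw / q2) (smul (q2 / qw) (tens beta P - tens W U)) = smul (qw / q2) (opSt (tens P alpha) + smul (1 / qw) (tens beta P))"
    by (simp add: left_Si_ThetaP P_beta_commute)
  then have "tens beta P - tens W U = smul (qw / q2) (opSt (tens P alpha)) + smul (1 / q2) (tens beta P)"
    using nonzero by (simp add: fam.scale_right_distrib)
  then have "tens W U = tens beta P - (smul (qw / q2) (opSt (tens P alpha)) + smul (1 / q2) (tens beta P))"
    by (simp add: algebra_simps)
  then show ?thesis
    by (simp add: fam.scale_left_diff_distrib algebra_simps)
qed

lemma UU_eq: "opS (tens U U) = smul (- (qw / q2)) (tens U U)"
proof -
  \<comment> \<open>With \<open>W U\<close> known, the right hand side of \<open>UU_deviation\<close> is a multiple of \<open>\<beta> P\<close>, with factor \<open>0\<close>.\<close>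
  have WU: "opS (tens W U) = smul ((1 - 1 / q2) * qw) (tens beta P) - smul (qw / q2) (tens alpha P)"
    using S_P_beta alpha_P_eq' by (simp add: WU_eq act123_linear P_beta_commute)
  have "tens U U + smul (q2 / qw) (opS (tens U U)) = smul q2 (tens beta P) - tens beta P - smul (q2 - 1) (tens beta P)"
  proof -
    have "q2 / qw * ((1 - 1 / q2) * qw) = q2 - 1" "q2 / qw * (qw / q2) = 1"
      using nonzero by (simp_all add: field_simps)
    then show ?thesis
      unfolding UU_deviation WU Theta_alpha_beta tens_linear P_beta_commute fam.scale_right_diff_distrib fam.scale_scale by simp
  qed
  then have "tens U U + smul (q2 / qw) (opS (tens U U)) = 0"
    by (simp add: fam.scale_left_diff_distrib)
  then have "smul (qw / q2) (smul (q2 / qw) (opS (tens U U))) = smul (qw / q2) (- tens U U)"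
    by (simp add: add_eq_0_iff)
  then show ?thesis using nonzero by simp
qed

lemma WW_eq: "opSt (tens W W) = smul (- (q2 / qw)) (tens W W)"
proof -
  have "tens W W + smul (qw / q2) (opSt (tens W W)) = 0"
    unfolding WW_deviation WU_eq using nonzero
    by (simp add: Theta_alpha_beta tens_linear P_beta_commute act234_linear St_beta_P fam.scale_right_distrib fam.scale_left_diff_distrib)
  then have "smul (q2 / qw) (smul (qw / q2) (opSt (tens W W))) = smul (q2 / qw) (- tens W W)"
    by (simp add: add_eq_0_iff)
  then show ?thesis using nonzero by simp
qed

text \<open>
  The relations by which the product of forms vanishes on \<open>id + \<sigma>\<close>, one for each pair of types.
\<close>

theorem wedge_UU: "tens U U + smul q2 (opS (opSt (tens U U))) = 0"
  using nonzero by (simp add: St_UU act123_linear UU_eq)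

theorem wedge_WW: "tens W W + smul (1 / q2) (opS (opSt (tens W W))) = 0"
  using nonzero by (simp add: WW_eq act123_linear S_WW)

text \<open>
  The image of the metric component in the order \<open>W U\<close>.
\<close>

definition g where "g = (\<Sum>i\<in>UNIV. sc (e i) * beta i i)"

text \<open>
  Contract \<open>P \<beta> = \<beta> P\<close> in the last two legs.
\<close>

lemma P_g: "P i j * g = sc qm * beta i j"
proof -
  have "trace34 (tens P beta) = trace34 (tens beta P)" by (simp only: P_beta_commute)
  then have "P i j * g = beta i j * sc qm"
    by (simp add: trace_tens[OF central_PUW(1)] trace_tens[OF central_alpha_beta(2)] g_def trace_P fun_eq_iff)
  then show ?thesis using central_alpha_beta(2) by (simp add: central_fam_def)
qed

theorem wedge_UW: "tens U W + smul (q2\<^sup>2 / qw\<^sup>2) (opS (opSti (tens W U)))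
    + smul ((1 - q2) * q2 / qm) (tens (\<lambda>i j. P i j * g) P) = 0"
proof -
  \<comment> \<open>The operator is applied to \<open>WU_eq\<close>: \<open>\<beta> P = P \<beta>\<close> is an eigenvector of both factors, and the inverse of
    \<open>St\<close> cancels on the other term, where \<open>S P \<alpha>\<close> is known from \<open>UW_eq\<close>.\<close>
  have BP: "tens (\<lambda>i j. P i j * g) P = smul qm (tens beta P)"
    by (simp add: P_g tens_def smul_def mult.assoc)
  have "opSti (tens beta P) = smul qw (tens beta P)"
    using inv_ops(4)[of "tens beta P"] nonzero by (simp add: St_beta_P act234_linear) (metis fam.scale_scale fam.scale_one nonzero_divide_eq_eq times_divide_eq_right mult.right_neutral)
  moreover have "opS (tens beta P) = smul qw (tens beta P)" using S_P_beta by (simp add: P_beta_commute)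
  moreover have "opS (tens P alpha) = smul (qw / q2) (tens U W)" using nonzero by (simp add: UW_eq)
  ultimately have "opS (opSti (tens W U)) = smul ((1 - 1 / q2) * (qw * qw)) (tens beta P) - smul (qw / q2 * (qw / q2)) (tens U W)"
    by (simp add: WU_eq act123_linear act234_linear inv_ops)
  moreover have "q2\<^sup>2 / qw\<^sup>2 * ((1 - 1 / q2) * (qw * qw)) = q2 * (q2 - 1)" "q2\<^sup>2 / qw\<^sup>2 * (qw / q2 * (qw / q2)) = 1"
    "(1 - q2) * q2 / qm * qm = - (q2 * (q2 - 1))"
    using nonzero by (simp_all add: field_simps power2_eq_square)
  ultimately show ?thesis
    unfolding BP by (simp only: fam.scale_right_diff_distrib fam.scale_scale) simp
qed

text \<open>
  The metric component in the order \<open>U W\<close> has the image \<open>- g\<close>, because the contraction \<open>E'\<close> of \<open>\<Theta>\<close> is \<open>0\<close>.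
\<close>

theorem wedge_WU: "tens W U + smul (qw\<^sup>2 / q2\<^sup>2) (opSi (opSt (tens U W)))
    + smul ((1 - 1 / q2) / qm) (tens (\<lambda>i j. P i j * - g) P) = 0"
proof -
  have "tens (\<lambda>i j. P i j * - g) P = smul (- qm) (tens beta P)"
    by (simp add: P_g tens_def smul_def mult.assoc sc_simps fun_eq_iff)
  moreover have "opSt (tens U W) = smul (q2 / qw) (tens alpha P)" using nonzero by (simp add: alpha_P_eq)
  ultimately show ?thesis using nonzero
    by (simp add: WU_eq act123_linear Si_alpha_P) (simp add: field_simps power2_eq_square fam.scale_left_diff_distrib)
qed

end

section \<open>Chain modules and uniqueness of braidings\<close>

lemma entry_column: "A $ j $ i = (A *v axis i 1) $ j" for A :: "complex ^ 'i::finite ^ 'j"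
  by (simp add: matrix_vector_mult_def axis_def if_distrib cong: if_cong)

lemma matrix_eq_columns:
  fixes A B :: "complex ^ 'i::finite ^ 'j"
  assumes "\<And>i. A *v axis i 1 = B *v axis i 1"
  shows "A = B"
  using assms by (simp add: vec_eq_iff[of A B] vec_eq_iff[of "A $ _"] entry_column)

lemma kron_tensor_vec: "kron A B *v tensor_vec x y = tensor_vec (A *v x) (B *v y)"
  for A :: "complex ^ 'i::finite ^ 'i" and B :: "complex ^ 'j::finite ^ 'j"
proof -
  have "(kron A B *v tensor_vec x y) $ k = tensor_vec (A *v x) (B *v y) $ k" for k
  proof -
    have "(kron A B *v tensor_vec x y) $ k
        = (\<Sum>j\<in>UNIV \<times> UNIV. A $ fst k $ fst j * B $ snd k $ snd j * (x $ fst j * y $ snd j))"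
      by (simp add: kron_def tensor_vec_def matrix_vector_mult_def)
    also have "\<dots> = (\<Sum>i\<in>UNIV. A $ fst k $ i * x $ i) * (\<Sum>j\<in>UNIV. B $ snd k $ j * y $ j)"
      unfolding sum_product sum.cartesian_product by (rule sum.cong) (auto simp: ac_simps)
    finally show ?thesis by (simp add: tensor_vec_def matrix_vector_mult_def)
  qed
  then show ?thesis by (simp add: vec_eq_iff)
qed

lemma tensor_vec_axis: "tensor_vec (axis i 1) (axis j 1) = axis (i, j) 1"
  by (auto simp: tensor_vec_def axis_def vec_eq_iff)

lemma tensor_vec_linear:
  "tensor_vec (c *s x) y = c *s tensor_vec x y" "tensor_vec x (c *s y) = c *s tensor_vec x y"
  "tensor_vec 0 y = 0" "tensor_vec x 0 = 0"
  by (simp_all add: tensor_vec_def vec_eq_iff algebra_simps)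

lemma mult_vec_linear:
  fixes A :: "complex ^ 'i::finite ^ 'j"
  shows "A *v (c *s x) = c *s (A *v x)" "A *v (x + y) = A *v x + A *v y" "A *v 0 = 0"
    "A *v (\<Sum>u\<in>I. f u) = (\<Sum>u\<in>I. A *v f u)"
     apply (simp_all add: vec.scale vec.add vec.sum)
  done

lemma uq_tensor_action:
  fixes X :: "('i::finite) uq_mod" and Y :: "('j::finite) uq_mod"
  shows "uK (uq_tensor X Y) i *v axis (x, y) 1 = tensor_vec (uK X i *v axis x 1) (uK Y i *v axis y 1)"
    "uKinv (uq_tensor X Y) i *v axis (x, y) 1 = tensor_vec (uKinv X i *v axis x 1) (uKinv Y i *v axis y 1)"
    "uE (uq_tensor X Y) i *v axis (x, y) 1
       = tensor_vec (uE X i *v axis x 1) (uK Y i *v axis y 1) + tensor_vec (axis x 1) (uE Y i *v axis y 1)"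
    "uF (uq_tensor X Y) i *v axis (x, y) 1
       = tensor_vec (uF X i *v axis x 1) (axis y 1) + tensor_vec (uKinv X i *v axis x 1) (uF Y i *v axis y 1)"
  by (simp_all add: uq_tensor_def tensor_vec_axis[symmetric] kron_tensor_vec matrix_vector_mult_add_rdistrib)

text \<open>
  A module with a basis \<open>b 0, \<dots>, b r\<close>, on which \<open>F\<close> of the \<open>k\<close>-th node \<open>\<nu> k\<close> only moves \<open>b k\<close>, to a multiple of
  \<open>b (k + 1)\<close>, and \<open>E\<close> moves it back.  The factors \<open>\<phi>\<close> are kept because the basis of \<open>V\<close> is an arbitrary
  weight basis, and \<open>\<nu>\<close> because the chain of \<open>V\<close> runs through the nodes in decreasing order if \<open>s = r\<close>.
\<close>

locale chain_module =
  fixes r :: nat and Q :: complex and X :: "('i::finite) uq_mod"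
    and \<nu> :: "nat \<Rightarrow> nat" and b :: "nat \<Rightarrow> 'i" and \<phi> :: "nat \<Rightarrow> complex"
  assumes Q_nonzero: "Q \<noteq> 0"
    and node_bij: "bij_betw \<nu> {..<r} {1..r}"
    and basis_bij: "bij_betw b {..r} UNIV"
    and phi_nonzero: "k < r \<Longrightarrow> \<phi> k \<noteq> 0"
    and act_F: "k < r \<Longrightarrow> l \<le> r \<Longrightarrow>
      uF X (\<nu> k) *v axis (b l) 1 = (if l = k then \<phi> k *s axis (b (Suc k)) 1 else 0)"
    and act_E: "k < r \<Longrightarrow> l \<le> r \<Longrightarrow>
      uE X (\<nu> k) *v axis (b l) 1 = (if l = Suc k then (1 / \<phi> k) *s axis (b k) 1 else 0)"
    and act_K: "k < r \<Longrightarrow> l \<le> r \<Longrightarrow>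
      uK X (\<nu> k) *v axis (b l) 1 = (if l = k then Q else if l = Suc k then 1 / Q else 1) *s axis (b l) 1"
    and act_Kinv: "k < r \<Longrightarrow> l \<le> r \<Longrightarrow>
      uKinv X (\<nu> k) *v axis (b l) 1 = (if l = k then 1 / Q else if l = Suc k then Q else 1) *s axis (b l) 1"
begin

lemma b_eq_iff: "l \<le> r \<Longrightarrow> m \<le> r \<Longrightarrow> b l = b m \<longleftrightarrow> l = m"
  using basis_bij by (auto simp: bij_betw_def inj_on_def)

lemma b_cases:
  obtains l where "l \<le> r" "i = b l"
proof -
  have "i \<in> b ` {..r}" using basis_bij by (simp add: bij_betw_def)
  then show ?thesis using that by auto
qed

lemma node_cases:
  assumes "i \<in> {1..r}"
  obtains k where "k < r" "i = \<nu> k"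
proof -
  have "i \<in> \<nu> ` {..<r}" using node_bij assms by (simp add: bij_betw_def)
  then show ?thesis using that by auto
qed

lemma transpose_unit:
  fixes A :: "complex ^ 'i ^ 'i"
  assumes A: "\<And>l. l \<le> r \<Longrightarrow> A *v axis (b l) 1 = (if l = k then c *s axis (b k') 1 else 0)"
    and "k \<le> r" "k' \<le> r" "l \<le> r"
  shows "transpose A *v axis (b l) 1 = (if l = k' then c *s axis (b k) 1 else 0)"
proof -
  have "(transpose A *v axis (b l) 1) $ i = (if l = k' then c *s axis (b k) 1 else 0) $ i" for i
  proof -
    obtain m where m: "m \<le> r" "i = b m" by (rule b_cases)
    have "(transpose A *v axis (b l) 1) $ i = (A *v axis (b m) 1) $ b l"
      by (simp add: entry_column[symmetric] transpose_def m)
    then show ?thesis using A[OF m(1)] assms(2-) m by (auto simp: axis_def b_eq_iff)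
  qed
  then show ?thesis by (simp add: vec_eq_iff)
qed

lemma transpose_diag:
  fixes A :: "complex ^ 'i ^ 'i"
  assumes A: "\<And>l. l \<le> r \<Longrightarrow> A *v axis (b l) 1 = c l *s axis (b l) 1" and "l \<le> r"
  shows "transpose A *v axis (b l) 1 = c l *s axis (b l) 1"
proof -
  have "(transpose A *v axis (b l) 1) $ i = (c l *s axis (b l) 1) $ i" for i
  proof -
    obtain m where m: "m \<le> r" "i = b m" by (rule b_cases)
    have "(transpose A *v axis (b l) 1) $ i = (A *v axis (b m) 1) $ b l"
      by (simp add: entry_column[symmetric] transpose_def m)
    then show ?thesis using A[OF m(1)] assms(2-) m by (auto simp: axis_def b_eq_iff)
  qed
  then show ?thesis by (simp add: vec_eq_iff)
qed

lemma dual_act: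
  assumes k: "k < r" and l: "l \<le> r"
  shows "uF (uq_dual X) (\<nu> k) *v axis (b l) 1 = (if l = Suc k then (- (\<phi> k / Q)) *s axis (b k) 1 else 0)"
    "uE (uq_dual X) (\<nu> k) *v axis (b l) 1 = (if l = k then (- (Q / \<phi> k)) *s axis (b (Suc k)) 1 else 0)"
    "uK (uq_dual X) (\<nu> k) *v axis (b l) 1 = (if l = k then 1 / Q else if l = Suc k then Q else 1) *s axis (b l) 1"
    "uKinv (uq_dual X) (\<nu> k) *v axis (b l) 1 = (if l = k then Q else if l = Suc k then 1 / Q else 1) *s axis (b l) 1"
proof -
  have neg: "(- A) *v x = - (A *v x)" for A :: "complex ^ 'i ^ 'i" and x
    by (simp add: matrix_vector_mult_def vec_eq_iff sum_negf)
  have F: "(- (uK X (\<nu> k) ** uF X (\<nu> k))) *v axis (b l) 1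
      = (if l = k then (- (\<phi> k / Q)) *s axis (b (Suc k)) 1 else 0)" if "l \<le> r" for l
    using k that by (auto simp add: neg matrix_vector_mul_assoc[symmetric] act_F mult_vec_linear act_K vector_smult_assoc)
  have E: "(- (uE X (\<nu> k) ** uKinv X (\<nu> k))) *v axis (b l) 1
      = (if l = Suc k then (- (Q / \<phi> k)) *s axis (b k) 1 else 0)" if "l \<le> r" for l
    using k that by (auto simp add: neg matrix_vector_mul_assoc[symmetric] act_E mult_vec_linear act_Kinv vector_smult_assoc)
  show "uF (uq_dual X) (\<nu> k) *v axis (b l) 1 = (if l = Suc k then (- (\<phi> k / Q)) *s axis (b k) 1 else 0)"
    using transpose_unit[OF F _ _ l] k by (simp add: uq_dual_def)
  show "uE (uq_dual X) (\<nu> k) *v axis (b l) 1 = (if l = k then (- (Q / \<phi> k)) *s axis (b (Suc k)) 1 else 0)"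
    using transpose_unit[OF E _ _ l] k by (simp add: uq_dual_def)
  show "uK (uq_dual X) (\<nu> k) *v axis (b l) 1 = (if l = k then 1 / Q else if l = Suc k then Q else 1) *s axis (b l) 1"
    using transpose_diag[OF act_Kinv[OF k] l] by (simp add: uq_dual_def)
  show "uKinv (uq_dual X) (\<nu> k) *v axis (b l) 1 = (if l = k then Q else if l = Suc k then 1 / Q else 1) *s axis (b l) 1"
    using transpose_diag[OF act_K[OF k] l] by (simp add: uq_dual_def)
qed

text \<open>
  The dual of a chain runs in the opposite direction, so results on chain modules apply to it.
\<close>

lemma chain_module_dual:
  "chain_module r Q (uq_dual X) (\<lambda>k. \<nu> (r - 1 - k)) (\<lambda>l. b (r - l)) (\<lambda>k. - (\<phi> (r - 1 - k) / Q))"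
proof (rule chain_module.intro)
  show "Q \<noteq> 0" by (rule Q_nonzero)
  have "bij_betw (\<lambda>k. r - 1 - k) {..<r} {..<r}"
    by (rule bij_betw_byWitness[where f' = "\<lambda>k. r - 1 - k"]) auto
  then show "bij_betw (\<lambda>k. \<nu> (r - 1 - k)) {..<r} {1..r}"
    using bij_betw_trans[OF _ node_bij] by (simp add: o_def)
  have "bij_betw (\<lambda>k. r - k) {..r} {..r}"
    by (rule bij_betw_byWitness[where f' = "\<lambda>k. r - k"]) auto
  then show "bij_betw (\<lambda>l. b (r - l)) {..r} UNIV"
    using bij_betw_trans[OF _ basis_bij] by (simp add: o_def)
  fix k assume k: "k < r"
  then show "- (\<phi> (r - 1 - k) / Q) \<noteq> 0" using Q_nonzero phi_nonzero by simp
  fix l assume l: "l \<le> r"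
  have *: "r - 1 - k < r" "r - l \<le> r" using k l by auto
  have s: "Suc (r - 1 - k) = r - k" "r - Suc k = r - 1 - k" using k by auto
  have e: "r - l = r - 1 - k \<longleftrightarrow> l = Suc k" "r - l = r - k \<longleftrightarrow> l = k" using k l by auto
  have c: "(if l = Suc k then x else if l = k then y else z) = (if l = k then y else if l = Suc k then x else z)"
    for x y z :: complex by auto
  show "uF (uq_dual X) (\<nu> (r - 1 - k)) *v axis (b (r - l)) 1 =
           (if l = k then (- (\<phi> (r - 1 - k) / Q)) *s axis (b (r - Suc k)) 1 else 0)"
    using dual_act(1)[OF *] unfolding s e .
  show "uE (uq_dual X) (\<nu> (r - 1 - k)) *v axis (b (r - l)) 1 =
           (if l = Suc k then (1 / - (\<phi> (r - 1 - k) / Q)) *s axis (b (r - k)) 1 else 0)"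
    using dual_act(2)[OF *] unfolding s e by (simp only: divide_minus_right divide_divide_eq_right mult_1)
  show "uK (uq_dual X) (\<nu> (r - 1 - k)) *v axis (b (r - l)) 1 =
           (if l = k then Q else if l = Suc k then 1 / Q else 1) *s axis (b (r - l)) 1"
    using dual_act(3)[OF *] unfolding s e by (simp only: c)
  show "uKinv (uq_dual X) (\<nu> (r - 1 - k)) *v axis (b (r - l)) 1 =
           (if l = k then 1 / Q else if l = Suc k then Q else 1) *s axis (b (r - l)) 1"
    using dual_act(4)[OF *] unfolding s e by (simp only: c)
qed

lemma highest_in_span:
  assumes "\<And>i. i \<in> {1..r} \<Longrightarrow> uE X i *v v = 0"
  shows "v = (v $ b 0) *s axis (b 0) 1"
proof -
  have 0: "v $ b (Suc k) = 0" if k: "k < r" for k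
  proof -
    have "\<nu> k \<in> {1..r}" using node_bij k by (auto simp: bij_betw_def)
    then have "0 = (uE X (\<nu> k) *v v) $ b k" using assms by simp
    also have "\<dots> = (\<Sum>j\<in>UNIV. if j = b (Suc k) then 1 / \<phi> k * v $ j else 0)"
      unfolding matrix_vector_mult_def vec_lambda_beta
    proof (rule sum.cong)
      fix j
      obtain m where "m \<le> r" "j = b m" by (rule b_cases)
      then show "uE X (\<nu> k) $ b k $ j * v $ j = (if j = b (Suc k) then 1 / \<phi> k * v $ j else 0)"
        using k by (simp add: entry_column act_E b_eq_iff)
    qed simp
    also have "\<dots> = 1 / \<phi> k * v $ b (Suc k)" by simp
    finally show ?thesis using phi_nonzero[OF k] by simp
  qed
  have "v $ i = ((v $ b 0) *s axis (b 0) 1) $ i" for i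
  proof -
    obtain m where "m \<le> r" "i = b m" by (rule b_cases)
    then show ?thesis using 0[of "m - 1"] by (cases m) (auto simp: axis_def b_eq_iff)
  qed
  then show ?thesis by (intro vec_eq_iff[THEN iffD2] allI)
qed

lemma lowest_in_span:
  assumes "\<And>i. i \<in> {1..r} \<Longrightarrow> uF X i *v v = 0"
  shows "v = (v $ b r) *s axis (b r) 1"
proof -
  have 0: "v $ b k = 0" if k: "k < r" for k
  proof -
    have "\<nu> k \<in> {1..r}" using node_bij k by (auto simp: bij_betw_def)
    then have "0 = (uF X (\<nu> k) *v v) $ b (Suc k)" using assms by simp
    also have "\<dots> = (\<Sum>j\<in>UNIV. if j = b k then \<phi> k * v $ j else 0)"
      unfolding matrix_vector_mult_def vec_lambda_beta
    proof (rule sum.cong)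
      fix j
      obtain m where "m \<le> r" "j = b m" by (rule b_cases)
      then show "uF X (\<nu> k) $ b (Suc k) $ j * v $ j = (if j = b k then \<phi> k * v $ j else 0)"
        using k by (simp add: entry_column act_F b_eq_iff)
    qed simp
    also have "\<dots> = \<phi> k * v $ b k" by simp
    finally show ?thesis using phi_nonzero[OF k] by simp
  qed
  have "v $ i = ((v $ b r) *s axis (b r) 1) $ i" for i
  proof -
    obtain m where "m \<le> r" "i = b m" by (rule b_cases)
    then show ?thesis using 0[of m] by (cases "m = r") (auto simp: axis_def b_eq_iff)
  qed
  then show ?thesis by (intro vec_eq_iff[THEN iffD2] allI)
qed

end

text \<open>
  A highest weight vector tensored with a lowest weight vector generates the tensor product, so module
  maps that agree on it are equal.
\<close>

lemma tensor_cyclic: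
  fixes R R' :: "complex ^ ('i::finite \<times> 'j::finite) ^ 'k::finite"
  assumes X: "chain_module r Q X \<nu> b \<phi>" and Y: "chain_module r Q Y \<nu>' b' \<phi>'"
    and R: "uq_module_map r (uq_tensor X Y) Z R" "uq_module_map r (uq_tensor X Y) Z R'"
    and eq: "R *v axis (b 0, b' r) 1 = R' *v axis (b 0, b' r) 1"
  shows "R = R'"
proof -
  interpret X: chain_module r Q X \<nu> b \<phi> by (rule X)
  interpret Y: chain_module r Q Y \<nu>' b' \<phi>' by (rule Y)
  define W where "W = {x. R *v x = R' *v x}"
  have W_E: "uE (uq_tensor X Y) i *v x \<in> W" and W_F: "uF (uq_tensor X Y) i *v x \<in> W"
    if "x \<in> W" "i \<in> {1..r}" for x i
  proof -
    have "R *v (uE (uq_tensor X Y) i *v x) = uE Z i *v (R *v x)" "R' *v (uE (uq_tensor X Y) i *v x) = uE Z i *v (R' *v x)"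
      "R *v (uF (uq_tensor X Y) i *v x) = uF Z i *v (R *v x)" "R' *v (uF (uq_tensor X Y) i *v x) = uF Z i *v (R' *v x)"
      using R that(2) unfolding uq_module_map_def by (simp_all only: matrix_vector_mul_assoc)
    then show "uE (uq_tensor X Y) i *v x \<in> W" "uF (uq_tensor X Y) i *v x \<in> W"
      using that(1) by (simp_all only: W_def mem_Collect_eq)
  qed
  have W_sub: "x \<in> W" if "x + y \<in> W" "y \<in> W" for x y
    using that by (simp add: W_def mult_vec_linear)
  have W_scale: "c *s x \<in> W" if "x \<in> W" for c x
    using that by (simp add: W_def mult_vec_linear)
  have W_unscale: "x \<in> W" if "c *s x \<in> W" "c \<noteq> 0" for c x
    using W_scale[OF that(1), of "1 / c"] that(2) by (simp add: vector_smult_assoc)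
  have W_0: "0 \<in> W" by (simp add: W_def)
  have X_node: "\<nu> k \<in> {1..r}" if "k < r" for k using X.node_bij that by (auto simp: bij_betw_def)
  have Y_node: "\<nu>' k \<in> {1..r}" if "k < r" for k using Y.node_bij that by (auto simp: bij_betw_def)
  \<comment> \<open>The \<open>E\<close>s annihilate \<open>b 0\<close> and so move only the second factor; afterwards the \<open>F\<close>s move
    the first factor, up to terms that are already known to lie in \<open>W\<close>.\<close>
  have base: "axis (b 0, b' m) 1 \<in> W" if "m \<le> r" for m
    using that
  proof (induction m rule: inc_induct)
    case base
    show ?case using eq by (simp add: W_def)
  next
    case (step m)
    obtain k where k: "k < r" "\<nu>' m = \<nu> k" using X.node_cases[OF Y_node[OF step(2)]] by blast
    have "uE (uq_tensor X Y) (\<nu>' m) *v axis (b 0, b' (Suc m)) 1 = (1 / \<phi>' m) *s axis (b 0, b' m) 1"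
      using step(2) X.act_E[OF k(1), of 0]
      by (simp add: uq_tensor_action Y.act_E k(2)[symmetric] tensor_vec_linear tensor_vec_axis)
    then show ?case using W_E[OF step(3) Y_node[OF step(2)]] Y.phi_nonzero[OF step(2)] W_unscale by simp
  qed
  have all: "axis (b l, b' m) 1 \<in> W" if "l \<le> r" "m \<le> r" for l m
    using that
  proof (induction l arbitrary: m)
    case 0
    then show ?case using base by simp
  next
    case (Suc l)
    then have l: "l < r" by simp
    obtain k where k: "k < r" "\<nu> l = \<nu>' k" using Y.node_cases[OF X_node[OF l]] by blast
    have 1: "uF (uq_tensor X Y) (\<nu> l) *v axis (b l, b' m) 1 \<in> W"
      using W_F[OF Suc.IH X_node[OF l]] l Suc.prems by simp
    have "tensor_vec (axis (b l) 1) (uF Y (\<nu>' k) *v axis (b' m) 1) \<in> W"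
      using Suc.IH[of "Suc k"] Suc.prems l k by (simp add: Y.act_F tensor_vec_linear tensor_vec_axis W_0 W_scale)
    then have 2: "tensor_vec (uKinv X (\<nu> l) *v axis (b l) 1) (uF Y (\<nu> l) *v axis (b' m) 1) \<in> W"
      using l unfolding k(2) by (simp add: X.act_Kinv k(2)[symmetric] tensor_vec_linear W_scale)
    have "tensor_vec (uF X (\<nu> l) *v axis (b l) 1) (axis (b' m) 1) \<in> W"
      using W_sub[OF _ 2] 1 by (simp add: uq_tensor_action)
    then show ?case
      using l W_unscale[OF _ X.phi_nonzero[OF l]] by (simp add: X.act_F tensor_vec_linear tensor_vec_axis)
  qed
  show ?thesis
  proof (rule matrix_eq_columns)
    fix x :: "'i \<times> 'j"
    obtain l where l: "l \<le> r" "fst x = b l" by (rule X.b_cases)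
    obtain m where m: "m \<le> r" "snd x = b' m" by (rule Y.b_cases)
    have "x = (b l, b' m)" using l m by (simp add: prod_eq_iff)
    then show "R *v axis x 1 = R' *v axis x 1" using all[OF l(1) m(1)] by (simp add: W_def)
  qed
qed

text \<open>
  Highest and lowest weight vectors of a chain are multiples of its two ends, so one value of a module
  map is enough to meet the condition that defines the braiding.
\<close>

lemma braiding_eqI:
  fixes R :: "complex ^ ('i::finite \<times> 'j::finite) ^ ('j \<times> 'i)"
  assumes X: "chain_module r Q X \<nu> b \<phi>" and Y: "chain_module r Q Y \<nu>' b' \<phi>'"
    and R: "uq_module_map r (uq_tensor X Y) (uq_tensor Y X) R"
    and hw: "weight_vector r q X \<mu> (axis (b 0) 1)"
    and lw: "weight_vector r q Y (w0_act r \<mu>') (axis (b' r) 1)"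
    and val: "R *v axis (b 0, b' r) 1
        = complex_of_real (q powr wt_form r \<mu> (w0_act r \<mu>')) *s axis (b' r, b 0) 1"
  shows "braiding r q \<mu> X \<mu>' Y = R"
  unfolding braiding_def
proof (rule the_equality, intro conjI allI impI)
  interpret X: chain_module r Q X \<nu> b \<phi> by (rule X)
  interpret Y: chain_module r Q Y \<nu>' b' \<phi>' by (rule Y)
  show "uq_module_map r (uq_tensor X Y) (uq_tensor Y X) R" by (rule R)
  fix v u
  assume v: "highest_weight_vector r q X \<mu> v" and u: "lowest_weight_vector r q Y (w0_act r \<mu>') u"
  have "v = (v $ b 0) *s axis (b 0) 1"
    using v by (intro X.highest_in_span) (simp add: highest_weight_vector_def)
  moreover have "u = (u $ b' r) *s axis (b' r) 1"
    using u by (intro Y.lowest_in_span) (simp add: lowest_weight_vector_def)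
  ultimately obtain c c' where vu: "v = c *s axis (b 0) 1" "u = c' *s axis (b' r) 1" by blast
  show "R *v tensor_vec v u = complex_of_real (q powr wt_form r \<mu> (w0_act r \<mu>')) *s tensor_vec u v"
    unfolding vu by (simp add: tensor_vec_linear tensor_vec_axis mult_vec_linear val vector_smult_assoc mult.commute mult.left_commute)
next
  interpret X: chain_module r Q X \<nu> b \<phi> by (rule X)
  interpret Y: chain_module r Q Y \<nu>' b' \<phi>' by (rule Y)
  fix R'
  assume R': "uq_module_map r (uq_tensor X Y) (uq_tensor Y X) R' \<and>
     (\<forall>v u. highest_weight_vector r q X \<mu> v \<longrightarrow> lowest_weight_vector r q Y (w0_act r \<mu>') u \<longrightarrow>
        R' *v tensor_vec v u = complex_of_real (q powr wt_form r \<mu> (w0_act r \<mu>')) *s tensor_vec u v)"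
  have "uE X i *v axis (b 0) 1 = 0" if "i \<in> {1..r}" for i
    using X.node_cases[OF that] X.act_E[of _ 0] by (metis nat.simps(3) zero_le)
  then have h: "highest_weight_vector r q X \<mu> (axis (b 0) 1)"
    using hw by (simp add: highest_weight_vector_def)
  have "uF Y i *v axis (b' r) 1 = 0" if "i \<in> {1..r}" for i
    using Y.node_cases[OF that] Y.act_F[of _ r] by (metis less_irrefl order_refl)
  then have l: "lowest_weight_vector r q Y (w0_act r \<mu>') (axis (b' r) 1)"
    using lw by (simp add: lowest_weight_vector_def)
  have "R' *v axis (b 0, b' r) 1 = R *v axis (b 0, b' r) 1"
    using R' h l val by (simp add: tensor_vec_axis[symmetric])
  then show "R' = R"
    using tensor_cyclic[OF X Y _ R] R' by blast
qed

section \<open>Explicit braidings of chain modules\<close>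

lemma uq_module_mapI:
  fixes R :: "complex ^ 'i::finite ^ 'j::finite"
  assumes "\<And>i x. i \<in> {1..r} \<Longrightarrow> R *v (uK X i *v axis x 1) = uK Y i *v (R *v axis x 1)"
    and "\<And>i x. i \<in> {1..r} \<Longrightarrow> R *v (uKinv X i *v axis x 1) = uKinv Y i *v (R *v axis x 1)"
    and "\<And>i x. i \<in> {1..r} \<Longrightarrow> R *v (uE X i *v axis x 1) = uE Y i *v (R *v axis x 1)"
    and "\<And>i x. i \<in> {1..r} \<Longrightarrow> R *v (uF X i *v axis x 1) = uF Y i *v (R *v axis x 1)"
  shows "uq_module_map r X Y R"
  unfolding uq_module_map_def
  by (intro ballI conjI; rule matrix_eq_columns; simp only: matrix_vector_mul_assoc[symmetric] assms)

lemma uq_module_map_inverse: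
  fixes R :: "complex ^ 'i::finite ^ 'i"
  assumes "uq_module_map r X Y R" "R ** R' = mat 1" "R' ** R = mat 1"
  shows "uq_module_map r Y X R'"
proof -
  have "R' ** B = A ** R'" if "R ** A = B ** R" for A B
  proof -
    have "R' ** B = R' ** (B ** R) ** R'"
      by (simp add: matrix_mul_assoc[symmetric] assms)
    also have "\<dots> = R' ** R ** A ** R'" by (simp add: that[symmetric] matrix_mul_assoc)
    finally show ?thesis by (simp add: assms)
  qed
  then show ?thesis using assms(1) unfolding uq_module_map_def by blast
qed

lemma matrix_inv_inverse:
  assumes "invertible (A :: complex ^ 'i::finite ^ 'j::finite)"
  shows "A ** matrix_inv A = mat 1" "matrix_inv A ** A = mat 1"
proof -
  have "A ** matrix_inv A = mat 1 \<and> matrix_inv A ** A = mat 1"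
    unfolding matrix_inv_def by (rule someI_ex) (use assms in \<open>simp add: invertible_def\<close>)
  then show "A ** matrix_inv A = mat 1" "matrix_inv A ** A = mat 1" by auto
qed

lemma matrix_inv_eqI:
  assumes "A ** B = mat 1" "B ** A = (mat 1 :: complex ^ 'i::finite ^ 'i)"
  shows "matrix_inv A = B"
proof -
  have "invertible A" using assms by (auto simp: invertible_def)
  then have "matrix_inv A = (B ** A) ** matrix_inv A" by (simp add: assms)
  also have "\<dots> = B" using matrix_inv_inverse(1)[OF \<open>invertible A\<close>] by (simp add: matrix_mul_assoc[symmetric])
  finally show ?thesis .
qed

lemma tensor_vec_if:
  "tensor_vec (if c then x else y) z = (if c then tensor_vec x z else tensor_vec y z)"
  "tensor_vec z (if c then x else y) = (if c then tensor_vec z x else tensor_vec z y)"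
  by auto

context chain_module
begin

definition pos :: "'i \<Rightarrow> nat" where "pos = inv_into {..r} b"

lemma pos_b [simp]: "l \<le> r \<Longrightarrow> pos (b l) = l"
  using basis_bij by (simp add: pos_def bij_betw_def)

definition t :: complex where "t = Q - 1 / Q"

text \<open>
  The standard \<open>R\<close>-matrix of type \<open>A\<close>, scaled by \<open>z\<close>: the braiding of a chain module with itself.
\<close>

definition hecke :: "complex \<Rightarrow> complex ^ ('i \<times> 'i) ^ ('i \<times> 'i)" where
  "hecke z = (\<chi> x y. z * ((if x = (snd y, fst y) then if fst y = snd y then Q else 1 else 0)
     + (if x = y \<and> pos (snd y) < pos (fst y) then t else 0)))"

text \<open>
  The inverse of the braiding of a chain module with its dual.  Moving \<open>V\<close> past the evaluation
  \<open>V* \<otimes> V \<rightarrow> \<complex>\<close> shows that this inverse must be a partial transpose of the braiding on \<open>V \<otimes> V\<close>.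
\<close>

definition mixed :: "complex \<Rightarrow> complex ^ ('i \<times> 'i) ^ ('i \<times> 'i)" where
  "mixed z = (\<chi> x y. hecke z $ (fst y, fst x) $ (snd y, snd x))"

definition hecke_inv :: "complex \<Rightarrow> complex ^ ('i \<times> 'i) ^ ('i \<times> 'i)" where
  "hecke_inv z = (\<chi> x y. hecke z $ x $ y / z\<^sup>2 - (if x = y then t / z else 0))"

abbreviation ee :: "nat \<Rightarrow> nat \<Rightarrow> complex ^ ('i \<times> 'i)" where
  "ee l m \<equiv> axis (b l, b m) 1"

lemma hecke_column:
  assumes "l \<le> r" "m \<le> r"
  shows "hecke z *v ee l m = z *s ((if l = m then Q else 1) *s ee m l + (if m < l then t *s ee l m else 0))"
  unfolding vec_eq_iff entry_column[symmetric]
  using assms by (auto simp: hecke_def axis_def b_eq_iff)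

lemma mixed_column:
  assumes "l \<le> r" "m \<le> r"
  shows "mixed z *v ee l m = z *s ((if l = m then Q else 1) *s ee m l
     + (if l = m then t *s (\<Sum>u<l. ee u u) else 0))"
proof -
  have "(mixed z *v ee l m) $ x = (z *s ((if l = m then Q else 1) *s ee m l
     + (if l = m then t *s (\<Sum>u<l. ee u u) else 0))) $ x" for x
  proof -
    obtain i where i: "i \<le> r" "fst x = b i" by (rule b_cases)
    obtain j where j: "j \<le> r" "snd x = b j" by (rule b_cases)
    have x: "x = (b i, b j)" using i j by (simp add: prod_eq_iff)
    have "(\<Sum>u<l. ee u u) $ x = (\<Sum>u<l. if u = i then (if i = j then 1 else 0) else 0)"
      using assms i j unfolding sum_component x
      by (intro sum.cong) (auto simp: axis_def b_eq_iff)
    also have "\<dots> = (if i < l \<and> i = j then 1 else 0)" by simp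
    finally show ?thesis
      unfolding entry_column[symmetric] using assms i j
      by (auto simp: mixed_def hecke_def x axis_def b_eq_iff)
  qed
  then show ?thesis by (intro vec_eq_iff[THEN iffD2] allI)
qed

lemma hecke_inv_column:
  assumes "l \<le> r" "m \<le> r" "z \<noteq> 0"
  shows "hecke_inv z *v ee l m
     = (1 / z) *s ((if l = m then 1 / Q else 1) *s ee m l - (if l < m then t *s ee l m else 0))"
  unfolding vec_eq_iff entry_column[symmetric]
  using assms Q_nonzero by (auto simp: hecke_inv_def hecke_def axis_def b_eq_iff power2_eq_square t_def field_simps)

lemma basis2_cases:
  obtains l m where "l \<le> r" "m \<le> r" "x = (b l, b m)"
proof -
  obtain i where i: "i \<le> r" "fst x = b i" by (rule b_cases)
  obtain j where j: "j \<le> r" "snd x = b j" by (rule b_cases)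
  have x: "x = (b i, b j)" using i j by (simp add: prod_eq_iff)
  then show ?thesis using that i j by blast
qed

lemma hecke_inverse:
  assumes "z \<noteq> 0"
  shows "hecke z ** hecke_inv z = mat 1" "hecke_inv z ** hecke z = mat 1"
proof -
  show 1: "hecke z ** hecke_inv z = mat 1"
  proof (rule matrix_eq_columns)
    fix x
    obtain l m where lm: "l \<le> r" "m \<le> r" "x = (b l, b m)" by (rule basis2_cases)
    have "hecke z *v (hecke_inv z *v ee l m) = ee l m"
      using lm(1,2) assms Q_nonzero
      by (simp add: hecke_inv_column hecke_column mult_vec_linear vec.diff vec_eq_iff)
    then show "(hecke z ** hecke_inv z) *v axis x 1 = mat 1 *v axis x 1"
      by (simp add: lm matrix_vector_mul_assoc)
  qed
  then show "hecke_inv z ** hecke z = mat 1" by (simp add: matrix_left_right_inverse)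
qed

lemma mixed_invertible:
  assumes "z \<noteq> 0"
  shows "mixed z ** matrix_inv (mixed z) = mat 1" "matrix_inv (mixed z) ** mixed z = mat 1"
proof -
  let ?G = "mixed z"
  let ?I = "range ((*v) ?G)"
  have sub: "vec.subspace ?I" by (intro vec.subspace_image vec.subspace_UNIV)
  have off: "ee m l \<in> ?I" if "l \<le> r" "m \<le> r" "l \<noteq> m" for l m
  proof -
    have "?G *v ((1 / z) *s ee l m) = ee m l"
      using that assms by (simp add: mult_vec_linear mixed_column vector_smult_assoc)
    then show ?thesis by (metis rangeI)
  qed
  \<comment> \<open>The matrix is triangular on the vectors \<open>ee l l\<close>, so they are reached one after the other.\<close>
  have diag: "ee l l \<in> ?I" if "l \<le> r" for l
    using that
  proof (induction l rule: less_induct)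
    case (less l)
    have "(\<Sum>u<l. ee u u) \<in> ?I"
      using less by (intro vec.subspace_sum[OF sub]) auto
    then have 1: "(- (t / Q)) *s (\<Sum>u<l. ee u u) \<in> ?I" by (rule vec.subspace_scale[OF sub])
    have 2: "(1 / (z * Q)) *s (?G *v ee l l) \<in> ?I" by (intro vec.subspace_scale[OF sub]) auto
    have "ee l l = (1 / (z * Q)) *s (?G *v ee l l) + (- (t / Q)) *s (\<Sum>u<l. ee u u)"
      using less.prems assms Q_nonzero by (simp add: mixed_column vec_eq_iff field_simps)
    then show ?case using vec.subspace_add[OF sub 2 1] by (simp only:)
  qed
  have "x \<in> ?I" for x
  proof -
    have "x = (\<Sum>k\<in>UNIV. (x $ k) *s axis k 1)"
      by (simp add: vec_eq_iff sum_component axis_def if_distrib cong: if_cong)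
    also have "\<dots> \<in> ?I"
    proof (intro vec.subspace_sum[OF sub] vec.subspace_scale[OF sub])
      fix k :: "'i \<times> 'i"
      obtain l m where lm: "l \<le> r" "m \<le> r" "k = (b l, b m)" by (rule basis2_cases)
      then show "axis k 1 \<in> ?I" using off diag by (cases "l = m") auto
    qed
    finally show ?thesis .
  qed
  then have "surj ((*v) ?G)" by auto
  then have "invertible ?G"
    using matrix_right_invertible_surjective invertible_right_inverse by blast
  then show "?G ** matrix_inv ?G = mat 1" "matrix_inv ?G ** ?G = mat 1"
    by (rule matrix_inv_inverse)+
qed

text \<open>
  The sum that arises when the weighted contraction meets a column of \<open>mixed\<close>.  It telescopes
  since \<open>Q e\<^sub>l - t e\<^sub>l = e\<^sub>l / Q = Q e\<^sub>l\<^sub>+\<^sub>1\<close>.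
\<close>

lemma ev_mixed_sum:
  fixes e :: "nat \<Rightarrow> complex"
  assumes e: "\<And>l. l < r \<Longrightarrow> Q * e (Suc l) = e l / Q" and "l \<le> r" "i \<le> r"
  shows "(\<Sum>u<l. if u = i then e i / Q else if i < u then - (t * e u) else 0) = (if i < l then Q * e l else 0)"
  using assms(2)
proof (induction l)
  case (Suc l)
  then have IH: "(\<Sum>u<l. if u = i then e i / Q else if i < u then - (t * e u) else 0) = (if i < l then Q * e l else 0)"
    by simp
  have "Q * e l - t * e l = e l / Q" by (simp add: t_def algebra_simps)
  then show ?case using e[of l] Suc.prems by (auto simp: IH)
qed simp

lemma tensor_act:
  assumes "k < r" "l \<le> r" "m \<le> r"
  shows "uF (uq_tensor X X) (\<nu> k) *v ee l m = (if l = k then \<phi> k *s ee (Suc k) m else 0)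
      + (if m = k then ((if l = k then 1 / Q else if l = Suc k then Q else 1) * \<phi> k) *s ee l (Suc k) else 0)"
    "uE (uq_tensor X X) (\<nu> k) *v ee l m
      = (if l = Suc k then ((if m = k then Q else if m = Suc k then 1 / Q else 1) / \<phi> k) *s ee k m else 0)
      + (if m = Suc k then (1 / \<phi> k) *s ee l k else 0)"
    "uK (uq_tensor X X) (\<nu> k) *v ee l m = ((if l = k then Q else if l = Suc k then 1 / Q else 1)
      * (if m = k then Q else if m = Suc k then 1 / Q else 1)) *s ee l m"
    "uKinv (uq_tensor X X) (\<nu> k) *v ee l m = ((if l = k then 1 / Q else if l = Suc k then Q else 1)
      * (if m = k then 1 / Q else if m = Suc k then Q else 1)) *s ee l m"
  using assms
  by (simp_all add: uq_tensor_action act_F act_E act_K act_Kinv tensor_vec_linear tensor_vec_if tensor_vec_axis vector_smult_assoc)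

text \<open>
  A check on basis vectors \<open>b l \<otimes> b m\<close>: the \<open>k\<close>-th generators see only whether \<open>l\<close> and \<open>m\<close> are below \<open>k\<close>, equal
  to \<open>k\<close> or \<open>k + 1\<close>, or above \<open>k + 1\<close>, which leaves sixteen cases.
\<close>

lemma hecke_module_map: "uq_module_map r (uq_tensor X X) (uq_tensor X X) (hecke z)"
proof (rule uq_module_mapI)
  fix i x
  assume "i \<in> {1..r}"
  then obtain k where k: "k < r" "i = \<nu> k" by (rule node_cases)
  obtain l m where x: "l \<le> r" "m \<le> r" "x = (b l, b m)" by (rule basis2_cases)
  have k': "k \<le> r" "Suc k \<le> r" using k by auto
  note simps = tensor_act[OF k(1)] hecke_column mult_vec_linear k(2) x k'
  have cases: thesis if "l = k \<Longrightarrow> thesis" "l = Suc k \<Longrightarrow> thesis" "l < k \<Longrightarrow> thesis" "l > Suc k \<Longrightarrow> thesis" for thesis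
    using that by linarith
  have cases': thesis if "m = k \<Longrightarrow> thesis" "m = Suc k \<Longrightarrow> thesis" "m < k \<Longrightarrow> thesis" "m > Suc k \<Longrightarrow> thesis" for thesis
    using that by linarith
  show "hecke z *v (uK (uq_tensor X X) i *v axis x 1) = uK (uq_tensor X X) i *v (hecke z *v axis x 1)"
    "hecke z *v (uKinv (uq_tensor X X) i *v axis x 1) = uKinv (uq_tensor X X) i *v (hecke z *v axis x 1)"
    using x(1,2) by (auto simp: simps vector_smult_assoc vec_eq_iff algebra_simps)
  show "hecke z *v (uE (uq_tensor X X) i *v axis x 1) = uE (uq_tensor X X) i *v (hecke z *v axis x 1)"
    apply (rule cases; rule cases')
    using x(1,2) Q_nonzero phi_nonzero[OF k(1)] by (simp_all add: simps vec_eq_iff) (auto simp: t_def field_simps)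
  show "hecke z *v (uF (uq_tensor X X) i *v axis x 1) = uF (uq_tensor X X) i *v (hecke z *v axis x 1)"
    apply (rule cases; rule cases')
    using x(1,2) Q_nonzero phi_nonzero[OF k(1)] by (simp_all add: simps vec_eq_iff) (auto simp: t_def field_simps)
qed

lemma tensor_dual_act:
  assumes "k < r" "l \<le> r" "m \<le> r"
  shows "uF (uq_tensor (uq_dual X) X) (\<nu> k) *v ee l m = (if l = Suc k then (- (\<phi> k / Q)) *s ee k m else 0)
      + (if m = k then ((if l = k then Q else if l = Suc k then 1 / Q else 1) * \<phi> k) *s ee l (Suc k) else 0)"
    "uE (uq_tensor (uq_dual X) X) (\<nu> k) *v ee l m
      = (if l = k then (- (Q / \<phi> k) * (if m = k then Q else if m = Suc k then 1 / Q else 1)) *s ee (Suc k) m else 0)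
      + (if m = Suc k then (1 / \<phi> k) *s ee l k else 0)"
    "uK (uq_tensor (uq_dual X) X) (\<nu> k) *v ee l m = ((if l = k then 1 / Q else if l = Suc k then Q else 1)
      * (if m = k then Q else if m = Suc k then 1 / Q else 1)) *s ee l m"
    "uKinv (uq_tensor (uq_dual X) X) (\<nu> k) *v ee l m = ((if l = k then Q else if l = Suc k then 1 / Q else 1)
      * (if m = k then 1 / Q else if m = Suc k then Q else 1)) *s ee l m"
    "uF (uq_tensor X (uq_dual X)) (\<nu> k) *v ee l m = (if l = k then \<phi> k *s ee (Suc k) m else 0)
      + (if m = Suc k then ((if l = k then 1 / Q else if l = Suc k then Q else 1) * (- (\<phi> k / Q))) *s ee l k else 0)"
    "uE (uq_tensor X (uq_dual X)) (\<nu> k) *v ee l m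
      = (if l = Suc k then ((if m = k then 1 / Q else if m = Suc k then Q else 1) / \<phi> k) *s ee k m else 0)
      + (if m = k then (- (Q / \<phi> k)) *s ee l (Suc k) else 0)"
    "uK (uq_tensor X (uq_dual X)) (\<nu> k) *v ee l m = ((if l = k then Q else if l = Suc k then 1 / Q else 1)
      * (if m = k then 1 / Q else if m = Suc k then Q else 1)) *s ee l m"
    "uKinv (uq_tensor X (uq_dual X)) (\<nu> k) *v ee l m = ((if l = k then 1 / Q else if l = Suc k then Q else 1)
      * (if m = k then Q else if m = Suc k then 1 / Q else 1)) *s ee l m"
  using assms
  by (simp_all only: uq_tensor_action act_F act_E act_K act_Kinv dual_act tensor_vec_linear tensor_vec_if tensor_vec_axis vector_smult_assoc)
     auto

text \<open>
  The full sum of all \<open>v\<^sub>u \<otimes> f\<^sup>u\<close> is invariant, hence on a partial sum only the boundary term survives.  These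
  sums occur in the columns of \<open>mixed\<close>.
\<close>

lemma partial_coevaluation_act:
  assumes "k < r" "l \<le> r"
  shows "uF (uq_tensor X (uq_dual X)) (\<nu> k) *v (\<Sum>u<l. ee u u) = (if l = Suc k then \<phi> k *s ee (Suc k) k else 0)"
    "uE (uq_tensor X (uq_dual X)) (\<nu> k) *v (\<Sum>u<l. ee u u) = (if l = Suc k then (- (Q / \<phi> k)) *s ee k (Suc k) else 0)"
    "uK (uq_tensor X (uq_dual X)) (\<nu> k) *v (\<Sum>u<l. ee u u) = (\<Sum>u<l. ee u u)"
    "uKinv (uq_tensor X (uq_dual X)) (\<nu> k) *v (\<Sum>u<l. ee u u) = (\<Sum>u<l. ee u u)"
proof -
  note simps = tensor_dual_act[OF assms(1)]
  show "uF (uq_tensor X (uq_dual X)) (\<nu> k) *v (\<Sum>u<l. ee u u) = (if l = Suc k then \<phi> k *s ee (Suc k) k else 0)"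
    using assms(2)
  proof (induction l)
    case (Suc l)
    then show ?case using Q_nonzero assms(1)
      by (simp add: mult_vec_linear simps; auto simp: vec_eq_iff)
  qed (simp add: mult_vec_linear)
  show "uE (uq_tensor X (uq_dual X)) (\<nu> k) *v (\<Sum>u<l. ee u u) = (if l = Suc k then (- (Q / \<phi> k)) *s ee k (Suc k) else 0)"
    using assms(2)
  proof (induction l)
    case (Suc l)
    then show ?case using Q_nonzero assms(1)
      by (simp add: mult_vec_linear simps; auto simp: vec_eq_iff)
  qed (simp add: mult_vec_linear)
  show "uK (uq_tensor X (uq_dual X)) (\<nu> k) *v (\<Sum>u<l. ee u u) = (\<Sum>u<l. ee u u)"
    "uKinv (uq_tensor X (uq_dual X)) (\<nu> k) *v (\<Sum>u<l. ee u u) = (\<Sum>u<l. ee u u)"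
    using assms Q_nonzero by (auto simp: mult_vec_linear simps intro!: sum.cong)
qed

lemma mixed_module_map: "uq_module_map r (uq_tensor (uq_dual X) X) (uq_tensor X (uq_dual X)) (mixed z)"
proof (rule uq_module_mapI)
  fix i x
  assume "i \<in> {1..r}"
  then obtain k where k: "k < r" "i = \<nu> k" by (rule node_cases)
  obtain l m where x: "l \<le> r" "m \<le> r" "x = (b l, b m)" by (rule basis2_cases)
  have k': "k \<le> r" "Suc k \<le> r" using k by auto
  note simps = tensor_dual_act[OF k(1)] mixed_column partial_coevaluation_act[OF k(1)] mult_vec_linear(1-3) k(2) x k'
  have cases: thesis if "l = k \<Longrightarrow> thesis" "l = Suc k \<Longrightarrow> thesis" "l < k \<Longrightarrow> thesis" "l > Suc k \<Longrightarrow> thesis" for thesis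
    using that by linarith
  have cases': thesis if "m = k \<Longrightarrow> thesis" "m = Suc k \<Longrightarrow> thesis" "m < k \<Longrightarrow> thesis" "m > Suc k \<Longrightarrow> thesis" for thesis
    using that by linarith
  show "mixed z *v (uK (uq_tensor (uq_dual X) X) i *v axis x 1) = uK (uq_tensor X (uq_dual X)) i *v (mixed z *v axis x 1)"
    "mixed z *v (uKinv (uq_tensor (uq_dual X) X) i *v axis x 1) = uKinv (uq_tensor X (uq_dual X)) i *v (mixed z *v axis x 1)"
    using x(1,2) Q_nonzero by (auto simp: simps vec.diff vec_eq_iff)
  show "mixed z *v (uE (uq_tensor (uq_dual X) X) i *v axis x 1) = uE (uq_tensor X (uq_dual X)) i *v (mixed z *v axis x 1)"
    apply (rule cases; rule cases')
    using x(1,2) Q_nonzero phi_nonzero[OF k(1)] by (simp_all add: simps vec.diff vec.neg vec_eq_iff) (auto simp: t_def field_simps)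
  show "mixed z *v (uF (uq_tensor (uq_dual X) X) i *v axis x 1) = uF (uq_tensor X (uq_dual X)) i *v (mixed z *v axis x 1)"
    apply (rule cases; rule cases')
    using x(1,2) Q_nonzero phi_nonzero[OF k(1)] by (simp_all add: simps vec.diff vec.neg vec_eq_iff) (auto simp: t_def field_simps)
qed

text \<open>
  The contractions of legs 1, 2 and of legs 2, 3 as matrices, with weights \<open>e\<close>: for the weights of \<open>E'\<close> they are
  \<open>E'\<^sub>1\<^sub>2\<close> and \<open>E'\<^sub>2\<^sub>3\<close>, for \<open>e = 1\<close> they are the evaluations \<open>E\<^sub>1\<^sub>2\<close> and \<open>E\<^sub>2\<^sub>3\<close>.
\<close>

definition ev12 :: "('i \<Rightarrow> complex) \<Rightarrow> complex ^ ('i \<times> 'i \<times> 'i) ^ 'i" where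
  "ev12 e = (\<chi> i y. if fst y = fst (snd y) \<and> snd (snd y) = i then e (fst y) else 0)"
definition ev23 :: "('i \<Rightarrow> complex) \<Rightarrow> complex ^ ('i \<times> 'i \<times> 'i) ^ 'i" where
  "ev23 e = (\<chi> i y. if fst (snd y) = snd (snd y) \<and> fst y = i then e (fst (snd y)) else 0)"

lemma ev_axis:
  "ev12 e *v axis (i, j, k) 1 = (if i = j then e i *s axis k 1 else 0)"
  "ev23 e *v axis (i, j, k) 1 = (if j = k then e j *s axis i 1 else 0)"
  unfolding vec_eq_iff entry_column[symmetric] by (auto simp: ev12_def ev23_def axis_def)

text \<open>
  The columns of \<open>leg12 A\<close> and \<open>leg23 A\<close> are columns of \<open>A\<close> with a basis vector in the idle leg.
\<close>

definition emb12 :: "'i \<Rightarrow> complex ^ ('i \<times> 'i) \<Rightarrow> complex ^ ('i \<times> 'i \<times> 'i)" where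
  "emb12 k v = (\<chi> y. if snd (snd y) = k then v $ (fst y, fst (snd y)) else 0)"
definition emb23 :: "'i \<Rightarrow> complex ^ ('i \<times> 'i) \<Rightarrow> complex ^ ('i \<times> 'i \<times> 'i)" where
  "emb23 k v = (\<chi> y. if fst y = k then v $ (fst (snd y), snd (snd y)) else 0)"

lemma emb_linear:
  "emb12 k (x + y) = emb12 k x + emb12 k y" "emb12 k (x - y) = emb12 k x - emb12 k y"
  "emb12 k (c *s x) = c *s emb12 k x" "emb12 k 0 = 0" "emb12 k (\<Sum>u\<in>I. f u) = (\<Sum>u\<in>I. emb12 k (f u))"
  "emb12 k (axis (i, j) 1) = axis (i, j, k) 1"
  "emb23 k (x + y) = emb23 k x + emb23 k y" "emb23 k (x - y) = emb23 k x - emb23 k y"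
  "emb23 k (c *s x) = c *s emb23 k x" "emb23 k 0 = 0" "emb23 k (\<Sum>u\<in>I. f u) = (\<Sum>u\<in>I. emb23 k (f u))"
  "emb23 k (axis (i, j) 1) = axis (k, i, j) 1"
  by (auto simp: emb12_def emb23_def vec_eq_iff axis_def)

lemma leg_axis:
  "leg12 A *v axis (i, j, k) 1 = emb12 k (A *v axis (i, j) 1)"
  "leg23 A *v axis (i, j, k) 1 = emb23 i (A *v axis (j, k) 1)"
  unfolding vec_eq_iff entry_column[symmetric] by (auto simp: leg12_def leg23_def emb12_def emb23_def) (simp_all add: entry_column)

lemma basis3_cases:
  obtains j l m where "j \<le> r" "l \<le> r" "m \<le> r" "x = (b j, b l, b m)"
proof -
  obtain j where "j \<le> r" "fst x = b j" by (rule b_cases)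
  moreover obtain l m where "l \<le> r" "m \<le> r" "snd x = (b l, b m)" by (rule basis2_cases)
  ultimately show ?thesis using that by (metis prod.collapse)
qed

context
  fixes e :: "'i \<Rightarrow> complex"
  assumes e_step: "l < r \<Longrightarrow> Q * e (b (Suc l)) = e (b l) / Q"
begin

lemma ev_partial_sum:
  assumes "l \<le> r" "i \<le> r"
  shows "(\<Sum>u<l. if u = i then e (b i) / Q else if i < u then - (t * e (b u)) else 0) = (if i < l then Q * e (b l) else 0)"
  using ev_mixed_sum[of "\<lambda>l. e (b l)"] e_step assms by simp

text \<open>
  The braiding of \<open>V\<close> with \<open>V*\<close> followed by the evaluation \<open>E\<close> is a multiple of \<open>E'\<close>.
\<close>

lemma ev12_mixed:
  assumes "z \<noteq> 0"
  shows "ev12 e ** leg12 (mixed z) = (\<chi> i y. z * Q * e (b 0) * ev12 (\<lambda>_. 1) $ i $ y)"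
    "ev23 e ** leg23 (mixed z) = (\<chi> i y. z * Q * e (b 0) * ev23 (\<lambda>_. 1) $ i $ y)"
proof -
  \<comment> \<open>The sum telescopes because \<open>t e\<^sub>u = Q e\<^sub>u - Q e\<^sub>u\<^sub>+\<^sub>1\<close>.\<close>
  have s: "Q * e (b l) + (\<Sum>u<l. t * e (b u)) = Q * e (b 0)" if "l \<le> r" for l
    using that
  proof (induction l)
    case (Suc l)
    have "Q * e (b l) - t * e (b l) = e (b l) / Q" by (simp add: t_def algebra_simps)
    then show ?case using Suc e_step[of l] by (simp add: algebra_simps)
  qed simp
  have scale: "(\<chi> i y. c * A $ i $ y) *v v = c *s (A *v v)" for c and A :: "complex ^ ('i \<times> 'i \<times> 'i) ^ 'i" and v
    by (simp add: vec_eq_iff matrix_vector_mult_def sum_distrib_left mult.assoc)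
  have pull: "(\<Sum>u<l. c u *s x) = (\<Sum>u<l. c u) *s x" for c and l :: nat and x :: "complex ^ 'i"
    by (simp add: vec_eq_iff sum_component sum_distrib_right)
  show "ev12 e ** leg12 (mixed z) = (\<chi> i y. z * Q * e (b 0) * ev12 (\<lambda>_. 1) $ i $ y)"
  proof (rule matrix_eq_columns)
    fix x
    obtain j l m where x: "j \<le> r" "l \<le> r" "m \<le> r" "x = (b j, b l, b m)" by (rule basis3_cases)
    have "z * (Q * e (b l)) + z * (t * (\<Sum>u<l. e (b u))) = z * (Q * e (b 0))"
      by (simp only: s[OF x(2), symmetric] distrib_left sum_distrib_left)
    note c = this
    show "(ev12 e ** leg12 (mixed z)) *v axis x 1 = (\<chi> i y. z * Q * e (b 0) * ev12 (\<lambda>_. 1) $ i $ y) *v axis x 1"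
      using x(1-3) unfolding x(4) scale matrix_vector_mul_assoc[symmetric] leg_axis
      by (simp add: mixed_column emb_linear mult_vec_linear ev_axis b_eq_iff vector_smult_assoc pull
          vec.scale_left_distrib[symmetric] sum_distrib_left[symmetric] mult.assoc c del: vector_sadd_rdistrib)
  qed
  show "ev23 e ** leg23 (mixed z) = (\<chi> i y. z * Q * e (b 0) * ev23 (\<lambda>_. 1) $ i $ y)"
  proof (rule matrix_eq_columns)
    fix x
    obtain j l m where x: "j \<le> r" "l \<le> r" "m \<le> r" "x = (b j, b l, b m)" by (rule basis3_cases)
    have "z * (Q * e (b m)) + z * (t * (\<Sum>u<m. e (b u))) = z * (Q * e (b 0))"
      by (simp only: s[OF x(3), symmetric] distrib_left sum_distrib_left)
    note c = this
    show "(ev23 e ** leg23 (mixed z)) *v axis x 1 = (\<chi> i y. z * Q * e (b 0) * ev23 (\<lambda>_. 1) $ i $ y) *v axis x 1"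
      using x(1-3) unfolding x(4) scale matrix_vector_mul_assoc[symmetric] leg_axis
      by (simp add: mixed_column emb_linear mult_vec_linear ev_axis b_eq_iff vector_smult_assoc pull
          vec.scale_left_distrib[symmetric] sum_distrib_left[symmetric] mult.assoc c del: vector_sadd_rdistrib)
  qed
qed

text \<open>
  Naturality of the braiding with respect to the module map \<open>E'\<close>: the factor \<open>V\<close> may be moved past \<open>V \<otimes> V*\<close>
  before or after the contraction.
\<close>

lemma ev12_hecke_mixed:
  assumes "z \<noteq> 0"
  shows "ev23 e ** leg12 (hecke_inv z) ** leg23 (mixed z) = ev12 e"
proof (rule matrix_eq_columns)
  fix x
  obtain i j k where x: "i \<le> r" "j \<le> r" "k \<le> r" "x = (b i, b j, b k)" by (rule basis3_cases)
  have f: "ev23 e *v (leg12 (hecke_inv z) *v axis (b l, b m, b n) 1)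
      = (1 / z) *s ((if l = n then (if l = m then 1 / Q else 1) * e (b l) else 0) *s axis (b m) 1
         - (if l < m \<and> m = n then t * e (b m) else 0) *s axis (b l) 1)"
    if "l \<le> r" "m \<le> r" "n \<le> r" for l m n
    using that assms unfolding leg_axis
    by (auto simp: hecke_inv_column emb_linear mult_vec_linear vec.diff ev_axis b_eq_iff vec_eq_iff)
  have "ev23 e *v (leg12 (hecke_inv z) *v (leg23 (mixed z) *v axis x 1)) = ev12 e *v axis x 1"
  proof (cases "j = k")
    case False
    then show ?thesis
      using x(1-3) assms unfolding x(4) leg_axis(2)
      by (auto simp: mixed_column emb_linear mult_vec_linear f ev_axis b_eq_iff vector_smult_assoc)
  next
    case True
    have *: "ev23 e *v (leg12 (hecke_inv z) *v axis (b i, b u, b u) 1)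
       = (1 / z * (if u = i then e (b i) / Q else if i < u then - (t * e (b u)) else 0)) *s axis (b i) 1" if "u \<le> r" for u
      using x(1) that by (simp add: f)
    have pull: "(\<Sum>u<l. c u *s y) = (\<Sum>u<l. c u) *s y" for c and l :: nat and y :: "complex ^ 'i"
      by (simp add: vec_eq_iff sum_component sum_distrib_right)
    have "ev23 e *v (leg12 (hecke_inv z) *v (leg23 (mixed z) *v axis x 1))
      = (Q * (if k = i then e (b i) / Q else if i < k then - (t * e (b k)) else 0)
          + t * (\<Sum>u<k. if u = i then e (b i) / Q else if i < u then - (t * e (b u)) else 0)) *s axis (b i) 1"
      using x(1-3) assms unfolding x(4) leg_axis(2) True
      by (simp add: mixed_column emb_linear mult_vec_linear * vector_smult_assoc pull sum_distrib_left[symmetric] sum_divide_distrib[symmetric]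
          vec.scale_left_distrib[symmetric] del: vector_sadd_rdistrib)
    also have "\<dots> = ev12 e *v axis x 1"
      unfolding ev_partial_sum[OF x(3,1)] using x(1-3) True Q_nonzero by (auto simp: x(4) ev_axis b_eq_iff)
    finally show ?thesis .
  qed
  then show "(ev23 e ** leg12 (hecke_inv z) ** leg23 (mixed z)) *v axis x 1 = ev12 e *v axis x 1"
    by (simp only: matrix_vector_mul_assoc matrix_mul_assoc)
qed

text \<open>
  Naturality again, now moving \<open>V*\<close> past \<open>V \<otimes> V*\<close>.  The matrix \<open>D\<close> is the inverse braiding on \<open>V* \<otimes> V*\<close>, which is
  that of the reversed chain; this is why the inequality points in the other direction than in
  \<open>hecke_inv_column\<close>.
\<close>

lemma ev23_hecke_mixed:
  assumes "z \<noteq> 0" and D: "\<And>l m. l \<le> r \<Longrightarrow> m \<le> r \<Longrightarrow> D *v ee l m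
      = (1 / z) *s ((if l = m then 1 / Q else 1) *s ee m l - (if m < l then t *s ee l m else 0))"
  shows "ev12 e ** leg23 D ** leg12 (mixed z) = ev23 e"
proof (rule matrix_eq_columns)
  fix x
  obtain j k i where x: "j \<le> r" "k \<le> r" "i \<le> r" "x = (b j, b k, b i)" by (rule basis3_cases)
  have f: "ev12 e *v (leg23 D *v axis (b n, b m, b l) 1)
      = (1 / z) *s ((if l = n then (if l = m then 1 / Q else 1) * e (b l) else 0) *s axis (b m) 1
         - (if l < m \<and> m = n then t * e (b m) else 0) *s axis (b l) 1)"
    if "l \<le> r" "m \<le> r" "n \<le> r" for l m n
    using that assms(1) unfolding leg_axis
    by (auto simp: D emb_linear mult_vec_linear vec.diff ev_axis b_eq_iff vec_eq_iff)
  have "ev12 e *v (leg23 D *v (leg12 (mixed z) *v axis x 1)) = ev23 e *v axis x 1"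
  proof (cases "j = k")
    case False
    then show ?thesis
      using x(1-3) assms unfolding x(4) leg_axis(1)
      by (auto simp: mixed_column emb_linear mult_vec_linear f ev_axis b_eq_iff vector_smult_assoc)
  next
    case True
    have *: "ev12 e *v (leg23 D *v axis (b u, b u, b i) 1)
       = (1 / z * (if u = i then e (b i) / Q else if i < u then - (t * e (b u)) else 0)) *s axis (b i) 1" if "u \<le> r" for u
      using x(3) that by (simp add: f)
    have pull: "(\<Sum>u<l. c u *s y) = (\<Sum>u<l. c u) *s y" for c and l :: nat and y :: "complex ^ 'i"
      by (simp add: vec_eq_iff sum_component sum_distrib_right)
    have "ev12 e *v (leg23 D *v (leg12 (mixed z) *v axis x 1))
      = (Q * (if k = i then e (b i) / Q else if i < k then - (t * e (b k)) else 0)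
          + t * (\<Sum>u<k. if u = i then e (b i) / Q else if i < u then - (t * e (b u)) else 0)) *s axis (b i) 1"
      using x(1-3) assms unfolding x(4) leg_axis(1) True
      by (simp add: mixed_column emb_linear mult_vec_linear * vector_smult_assoc pull sum_distrib_left[symmetric] sum_divide_distrib[symmetric]
          vec.scale_left_distrib[symmetric] del: vector_sadd_rdistrib)
    also have "\<dots> = ev23 e *v axis x 1"
      unfolding ev_partial_sum[OF x(2,3)] using x(1-3) True Q_nonzero by (auto simp: x(4) ev_axis b_eq_iff)
    finally show ?thesis .
  qed
  then show "(ev12 e ** leg23 D ** leg12 (mixed z)) *v axis x 1 = ev23 e *v axis x 1"
    by (simp only: matrix_vector_mul_assoc matrix_mul_assoc)
qed

end

end

section \<open>The three-leg operators of a chain module\<close>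

definition scale_mat :: "complex \<Rightarrow> complex ^ 'k ^ 'l \<Rightarrow> complex ^ 'k ^ 'l" where
  "scale_mat c A = (\<chi> i j. c * A $ i $ j)"

lemma scale_mat_simps:
  fixes A :: "complex ^ 'k::finite ^ 'l::finite" and B :: "complex ^ 'm::finite ^ 'k"
  shows "scale_mat c A ** B = scale_mat c (A ** B)" "scale_mat c (scale_mat d A) = scale_mat (c * d) A"
    "scale_mat 1 A = A"
  by (simp_all add: scale_mat_def matrix_matrix_mult_def vec_eq_iff sum_distrib_left mult.assoc)

lemma leg_entries:
  "leg12 A $ (i, j, k) $ (i', j', k') = (if k = k' then A $ (i, j) $ (i', j') else 0)"
  "leg23 A $ (i, j, k) $ (i', j', k') = (if i = i' then A $ (j, k) $ (j', k') else 0)"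
  by (simp_all add: leg12_def leg23_def)

lemma sum_pair:
  "(\<Sum>y\<in>UNIV. f y) = (\<Sum>i\<in>UNIV. \<Sum>j\<in>UNIV. f (i :: 'n::finite, j :: 'n))"
  unfolding UNIV_Times_UNIV[symmetric]
  by (subst sum.cartesian_product') simp

lemma sum_if_const: "(\<Sum>j\<in>A. if c then f j else 0) = (if c then \<Sum>j\<in>A. f j else (0::complex))"
  by simp

lemma leg_mult:
  "leg12 A ** leg12 B = leg12 (A ** B)" "leg23 A ** leg23 B = leg23 (A ** B)"
proof -
  have z: "(if c then x else 0) * y = (if c then x * y else 0)" "y * (if c then x else 0) = (if c then y * x else 0)"
    for c and x y :: complex by auto
  have "(leg12 A ** leg12 B) $ (i, j, k) $ (i', j', k') = leg12 (A ** B) $ (i, j, k) $ (i', j', k')" for i j k i' j' k'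
    by (simp add: matrix_matrix_mult_def sum_triple sum_pair leg_entries z sum_if_const)
  then show "leg12 A ** leg12 B = leg12 (A ** B)" by (simp add: vec_eq_iff)
  have "(leg23 A ** leg23 B) $ (i, j, k) $ (i', j', k') = leg23 (A ** B) $ (i, j, k) $ (i', j', k')" for i j k i' j' k'
    by (simp add: matrix_matrix_mult_def sum_triple sum_pair leg_entries z sum_if_const)
  then show "leg23 A ** leg23 B = leg23 (A ** B)" by (simp add: vec_eq_iff)
qed

lemma leg_mat1: "leg12 (mat 1) = mat 1" "leg23 (mat 1) = mat 1"
  by (auto simp: leg12_def leg23_def mat_def vec_eq_iff)

text \<open>
  With both formulas, \<open>rotation\<close> is reduced to identities between entries of the two-leg matrices.
\<close>

lemma conj_entry:
  "(leg23 M ** leg12 N ** leg23 L) $ (j, p, c) $ (j', p', c')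
     = (\<Sum>x\<in>UNIV. \<Sum>y\<in>UNIV. M $ (p, c) $ (x, y) * (\<Sum>u\<in>UNIV. N $ (j, x) $ (j', u) * L $ (u, y) $ (p', c')))"
  "(leg12 M ** leg23 K ** leg12 L) $ (p, c, c') $ (j, j', p')
     = (\<Sum>x\<in>UNIV. \<Sum>y\<in>UNIV. M $ (p, c) $ (x, y) * (\<Sum>h\<in>UNIV. K $ (y, c') $ (h, p') * L $ (x, h) $ (j, j')))"
proof -
  have z: "(if c then x else 0) * y = (if c then x * y else 0)" "y * (if c then x else 0) = (if c then y * x else 0)"
    for c and x y :: complex by auto
  have 1: "(leg12 N ** leg23 L) $ (j, x, y) $ (j', p', c') = (\<Sum>u\<in>UNIV. N $ (j, x) $ (j', u) * L $ (u, y) $ (p', c'))" for x y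
    by (simp add: matrix_matrix_mult_def sum_triple leg_entries z sum_if_const)
  show "(leg23 M ** leg12 N ** leg23 L) $ (j, p, c) $ (j', p', c')
     = (\<Sum>x\<in>UNIV. \<Sum>y\<in>UNIV. M $ (p, c) $ (x, y) * (\<Sum>u\<in>UNIV. N $ (j, x) $ (j', u) * L $ (u, y) $ (p', c')))"
    unfolding matrix_mul_assoc[symmetric] unfolding matrix_matrix_mult_def[of "leg23 M"]
    by (simp add: 1 sum_triple leg_entries z sum_if_const)
  have 2: "(leg23 K ** leg12 L) $ (x, y, c') $ (j, j', p') = (\<Sum>h\<in>UNIV. K $ (y, c') $ (h, p') * L $ (x, h) $ (j, j'))" for x y
    by (simp add: matrix_matrix_mult_def sum_triple leg_entries z sum_if_const)
  show "(leg12 M ** leg23 K ** leg12 L) $ (p, c, c') $ (j, j', p')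
     = (\<Sum>x\<in>UNIV. \<Sum>y\<in>UNIV. M $ (p, c) $ (x, y) * (\<Sum>h\<in>UNIV. K $ (y, c') $ (h, p') * L $ (x, h) $ (j, j')))"
    unfolding matrix_mul_assoc[symmetric] unfolding matrix_matrix_mult_def[of "leg12 M"]
    by (simp add: 2 sum_triple leg_entries z sum_if_const)
qed

text \<open>
  Hecke relations are inherited by conjugates.
\<close>

lemma shift_conjugate:
  fixes M L A B :: "complex ^ 'k::finite ^ 'k"
  assumes inv: "M ** L = mat 1" and AB: "\<And>x y. A $ x $ y = c * B $ x $ y - (if x = y then d else 0)"
  shows "(M ** A ** L) $ x $ y = c * (M ** B ** L) $ x $ y - (if x = y then d else 0)"
proof -
  have A: "A *v v = c *s (B *v v) - d *s v" for v
    by (simp add: matrix_vector_mult_def vec_eq_iff AB left_diff_distrib sum_subtractf sum_distrib_left mult.assoc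
        if_distrib[of "\<lambda>x. x * _"] cong: if_cong)
  have "(M ** A ** L) *v v = c *s ((M ** B ** L) *v v) - d *s ((M ** L) *v v)" for v
    by (simp only: matrix_vector_mul_assoc[symmetric] A vec.diff vec.scale)
  then show ?thesis
    by (simp add: entry_column inv) (simp add: axis_def)
qed

lemma leg_shift:
  assumes "\<And>x y. A $ x $ y = c * B $ x $ y - (if x = y then d else 0)"
  shows "leg12 A $ x $ y = c * leg12 B $ x $ y - (if x = y then d else 0)"
    "leg23 A $ x $ y = c * leg23 B $ x $ y - (if x = y then d else 0)"
  by (cases x; cases y; simp add: leg_entries assms)+

text \<open>
  An operator on the middle legs 2, 3 may be read as acting on legs 1, 2, 3 or on legs 2, 3, 4.
\<close>

lemma act_leg_middle: "act123 (left_mult sc) (leg23 A) X = act234 (left_mult sc) (leg12 A) X"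
  if "ring_map sc" for sc :: "complex \<Rightarrow> 'm::ring_1" and X :: "('n::finite, 'm) fam4"
proof -
  have d: "sc (if c then x else 0) * y = (if c then sc x * y else 0)" for c x y
    by (simp add: ring_map_simps[OF that])
  have s: "(\<Sum>j\<in>J. if c then f j else 0) = (if c then \<Sum>j\<in>J. f j else 0)" for c and f :: "'n \<Rightarrow> 'm" and J
    by simp
  show ?thesis
    by (simp add: act123_def act234_def sum_triple leg_entries fun_eq_iff d s)
qed

lemma act_outer_commute:
  "act123 (left_mult sc) (leg12 A) (act234 (left_mult sc) (leg23 B) X)
     = act234 (left_mult sc) (leg23 B) (act123 (left_mult sc) (leg12 A) X)"
  if "ring_map sc" for sc :: "complex \<Rightarrow> 'm::ring_1" and X :: "('n::finite, 'm) fam4"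
proof -
  have d: "sc (if c then x else 0) * y = (if c then sc x * y else 0)" for c x y
    by (simp add: ring_map_simps[OF that])
  have s: "(\<Sum>j\<in>J. if c then f j else 0) = (if c then \<Sum>j\<in>J. f j else 0)" for c and f :: "'n \<Rightarrow> 'm" and J
    by simp
  have a: "act123 (left_mult sc) (leg12 A) Y i j k l = (\<Sum>x\<in>UNIV. sc (A $ (i, j) $ x) * Y (fst x) (snd x) k l)" for Y i j k l
    by (simp add: act123_def sum_triple sum_pair leg_entries d s)
  have b: "act234 (left_mult sc) (leg23 B) Y i j k l = (\<Sum>x\<in>UNIV. sc (B $ (k, l) $ x) * Y i j (fst x) (snd x))" for Y i j k l
    by (simp add: act234_def sum_triple sum_pair leg_entries d s)
  have c: "sc x * (sc y * w) = sc y * (sc x * w)" for x y w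
    by (metis ring_map_simps(2)[OF that] mult.assoc mult.commute)
  show ?thesis
    unfolding fun_eq_iff a b sum_distrib_left
    by (intro allI, subst sum.swap) (simp add: c)
qed

text \<open>
  Both operators are conjugated by the same operator on legs 2, 3; without it they act on the disjoint
  pairs of legs 1, 2 and 3, 4.
\<close>

lemma act_conjugate_commute:
  fixes sc :: "complex \<Rightarrow> 'm::ring_1" and X :: "('n::finite, 'm) fam4"
  assumes sc: "ring_map sc" and inv: "L ** M = mat 1"
  shows "act123 (left_mult sc) (leg23 M ** leg12 A ** leg23 L) (act234 (left_mult sc) (leg12 M ** leg23 B ** leg12 L) X)
     = act234 (left_mult sc) (leg12 M ** leg23 B ** leg12 L) (act123 (left_mult sc) (leg23 M ** leg12 A ** leg23 L) X)"
proof -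
  let ?a = "\<lambda>C Y :: ('n, 'm) fam4. act123 (left_mult sc) C Y"
  let ?b = "\<lambda>C Y :: ('n, 'm) fam4. act234 (left_mult sc) C Y"
  let ?S = "?a (leg23 M ** leg12 A ** leg23 L)" and ?St = "?b (leg12 M ** leg23 B ** leg12 L)"
  have LM: "?b (leg12 L) (?b (leg12 M) Y) = Y" for Y :: "('n, 'm) fam4"
    by (simp add: act234_comp[OF sc] leg_mult inv leg_mat1 act_mat1[OF sc])
  have S: "?S Y = ?b (leg12 M) (?a (leg12 A) (?b (leg12 L) Y))" for Y
    by (simp add: act123_comp[OF sc, symmetric] act_leg_middle[OF sc])
  have St: "?St Y = ?b (leg12 M) (?b (leg23 B) (?b (leg12 L) Y))" for Y
    by (simp add: act234_comp[OF sc, symmetric])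
  show ?thesis
    unfolding S St LM act_outer_commute[OF sc] by (rule refl)
qed

context chain_module
begin

lemma ev12_mult_entry: "(ev12 e ** A) $ l $ y = (\<Sum>j\<in>UNIV. e j * A $ (j, j, l) $ y)"
proof -
  have z: "(if c then x else 0) * y = (if c then x * y else 0)" for c and x y :: complex by auto
  have z2: "(if c \<and> d then x else (0::complex)) = (if d then if c then x else 0 else 0)" for c d x by auto
  show ?thesis
    by (simp add: matrix_matrix_mult_def ev12_def sum_triple z z2 sum_if_const)
qed

text \<open>
  The recursion for the weights \<open>e\<close> is that of \<open>q\<close> to the power \<open>(\<lambda>\<^sub>i, 2\<rho>)\<close> along the chain.
\<close>

theorem hk_matrices_chain:
  fixes e :: "'i \<Rightarrow> complex"
  assumes e_step: "\<And>l. l < r \<Longrightarrow> Q * e (b (Suc l)) = e (b l) / Q" and e0: "e (b 0) \<noteq> 0" and z: "z \<noteq> 0"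
  defines "K \<equiv> chain_module.hecke r Q (\<lambda>l. b (r - l)) z" and "M \<equiv> matrix_inv (mixed z)"
  shows "hk_matrices (leg23 M ** leg12 (hecke z) ** leg23 (matrix_inv M))
     (leg12 M ** leg23 (matrix_inv K) ** leg12 (matrix_inv M)) e (z * Q) (Q\<^sup>2) (e (b 0))"
proof -
  interpret D: chain_module r Q "uq_dual X" "\<lambda>k. \<nu> (r - 1 - k)" "\<lambda>l. b (r - l)" "\<lambda>k. - (\<phi> (r - 1 - k) / Q)"
    by (rule chain_module_dual)
  let ?G = "mixed z" and ?A = "hecke z" and ?Ai = "hecke_inv z" and ?Ki = "D.hecke_inv z"
  let ?S = "leg23 M ** leg12 ?A ** leg23 ?G" and ?St = "leg12 M ** leg23 ?Ki ** leg12 ?G"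
  let ?Si = "leg23 M ** leg12 ?Ai ** leg23 ?G" and ?Sti = "leg12 M ** leg23 K ** leg12 ?G"
  have GM: "?G ** M = mat 1" and MG: "M ** ?G = mat 1"
    using mixed_invertible[OF z] by (simp_all add: M_def)
  have Minv: "matrix_inv M = ?G" by (rule matrix_inv_eqI[OF MG GM])
  have KK: "K ** ?Ki = mat 1" "?Ki ** K = mat 1" using D.hecke_inverse[OF z] by (simp_all add: K_def)
  have Kinv: "matrix_inv K = ?Ki" by (rule matrix_inv_eqI[OF KK])
  have conj: "(A1 ** B1 ** C1) ** (A2 ** B2 ** C2) = mat 1"
    if "C1 ** A2 = mat 1" "B1 ** B2 = mat 1" "A1 ** C2 = mat 1"
    for A1 B1 C1 A2 B2 C2 :: "complex ^ ('i \<times> 'i \<times> 'i) ^ ('i \<times> 'i \<times> 'i)"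
  proof -
    have "(A1 ** B1 ** C1) ** (A2 ** B2 ** C2) = A1 ** (B1 ** ((C1 ** A2) ** B2)) ** C2"
      by (simp only: matrix_mul_assoc)
    then show ?thesis by (simp add: that)
  qed
  have SS: "?S ** ?Si = mat 1" "?Si ** ?S = mat 1" "?St ** ?Sti = mat 1" "?Sti ** ?St = mat 1"
    by (rule conj; simp add: leg_mult GM MG hecke_inverse[OF z] KK leg_mat1)+
  have Sinv: "matrix_inv ?S = ?Si" by (rule matrix_inv_eqI[OF SS(1,2)])
  have Stinv: "matrix_inv ?St = ?Sti" by (rule matrix_inv_eqI[OF SS(3,4)])
  have c: "1 / z\<^sup>2 = Q\<^sup>2 / (z * Q)\<^sup>2" "t / z = (Q\<^sup>2 - 1) / (z * Q)"
    using z Q_nonzero by (auto simp: t_def power2_eq_square field_simps)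
  have Ai: "?Ai $ x $ y = Q\<^sup>2 / (z * Q)\<^sup>2 * ?A $ x $ y - (if x = y then (Q\<^sup>2 - 1) / (z * Q) else 0)" for x y
    unfolding hecke_inv_def c[symmetric] by simp
  have Ki: "?Ki $ x $ y = Q\<^sup>2 / (z * Q)\<^sup>2 * K $ x $ y - (if x = y then (Q\<^sup>2 - 1) / (z * Q) else 0)" for x y
    unfolding D.hecke_inv_def K_def c[symmetric] by simp
  have inv_leg: "leg23 M ** leg23 ?G = mat 1" "leg12 M ** leg12 ?G = mat 1"
    by (simp_all add: leg_mult MG leg_mat1)
  \<comment> \<open>Naturality of the evaluation with respect to \<open>V*\<close>: the same partial transpose of the braiding
    on \<open>V* \<otimes> V*\<close> gives \<open>mixed z\<close> again.\<close>
  have rot: "hecke z $ (p', h) $ (c', y) = K $ (y, c') $ (h, p')" for p' h c' y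
  proof -
    obtain i where i: "i \<le> r" "p' = b i" by (rule b_cases)
    obtain j where j: "j \<le> r" "h = b j" by (rule b_cases)
    obtain k where k: "k \<le> r" "c' = b k" by (rule b_cases)
    obtain l where l: "l \<le> r" "y = b l" by (rule b_cases)
    have D_pos: "D.pos (b n) = r - n" if "n \<le> r" for n
      using D.pos_b[of "r - n"] that by simp
    have "hecke z $ (b i, b j) $ (b k, b l) = K $ (b l, b k) $ (b j, b i)"
      using i(1) j(1) k(1) l(1) unfolding K_def hecke_def D.hecke_def
      by (cases "i = l"; cases "j = k"; cases "i = k"; cases "j = l"; simp add: b_eq_iff D_pos; auto)
    then show ?thesis by (simp only: i(2) j(2) k(2) l(2))
  qed
  have scale: "scale_mat (z * Q * e (b 0)) (ev12 (\<lambda>_. 1)) = ev12 e ** leg12 ?G"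
    "scale_mat (z * Q * e (b 0)) (ev23 (\<lambda>_. 1)) = ev23 e ** leg23 ?G"
    using ev12_mixed[of e, OF e_step z] by (simp_all add: scale_mat_def)
  have tr_S: "ev12 e ** ?S = scale_mat (z * Q * e (b 0)) (ev23 (\<lambda>_. 1))"
  proof -
    have "ev12 e ** ?S = ev23 e ** leg12 ?Ai ** (leg23 ?G ** leg23 M) ** leg12 ?A ** leg23 ?G"
      using ev12_hecke_mixed[of e, OF e_step z] by (simp add: matrix_mul_assoc)
    also have "\<dots> = ev23 e ** (leg12 ?Ai ** leg12 ?A) ** leg23 ?G"
      by (simp add: leg_mult GM leg_mat1 matrix_mul_assoc[symmetric])
    also have "\<dots> = scale_mat (z * Q * e (b 0)) (ev23 (\<lambda>_. 1))"
      by (simp add: leg_mult hecke_inverse[OF z] leg_mat1 scale)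
    finally show ?thesis .
  qed
  have tr_St: "ev12 (\<lambda>_. 1) ** ?St = scale_mat (1 / (z * Q * e (b 0))) (ev23 e)"
  proof -
    have Kcol: "?Ki *v ee l m = (1 / z) *s ((if l = m then 1 / Q else 1) *s ee m l - (if m < l then t *s ee l m else 0))"
      if "l \<le> r" "m \<le> r" for l m
      using D.hecke_inv_column[of "r - l" "r - m" z] that z by auto
    have "ev12 (\<lambda>_. 1) ** leg12 M = scale_mat (1 / (z * Q * e (b 0))) (ev12 e ** (leg12 ?G ** leg12 M))"
      using z Q_nonzero e0 by (simp add: matrix_mul_assoc scale(1)[symmetric] scale_mat_simps)
    also have "\<dots> = scale_mat (1 / (z * Q * e (b 0))) (ev12 e)"
      by (simp add: leg_mult GM leg_mat1)
    finally have "ev12 (\<lambda>_. 1) ** ?St = scale_mat (1 / (z * Q * e (b 0))) (ev12 e ** leg23 ?Ki ** leg12 ?G)"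
      by (simp add: matrix_mul_assoc scale_mat_simps)
    then show ?thesis by (simp add: ev23_hecke_mixed[of e, OF e_step z Kcol])
  qed
  show ?thesis
    unfolding Minv Kinv
  proof
    show "z * Q \<noteq> 0" "Q\<^sup>2 \<noteq> 0" "e (b 0) \<noteq> 0" using z Q_nonzero e0 by auto
    show "?S ** matrix_inv ?S = mat 1" "matrix_inv ?S ** ?S = mat 1"
      "?St ** matrix_inv ?St = mat 1" "matrix_inv ?St ** ?St = mat 1"
      unfolding Sinv Stinv by (fact SS)+
    show "matrix_inv ?S $ x $ y = Q\<^sup>2 / (z * Q)\<^sup>2 * ?S $ x $ y - (if x = y then (Q\<^sup>2 - 1) / (z * Q) else 0)" for x y
      unfolding Sinv by (rule shift_conjugate[OF inv_leg(1) leg_shift(1)[OF Ai]])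
    show "?St $ x $ y = Q\<^sup>2 / (z * Q)\<^sup>2 * matrix_inv ?St $ x $ y - (if x = y then (Q\<^sup>2 - 1) / (z * Q) else 0)" for x y
      unfolding Stinv by (rule shift_conjugate[OF inv_leg(2) leg_shift(2)[OF Ki]])
    show "?S $ (j, p, c) $ (j', p', c') = matrix_inv ?St $ (p, c, c') $ (j, j', p')" for j p c j' p' c'
      unfolding Stinv conj_entry by (simp add: mixed_def rot mult.commute)
    show "(\<Sum>k\<in>UNIV. e k * ?S $ (k, k, i) $ (i', j', k')) = (if j' = k' \<and> i = i' then z * Q * e (b 0) else 0)" for i i' j' k'
      unfolding ev12_mult_entry[symmetric] tr_S by (auto simp: scale_mat_def ev23_def)
    show "(\<Sum>j\<in>UNIV. ?St $ (j, j, l) $ (j', k', l')) = (if k' = l' \<and> l = j' then e k' / (z * Q * e (b 0)) else 0)" for l j' k' l'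
      using ev12_mult_entry[of "\<lambda>_. 1" ?St l "(j', k', l')"] unfolding tr_St by (auto simp: scale_mat_def ev23_def)
  qed
qed

end

context qps_data
begin

section \<open>The module V is a chain module\<close>

text \<open>
  The nodes in the order in which the \<open>F\<close>s act on the highest weight vector.
\<close>

definition node :: "nat \<Rightarrow> nat" where "node k = (if s = 1 then Suc k else r - k)"

lemma node_mem: "k < r \<Longrightarrow> node k \<in> {1..r}"
  unfolding node_def by auto

lemma nodes_bij: "bij_betw node {..<r} {1..r}"
proof (rule bij_betw_byWitness[where f' = "\<lambda>i. if s = 1 then i - 1 else r - i"])
  show "\<forall>k\<in>{..<r}. (if s = 1 then node k - 1 else r - node k) = k" unfolding node_def by auto
  show "\<forall>i\<in>{1..r}. node (if s = 1 then i - 1 else r - i) = i" unfolding node_def by auto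
  show "node ` {..<r} \<subseteq> {1..r}" using node_mem by blast
  show "(\<lambda>i. if s = 1 then i - 1 else r - i) ` {1..r} \<subseteq> {..<r}" by auto
qed

lemma wt_nodes:
  assumes "j < r" "k < r"
  shows "wt_form r (simple_root (node j)) (simple_root (node k))
    = (if j = k then 2 else if j = Suc k \<or> k = Suc j then -1 else 0)"
  unfolding wt_form_simple_root[OF node_mem[OF assms(1)]] unfolding node_def simple_root_def using assms by auto

lemma s_node: "s = node 0"
  using s_cases unfolding node_def by auto

lemma s_mem: "s \<in> {1..r}" using s_cases r_ge_1 by auto

text \<open>
  On the \<open>k\<close>-th vector of the chain of \<open>V\<close> the element \<open>K\<close> of the \<open>j\<close>-th node has the eigenvalue
  \<open>q powr chain_exp j k\<close>.
\<close>

definition chain_exp :: "nat \<Rightarrow> nat \<Rightarrow> real" where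
  "chain_exp j k = (if k = j then 1 else if k = Suc j then -1 else 0)"

lemma chain_exp_inj:
  assumes "k \<le> r" "l \<le> r" "\<And>j. j < r \<Longrightarrow> chain_exp j k = chain_exp j l"
  shows "k = l"
proof (rule ccontr)
  assume "k \<noteq> l"
  then consider "k < l" | "l < k" by linarith
  then show False
    using assms(3)[of k] assms(3)[of l] assms(1,2) by cases (auto simp: chain_exp_def split: if_splits)
qed

lemma wt_hw: "j < r \<Longrightarrow> wt_form r (simple_root (node j)) (fund_weight r s) = chain_exp j 0"
  using wt_form_simple_root_fund_weight[OF node_mem, of j s] nodes_bij s_node
  by (auto simp: chain_exp_def bij_betw_def inj_on_def)

definition Q :: complex where "Q = complex_of_real q"

lemma Q_powr: "complex_of_real (q powr chain_exp j k) = (if k = j then Q else if k = Suc j then 1 / Q else 1)"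
  using q_pos by (auto simp: chain_exp_def Q_def powr_minus field_simps)

lemma scaleR_mult_vec: "(c *\<^sub>R A) *v x = complex_of_real c *s (A *v x)" for A :: "complex ^ 'n ^ 'n"
  by (simp add: matrix_vector_mult_def vec_eq_iff sum_distrib_left scaleR_conv_of_real[of c "_ :: complex"] mult.assoc)

lemma V_module: "uq_module r q V"
  using V_simple by (simp add: is_simple_hw_module_def simple_uq_module_def)

lemma V_relations:
  assumes "j < r" "k < r"
  shows "uK V (node j) *v (uKinv V (node j) *v x) = x" "uKinv V (node j) *v (uK V (node j) *v x) = x"
    "uK V (node j) *v (uF V (node k) *v x)
       = complex_of_real (q powr (- wt_form r (simple_root (node j)) (simple_root (node k)))) *s (uF V (node k) *v (uK V (node j) *v x))"
    "uK V (node j) *v (uE V (node k) *v x)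
       = complex_of_real (q powr (wt_form r (simple_root (node j)) (simple_root (node k)))) *s (uE V (node k) *v (uK V (node j) *v x))"
    "uE V (node j) *v (uF V (node k) *v x) = uF V (node k) *v (uE V (node j) *v x)
       + (if j = k then (1 / (Q - 1 / Q)) *s (uK V (node j) *v x - uKinv V (node j) *v x) else 0)"
proof -
  have mem: "node j \<in> {1..r}" "node k \<in> {1..r}" using assms by (blast intro: node_mem)+
  have eq: "node j = node k \<longleftrightarrow> j = k" using nodes_bij assms by (auto simp: bij_betw_def inj_on_def)
  note rel = V_module[unfolded uq_module_def, rule_format, OF mem(1)]
  have rel2: "uK V (node j) ** uE V (node k) ** uKinv V (node j)
          = q powr wt_form r (simple_root (node j)) (simple_root (node k)) *\<^sub>R uE V (node k)"
    "uK V (node j) ** uF V (node k) ** uKinv V (node j)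
          = q powr (- wt_form r (simple_root (node j)) (simple_root (node k))) *\<^sub>R uF V (node k)"
    "uE V (node j) ** uF V (node k) - uF V (node k) ** uE V (node j)
          = (if node j = node k then (1 / (q - 1 / q)) *\<^sub>R (uK V (node j) - uKinv V (node j)) else 0)"
    using rel mem(2) by blast+
  have inv: "uK V (node j) ** uKinv V (node j) = mat 1" "uKinv V (node j) ** uK V (node j) = mat 1"
    using rel by blast+
  show 1: "uK V (node j) *v (uKinv V (node j) *v x) = x" "uKinv V (node j) *v (uK V (node j) *v x) = x" for x
    by (simp_all add: matrix_vector_mul_assoc inv)
  have "(uK V (node j) ** uF V (node k) ** uKinv V (node j)) *v (uK V (node j) *v x) = uK V (node j) *v (uF V (node k) *v x)"
    "(uK V (node j) ** uE V (node k) ** uKinv V (node j)) *v (uK V (node j) *v x) = uK V (node j) *v (uE V (node k) *v x)"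
    by (simp_all only: matrix_vector_mul_assoc[symmetric] 1)
  then show "uK V (node j) *v (uF V (node k) *v x)
       = complex_of_real (q powr (- wt_form r (simple_root (node j)) (simple_root (node k)))) *s (uF V (node k) *v (uK V (node j) *v x))"
    "uK V (node j) *v (uE V (node k) *v x)
       = complex_of_real (q powr (wt_form r (simple_root (node j)) (simple_root (node k)))) *s (uE V (node k) *v (uK V (node j) *v x))"
    by (simp_all only: rel2 scaleR_mult_vec)
  have "uE V (node j) *v (uF V (node k) *v x) - uF V (node k) *v (uE V (node j) *v x)
      = (uE V (node j) ** uF V (node k) - uF V (node k) ** uE V (node j)) *v x"
    by (simp only: matrix_vector_mult_diff_rdistrib matrix_vector_mul_assoc)
  also have "\<dots> = (if j = k then (1 / (Q - 1 / Q)) *s (uK V (node j) *v x - uKinv V (node j) *v x) else 0)"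
    by (simp add: rel2(3) eq scaleR_mult_vec matrix_vector_mult_diff_rdistrib Q_def)
  finally show "uE V (node j) *v (uF V (node k) *v x) = uF V (node k) *v (uE V (node j) *v x)
       + (if j = k then (1 / (Q - 1 / Q)) *s (uK V (node j) *v x - uKinv V (node j) *v x) else 0)"
    by (simp only: diff_eq_eq add.commute)
qed

definition hw_vec :: "complex ^ 'n" where "hw_vec = (SOME v. highest_weight_vector r q V (fund_weight r s) v)"

lemma hw_vec: "highest_weight_vector r q V (fund_weight r s) hw_vec"
  unfolding hw_vec_def using V_simple by (auto simp: is_simple_hw_module_def intro: someI_ex)

text \<open>
  The vectors that will turn out to be multiples of the basis vectors.
\<close>

primrec chain_vec :: "nat \<Rightarrow> complex ^ 'n" where
  "chain_vec 0 = hw_vec"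
| "chain_vec (Suc k) = uF V (node k) *v chain_vec k"

lemma Q_facts: "Q \<noteq> 0" "Q - 1 / Q \<noteq> 0"
proof -
  show "Q \<noteq> 0" using q_pos by (simp add: Q_def)
  have "q * q < 1" using q_pos q_less_1 mult_strict_mono[of q 1 q 1] by simp
  then have "q - 1 / q \<noteq> 0" using q_pos by (simp add: field_simps)
  then show "Q - 1 / Q \<noteq> 0" unfolding Q_def by (metis of_real_1 of_real_diff of_real_divide of_real_eq_0_iff)
qed

text \<open>
  \<open>E\<close> undoes the last \<open>F\<close>: by induction \<open>E\<close> of the next node still annihilates the vector, and its
  commutator with \<open>F\<close> is \<open>(Q - 1 / Q) / (Q - 1 / Q) = 1\<close> on it.  In particular the chain does not
  break off before its end.
\<close>

lemma chain_vec_props: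
  assumes "k \<le> r"
  shows "(\<forall>j<r. uK V (node j) *v chain_vec k = complex_of_real (q powr chain_exp j k) *s chain_vec k)
    \<and> (\<forall>j<r. k \<le> j \<longrightarrow> uE V (node j) *v chain_vec k = 0) \<and> chain_vec k \<noteq> 0
    \<and> (k \<noteq> 0 \<longrightarrow> uE V (node (k - 1)) *v chain_vec k = chain_vec (k - 1))"
  using assms
proof (induction k)
  case 0
  show ?case
    using hw_vec node_mem wt_hw by (auto simp: highest_weight_vector_def weight_vector_def)
next
  case (Suc k)
  then have k: "k < r" by simp
  note IH = Suc.IH[OF less_imp_le[OF k]]
  have K: "uK V (node j) *v chain_vec (Suc k) = complex_of_real (q powr chain_exp j (Suc k)) *s chain_vec (Suc k)" if j: "j < r" for j
  proof -
    have "chain_exp j (Suc k) = - wt_form r (simple_root (node j)) (simple_root (node k)) + chain_exp j k"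
      unfolding wt_nodes[OF j k] by (auto simp: chain_exp_def)
    then have "complex_of_real (q powr chain_exp j (Suc k))
        = complex_of_real (q powr - wt_form r (simple_root (node j)) (simple_root (node k))) * complex_of_real (q powr chain_exp j k)"
      by (simp only: powr_add of_real_mult)
    then show ?thesis
      using IH j by (simp add: V_relations(3)[OF j k] mult_vec_linear)
  qed
  have E0: "uE V (node j) *v chain_vec (Suc k) = 0" if j: "j < r" "Suc k \<le> j" for j
    using IH j by (simp add: V_relations(5)[OF j(1) k] mult_vec_linear)
  have Kk: "uK V (node k) *v chain_vec k = Q *s chain_vec k" using IH k by (simp add: Q_powr)
  have "uKinv V (node k) *v (Q *s chain_vec k) = chain_vec k" using V_relations(2)[OF k k, of "chain_vec k"] Kk by simp
  then have Kinv: "uKinv V (node k) *v chain_vec k = (1 / Q) *s chain_vec k"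
    using Q_facts by (metis mult_vec_linear(1) nonzero_divide_eq_eq vector_smult_assoc vector_smult_lid)
  have "uE V (node k) *v chain_vec (Suc k) = (1 / (Q - 1 / Q)) *s (Q *s chain_vec k - (1 / Q) *s chain_vec k)"
    using IH k by (simp add: V_relations(5)[OF k k] Kk Kinv mult_vec_linear)
  also have "\<dots> = chain_vec k"
    by (simp only: vec.scale_left_diff_distrib[symmetric] vector_smult_assoc
        times_divide_eq_left mult_1 divide_self[OF Q_facts(2)] vector_smult_lid)
  finally have E: "uE V (node k) *v chain_vec (Suc k) = chain_vec k" .
  have "chain_vec (Suc k) \<noteq> 0"
  proof
    assume "chain_vec (Suc k) = 0"
    then have "chain_vec k = 0" using E by (simp add: mult_vec_linear)
    then show False using IH by simp
  qed
  then show ?case using K E0 E by simp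
qed

definition node_exp :: "nat \<Rightarrow> 'n \<Rightarrow> real" where "node_exp j i = wt_form r (simple_root (node j)) (lam i)"

lemma K_axis: "j < r \<Longrightarrow> uK V (node j) *v axis i 1 = complex_of_real (q powr node_exp j i) *s axis i 1"
  using basis_weight[of i] node_mem by (simp add: weight_vector_def node_exp_def)

lemma K_component: "j < r \<Longrightarrow> (uK V (node j) *v x) $ i = complex_of_real (q powr node_exp j i) * x $ i"
proof -
  assume j: "j < r"
  have "(uK V (node j) *v x) $ i = (\<Sum>l\<in>UNIV. uK V (node j) $ i $ l * x $ l)"
    by (simp add: matrix_vector_mult_def)
  also have "\<dots> = (\<Sum>l\<in>UNIV. if l = i then complex_of_real (q powr node_exp j i) * x $ i else 0)"
    by (intro sum.cong refl) (simp add: entry_column K_axis[OF j]; auto simp: axis_def)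
  finally show ?thesis by simp
qed

lemma eigen_support:
  assumes "j < r" "uK V (node j) *v x = complex_of_real (q powr y) *s x" "x $ i \<noteq> 0"
  shows "node_exp j i = y"
proof -
  have "complex_of_real (q powr node_exp j i) * x $ i = complex_of_real (q powr y) * x $ i"
    unfolding K_component[OF assms(1), symmetric] assms(2) by (rule vector_smult_component)
  then have "q powr node_exp j i = q powr y" using assms(3) by (metis mult_right_cancel of_real_eq_iff)
  then show ?thesis using powr_inj[of q] q_pos q_less_1 by simp
qed

definition chain_index :: "nat \<Rightarrow> 'n" where "chain_index k = (SOME i. chain_vec k $ i \<noteq> 0)"

lemma chain_vec_K:
  assumes "k \<le> r" "j < r"
  shows "uK V (node j) *v chain_vec k = complex_of_real (q powr chain_exp j k) *s chain_vec k"
  using chain_vec_props[OF assms(1)] assms(2) by blast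

lemma chain_vec_E:
  assumes "k < r"
  shows "uE V (node k) *v chain_vec (Suc k) = chain_vec k"
  using chain_vec_props[of "Suc k"] assms by (metis Suc_leI diff_Suc_1 nat.simps(3))

lemma chain_vec_index:
  assumes "k \<le> r"
  shows "chain_vec k $ chain_index k \<noteq> 0"
proof -
  have "chain_vec k \<noteq> 0" using chain_vec_props[OF assms] by blast
  then have "\<exists>i. chain_vec k $ i \<noteq> 0" by (simp add: vec_eq_iff)
  then show ?thesis unfolding chain_index_def by (rule someI_ex)
qed

lemma node_exp_chain_index: "k \<le> r \<Longrightarrow> j < r \<Longrightarrow> node_exp j (chain_index k) = chain_exp j k"
  by (rule eigen_support[OF _ chain_vec_K chain_vec_index])

text \<open>
  Vectors of the chain have pairwise different weights and the basis consists of weight vectors, so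
  counting shows that each of the \<open>r + 1\<close> basis vectors is a multiple of exactly one vector of the chain.
\<close>

lemma chain_index_bij: "bij_betw chain_index {..r} UNIV"
proof -
  have "inj_on chain_index {..r}"
  proof (rule inj_onI)
    fix k l assume kl: "k \<in> {..r}" "l \<in> {..r}" "chain_index k = chain_index l"
    have "chain_exp j k = chain_exp j l" if "j < r" for j
      using node_exp_chain_index[of k j] node_exp_chain_index[of l j] kl that by simp
    then show "k = l" using chain_exp_inj[of k l] kl by simp
  qed
  moreover from this have "chain_index ` {..r} = UNIV"
    by (intro card_subset_eq finite subset_UNIV) (simp only: card_image card_index card_atMost)
  ultimately show ?thesis by (simp add: bij_betw_def)
qed

lemma chain_index_cases: obtains k where "k \<le> r" "i = chain_index k"
proof -
  have "i \<in> chain_index ` {..r}" using chain_index_bij by (simp add: bij_betw_def)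
  then show ?thesis using that by auto
qed

lemma chain_vec_axis: "k \<le> r \<Longrightarrow> chain_vec k = (chain_vec k $ chain_index k) *s axis (chain_index k) 1"
proof -
  assume k: "k \<le> r"
  have "chain_vec k $ i = 0" if "i \<noteq> chain_index k" for i
  proof (rule ccontr)
    assume nz: "chain_vec k $ i \<noteq> 0"
    obtain l where l: "l \<le> r" "i = chain_index l" by (rule chain_index_cases)
    \<comment> \<open>A nonzero component at another basis vector would make two weights of the chain equal.\<close>
    have "chain_exp j k = chain_exp j l" if j: "j < r" for j
    proof -
      have "node_exp j i = chain_exp j k" by (rule eigen_support[OF j chain_vec_K[OF k j] nz])
      then show ?thesis using node_exp_chain_index[OF l(1) j] l(2) by simp
    qed
    then show False using chain_exp_inj[OF k l(1)] l(2) \<open>i \<noteq> chain_index k\<close> by auto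
  qed
  then have "chain_vec k $ i = ((chain_vec k $ chain_index k) *s axis (chain_index k) 1) $ i" for i
    by (cases "i = chain_index k") (simp_all add: axis_def)
  then show ?thesis by (intro vec_eq_iff[THEN iffD2] allI)
qed

definition chain_coeff :: "nat \<Rightarrow> complex" where "chain_coeff k = chain_vec (Suc k) $ chain_index (Suc k) / chain_vec k $ chain_index k"

text \<open>
  All weights of \<open>V\<close> are known and simple, so an \<open>E\<close> or \<open>F\<close> either connects neighbours in the chain or
  leads to a weight that does not occur.
\<close>

lemma V_chain: "chain_module r Q V node chain_index chain_coeff"
proof (rule chain_module.intro)
  show "Q \<noteq> 0" by (rule Q_facts)
  show "bij_betw node {..<r} {1..r}" by (rule nodes_bij)
  show "bij_betw chain_index {..r} UNIV" by (rule chain_index_bij)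
  fix k assume k: "k < r"
  then have k': "k \<le> r" "Suc k \<le> r" by auto
  show "chain_coeff k \<noteq> 0" using chain_vec_index k' by (simp add: chain_coeff_def del: chain_vec.simps)
  fix l assume l: "l \<le> r"
  have K: "uK V (node k) *v axis (chain_index l) 1 = complex_of_real (q powr chain_exp k l) *s axis (chain_index l) 1"
    using K_axis[OF k] node_exp_chain_index[OF l k] by simp
  then show "uK V (node k) *v axis (chain_index l) 1 = (if l = k then Q else if l = Suc k then 1 / Q else 1) *s axis (chain_index l) 1"
    by (simp add: Q_powr)
  have "axis (chain_index l) 1 = complex_of_real (q powr chain_exp k l) *s (uKinv V (node k) *v axis (chain_index l) 1)"
    using V_relations(2)[OF k k, of "axis (chain_index l) 1"] K by (simp add: mult_vec_linear)
  then have "(1 / complex_of_real (q powr chain_exp k l)) *s axis (chain_index l) 1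
      = (1 / complex_of_real (q powr chain_exp k l)) *s (complex_of_real (q powr chain_exp k l) *s (uKinv V (node k) *v axis (chain_index l) 1))"
    by simp
  also have "\<dots> = uKinv V (node k) *v axis (chain_index l) 1"
    using q_pos by (simp add: vector_smult_assoc)
  finally show "uKinv V (node k) *v axis (chain_index l) 1 = (if l = k then 1 / Q else if l = Suc k then Q else 1) *s axis (chain_index l) 1"
    by (simp add: Q_powr split: if_splits)
  have wt: "wt_form r (simple_root (node k)) (simple_root (node k)) = 2" using wt_nodes[OF k k] by simp
  have ax: "axis (chain_index n) 1 = (1 / chain_vec n $ chain_index n) *s chain_vec n" if "n \<le> r" for n
    using chain_vec_axis[OF that] chain_vec_index[OF that] by (metis nonzero_divide_eq_eq vector_smult_assoc vector_smult_lid)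
  show "uF V (node k) *v axis (chain_index l) 1 = (if l = k then chain_coeff k *s axis (chain_index (Suc k)) 1 else 0)"
  proof (cases "l = k")
    case True
    have "uF V (node k) *v axis (chain_index k) 1 = (1 / chain_vec k $ chain_index k) *s chain_vec (Suc k)"
      by (subst ax[OF k'(1)]) (simp add: mult_vec_linear)
    also have "\<dots> = chain_coeff k *s axis (chain_index (Suc k)) 1"
      by (subst chain_vec_axis[OF k'(2)]) (simp add: chain_coeff_def vector_smult_assoc del: chain_vec.simps)
    finally show ?thesis using True by simp
  next
    case False
    \<comment> \<open>The image has a weight that does not occur in \<open>V\<close>.\<close>
    let ?y = "uF V (node k) *v axis (chain_index l) 1"
    have y: "uK V (node k) *v ?y = complex_of_real (q powr (chain_exp k l - 2)) *s ?y"
      using V_relations(3)[OF k k, of "axis (chain_index l) 1"] q_pos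
      by (simp add: wt K mult_vec_linear vector_smult_assoc powr_diff powr_minus field_simps)
    have "?y $ i = 0" for i
    proof (rule ccontr)
      assume nz: "?y $ i \<noteq> 0"
      obtain n where n: "n \<le> r" "i = chain_index n" by (rule chain_index_cases)
      have "chain_exp k n = chain_exp k l - 2"
        using eigen_support[OF k y nz] node_exp_chain_index[OF n(1) k] n(2) by simp
      then show False using False by (auto simp: chain_exp_def split: if_splits)
    qed
    then show ?thesis using False by (simp add: vec_eq_iff)
  qed
  show "uE V (node k) *v axis (chain_index l) 1 = (if l = Suc k then (1 / chain_coeff k) *s axis (chain_index k) 1 else 0)"
  proof (cases "l = Suc k")
    case True
    have "uE V (node k) *v axis (chain_index (Suc k)) 1 = (1 / chain_vec (Suc k) $ chain_index (Suc k)) *s chain_vec k"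
      by (subst ax[OF k'(2)]) (simp only: mult_vec_linear chain_vec_E[OF k])
    also have "\<dots> = (1 / chain_coeff k) *s axis (chain_index k) 1"
      by (subst chain_vec_axis[OF k'(1)]) (simp add: chain_coeff_def vector_smult_assoc del: chain_vec.simps)
    finally show ?thesis using True by simp
  next
    case False
    let ?y = "uE V (node k) *v axis (chain_index l) 1"
    have y: "uK V (node k) *v ?y = complex_of_real (q powr (chain_exp k l + 2)) *s ?y"
      using V_relations(4)[OF k k, of "axis (chain_index l) 1"] q_pos
      by (simp add: wt K mult_vec_linear vector_smult_assoc powr_add field_simps)
    have "?y $ i = 0" for i
    proof (rule ccontr)
      assume nz: "?y $ i \<noteq> 0"
      obtain n where n: "n \<le> r" "i = chain_index n" by (rule chain_index_cases)
      have "chain_exp k n = chain_exp k l + 2"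
        using eigen_support[OF k y nz] node_exp_chain_index[OF n(1) k] n(2) by simp
      then show False using False by (auto simp: chain_exp_def split: if_splits)
    qed
    then show ?thesis using False by (simp add: vec_eq_iff)
  qed
qed

end

context qps_data
begin

section \<open>Weights and the braidings of V\<close>

text \<open>
  The weights of the chain in coordinates.  For \<open>s = r\<close> they are the negatives of those of the first
  fundamental module, in reverse order.
\<close>

definition std_weight :: "nat \<Rightarrow> nat \<Rightarrow> real" where
  "std_weight k n = (if s = 1 then (if n = Suc k then 1 else 0) - 1 / real (r + 1)
     else 1 / real (r + 1) - (if n = r + 1 - k then 1 else 0))"

lemma sum_single: "(\<Sum>n\<in>{1..r+1}. if n = i then f n else 0) = (if i \<in> {1..r+1} then f i else (0::real))"
  by simp

lemma std_weight_sum: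
  assumes "k \<le> r"
  shows "(\<Sum>n\<in>{1..r+1}. std_weight k n) = 0" "(\<Sum>n\<in>{1..r+1}. real n * std_weight k n) = real k - real r / 2"
proof -
  have g: "(\<Sum>n\<in>{1..r+1}. real n) = real (r + 1) * real (r + 2) / 2"
    by (induction r) (simp_all add: field_simps)
  have c: "(\<Sum>n\<in>{1..r+1}. 1 / real (r + 1)) = 1" by simp
  have mem: "Suc k \<in> {1..r+1}" "r + 1 - k \<in> {1..r+1}" using assms by auto
  have u: "(\<Sum>n\<in>{1..r+1}. if n = i then 1 else 0) = (1 :: real)" if "i \<in> {1..r+1}" for i
    by (simp only: sum_single that if_True)
  show "(\<Sum>n\<in>{1..r+1}. std_weight k n) = 0"
    unfolding std_weight_def
    by (cases "s = 1") (simp_all only: simp_thms if_True if_False sum_subtractf c u[OF mem(1)] u[OF mem(2)] diff_self)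
  have 1: "real n * ((if n = i then 1 else 0) - x) = (if n = i then real n else 0) - x * real n"
    "real n * (x - (if n = i then 1 else 0)) = x * real n - (if n = i then real n else 0)" for n i x
    by (auto simp: algebra_simps)
  have "(\<Sum>n\<in>{1..r+1}. real n * std_weight k n)
     = (if s = 1 then real (Suc k) - 1 / real (r + 1) * (real (r + 1) * real (r + 2) / 2)
        else 1 / real (r + 1) * (real (r + 1) * real (r + 2) / 2) - real (r + 1 - k))"
    unfolding std_weight_def g[symmetric]
    by (cases "s = 1") (simp_all only: simp_thms if_True if_False 1 sum_subtractf sum_distrib_left[symmetric] sum_single mem)
  then show "(\<Sum>n\<in>{1..r+1}. real n * std_weight k n) = real k - real r / 2"
    using assms by (auto simp: of_nat_diff field_simps)
qed

text \<open>
  A vector of coordinate sum zero is determined by its pairings with the simple roots.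
\<close>

lemma weight_unique:
  assumes k: "k \<le> r" and sum: "(\<Sum>n\<in>{1..r+1}. \<mu> n) = 0"
    and pair: "\<And>j. j < r \<Longrightarrow> wt_form r (simple_root (node j)) \<mu> = chain_exp j k" and n: "n \<in> {1..r+1}"
  shows "\<mu> n = std_weight k n"
proof -
  have step: "\<mu> i - std_weight k i = \<mu> (i + 1) - std_weight k (i + 1)" if i: "i \<in> {1..r}" for i
  proof -
    have "i \<in> node ` {..<r}" using nodes_bij i by (simp only: bij_betw_def)
    then obtain j where j: "j < r" "i = node j" by blast
    have "\<mu> i - \<mu> (i + 1) = chain_exp j k"
      using pair[OF j(1)] wt_form_simple_root[OF i] j by simp
    also have "\<dots> = std_weight k i - std_weight k (i + 1)"
      using k j unfolding std_weight_def chain_exp_def j(2) node_def by auto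
    finally show ?thesis by simp
  qed
  have const: "i \<in> {1..r+1} \<Longrightarrow> \<mu> i - std_weight k i = \<mu> 1 - std_weight k 1" for i
  proof (induction i)
    case (Suc i)
    then show ?case using step[of i] by (cases "i = 0") auto
  qed simp
  have "0 = (\<Sum>i\<in>{1..r+1}. \<mu> i - std_weight k i)"
    using sum std_weight_sum(1)[OF k] by (simp add: sum_subtractf)
  also have "\<dots> = (\<Sum>i\<in>{1..r+1}. \<mu> 1 - std_weight k 1)"
    by (intro sum.cong refl const)
  also have "\<dots> = real (r + 1) * (\<mu> 1 - std_weight k 1)" by simp
  finally have "real (r + 1) * (\<mu> 1 - std_weight k 1) = 0" by (rule sym)
  then have "\<mu> 1 - std_weight k 1 = 0" by (metis mult_eq_0_iff of_nat_eq_0_iff add_is_0 one_neq_zero)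
  then show ?thesis using const[OF n] by simp
qed

lemma wt_form_cong: "(\<And>n. n \<in> {1..r+1} \<Longrightarrow> \<mu> n = \<mu>' n) \<Longrightarrow> (\<And>n. n \<in> {1..r+1} \<Longrightarrow> \<nu> n = \<nu>' n) \<Longrightarrow> wt_form r \<mu> \<nu> = wt_form r \<mu>' \<nu>'"
  by (simp add: wt_form_def)

lemma rho_eq:
  assumes "n \<in> {1..r+1}"
  shows "rho_weight r n = real (r + 1) - real n - real r / 2"
proof -
  have g: "(\<Sum>i\<in>{1..r}. real i) = real r * real (r + 1) / 2"
    by (induction r) (simp_all add: field_simps)
  have "rho_weight r n = (\<Sum>i\<in>{1..r}. (if n \<le> i then 1 else 0) - real i / real (r + 1))"
    using assms by (simp add: rho_weight_def fund_weight_def)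
  also have "\<dots> = (\<Sum>i\<in>{1..r}. if n \<le> i then 1 else 0) - real r / 2"
  proof -
    have "(\<Sum>i\<in>{1..r}. real i / real (r + 1)) = real r / 2"
      unfolding sum_divide_distrib[symmetric] g by (simp add: field_simps)
    then show ?thesis by (simp only: sum_subtractf)
  qed
  also have "(\<Sum>i\<in>{1..r}. if n \<le> i then 1 else 0) = (\<Sum>i\<in>{n..r}. (1::real))"
    using assms by (intro sum.mono_neutral_cong_right) auto
  also have "\<dots> = real (r + 1) - real n" using assms by (simp add: of_nat_diff)
  finally show ?thesis .
qed

lemma wt_rho: 
  assumes "k \<le> r"
  shows "2 * wt_form r (std_weight k) (rho_weight r) = real r - 2 * real k"
proof -
  have "wt_form r (std_weight k) (rho_weight r) = (\<Sum>n\<in>{1..r+1}. (real (r + 1) - real r / 2) * std_weight k n - real n * std_weight k n)"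
    unfolding wt_form_def by (intro sum.cong refl) (simp only: rho_eq, simp add: algebra_simps)
  also have "\<dots> = - (real k - real r / 2)"
    by (simp only: sum_subtractf sum_distrib_left[symmetric] std_weight_sum[OF assms])
  finally show ?thesis by simp
qed

lemma lam_chain_index: "k \<le> r \<Longrightarrow> n \<in> {1..r+1} \<Longrightarrow> lam (chain_index k) n = std_weight k n"
  using node_exp_chain_index[of k] lam_mem[of "chain_index k"]
  by (intro weight_unique) (auto simp: node_exp_def weight_space_def)

lemma fund_weight_sum: "(\<Sum>n\<in>{1..r+1}. fund_weight r s n) = 0"
proof -
  have "(\<Sum>n\<in>{1..r+1}. fund_weight r s n) = (\<Sum>n\<in>{1..r+1}. if n \<le> s then 1 else 0) - real s"
    by (simp add: fund_weight_def sum_subtractf)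
  also have "(\<Sum>n\<in>{1..r+1}. if n \<le> s then 1 else 0) = (\<Sum>n\<in>{1..s}. (1::real))"
    using s_mem by (intro sum.mono_neutral_cong_right) auto
  finally show ?thesis by simp
qed

lemma fund_weight_std: "n \<in> {1..r+1} \<Longrightarrow> fund_weight r s n = std_weight 0 n"
  using wt_hw by (intro weight_unique fund_weight_sum) auto

lemma m_eq: "m = real r"
proof -
  have "wt_form r (fund_weight r s) (rho_weight r) = wt_form r (std_weight 0) (rho_weight r)"
    by (rule wt_form_cong) (simp_all only: fund_weight_std)
  then show ?thesis using wt_rho[of 0] by (simp add: m_def)
qed

lemma a_eq: "a = 2"
  using wt_nodes[of 0 0] r_ge_1 by (simp add: a_def s_node[symmetric])

lemma lam_rho: "k \<le> r \<Longrightarrow> 2 * wt_form r (lam (chain_index k)) (rho_weight r) = real r - 2 * real k"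
proof -
  assume k: "k \<le> r"
  have "wt_form r (lam (chain_index k)) (rho_weight r) = wt_form r (std_weight k) (rho_weight r)"
    by (rule wt_form_cong) (simp_all only: lam_chain_index[OF k])
  then show ?thesis using wt_rho[OF k] by simp
qed

text \<open>
  The scalar of the braiding of \<open>V\<close> with itself is \<open>q powr (w - 1)\<close>, so that its Hecke roots are \<open>q powr w\<close> and
  \<open>- (q powr (w - 2))\<close>.
\<close>

lemma wt_w0: "wt_form r (fund_weight r s) (w0_act r (fund_weight r s)) = w - 1"
proof -
  let ?x = "1 / real (r + 1)" and ?N = "{1..r+1}"
  have x: "real (r + 1) * ?x = 1" by simp
  have s: "(\<Sum>n\<in>?N. c * ((if n = i then 1 else 0) - ?x) * (c * ((if n = j then 1 else 0) - ?x))) = (if i = j then 1 else 0) - ?x"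
    if ij: "i \<in> ?N" "j \<in> ?N" and c: "c * c = 1" for i j and c :: real
  proof -
    have "c * ((if n = i then 1 else 0) - ?x) * (c * ((if n = j then 1 else 0) - ?x))
        = (if n = i then if i = j then 1 else 0 else 0) - (if n = i then ?x else 0) - (if n = j then ?x else 0) + ?x * ?x" for n
      using c by (auto simp: algebra_simps)
    then have "(\<Sum>n\<in>?N. c * ((if n = i then 1 else 0) - ?x) * (c * ((if n = j then 1 else 0) - ?x)))
       = (if i = j then 1 else 0) - ?x - ?x + real (r + 1) * (?x * ?x)"
      using ij by (simp only: sum.distrib sum_subtractf sum_single if_True) simp
    then show ?thesis by (simp only: mult.assoc[symmetric] x; simp)
  qed
  define c :: real where "c = (if s = 1 then 1 else -1)"
  define i where "i = (if s = 1 then 1 else r + 1)"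
  define j where "j = (if s = 1 then r + 1 else 1)"
  have cc: "c * c = 1" and ij: "i \<in> ?N" "j \<in> ?N" "i \<noteq> j"
    using r_ge_1 unfolding c_def i_def j_def by auto
  have f: "fund_weight r s n = c * ((if n = i then 1 else 0) - ?x)" if "n \<in> ?N" for n
    using fund_weight_std[OF that] unfolding std_weight_def c_def i_def by auto
  have f': "w0_act r (fund_weight r s) n = c * ((if n = j then 1 else 0) - ?x)" if "n \<in> ?N" for n
  proof -
    have "r + 2 - n \<in> ?N" "r + 2 - n = i \<longleftrightarrow> n = j" using that unfolding i_def j_def by auto
    then show ?thesis using that by (simp only: w0_act_def f if_True)
  qed
  have "w = 1 - ?x" using s[OF ij(1) ij(1) cc] unfolding w_def wt_form_def by (simp only: f cong: sum.cong; simp)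
  moreover have "wt_form r (fund_weight r s) (w0_act r (fund_weight r s)) = 0 - ?x"
    using s[OF ij(1,2) cc] ij(3) unfolding wt_form_def by (simp only: f f' cong: sum.cong; simp)
  ultimately show ?thesis by simp
qed

lemma w0_w0: "n \<in> {1..r+1} \<Longrightarrow> w0_act r dual_hw n = - fund_weight r s n"
proof -
  assume n: "n \<in> {1..r+1}"
  then have "r + 2 - n \<in> {1..r+1}" "r + 2 - (r + 2 - n) = n" by auto
  then show ?thesis using n by (simp only: w0_act_def dual_hw_def neg_weight_def if_True)
qed

lemma wt_dual:
  "wt_form r (fund_weight r s) (w0_act r dual_hw) = - w"
  "wt_form r dual_hw (w0_act r dual_hw) = w - 1"
proof -
  have "wt_form r (fund_weight r s) (w0_act r dual_hw) = (\<Sum>n\<in>{1..r+1}. - (fund_weight r s n * fund_weight r s n))"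
    unfolding wt_form_def using w0_w0 by (intro sum.cong refl) (metis mult_minus_right)
  then show "wt_form r (fund_weight r s) (w0_act r dual_hw) = - w"
    by (simp add: w_def wt_form_def sum_negf)
  have "wt_form r dual_hw (w0_act r dual_hw) = wt_form r (fund_weight r s) (w0_act r (fund_weight r s))"
    unfolding wt_form_def
  proof (intro sum.cong refl)
    fix n assume "n \<in> {1..r+1}"
    then show "dual_hw n * w0_act r dual_hw n = fund_weight r s n * w0_act r (fund_weight r s) n"
      by (subst w0_w0) (simp_all add: dual_hw_def neg_weight_def)
  qed
  then show "wt_form r dual_hw (w0_act r dual_hw) = w - 1" by (simp only: wt_w0)
qed

lemma wt_pair_w0:
  assumes "j < r"
  shows "wt_form r (simple_root (node j)) (w0_act r (fund_weight r s)) = chain_exp j r"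
proof -
  have i: "node j \<in> {1..r}" by (rule node_mem[OF assms])
  have 1: "node j \<in> {1..r+1}" "node j + 1 \<in> {1..r+1}" "r + 2 - node j \<in> {1..r+1}" "r + 2 - (node j + 1) \<in> {1..r+1}" using i by auto
  show ?thesis
    unfolding wt_form_simple_root[OF i] w0_act_def using 1 
    by (simp only: if_True fund_weight_std) (use assms in \<open>unfold std_weight_def node_def chain_exp_def, auto\<close>)
qed

lemma wt_pair_dual:
  assumes "j < r"
  shows "wt_form r (simple_root (node (r - 1 - j))) dual_hw = chain_exp j 0"
    "wt_form r (simple_root (node (r - 1 - j))) (w0_act r dual_hw) = chain_exp j r"
proof -
  let ?j = "r - 1 - j"
  have j: "?j < r" using assms by auto
  have i: "node ?j \<in> {1..r}" by (rule node_mem[OF j])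
  have 1: "node ?j \<in> {1..r+1}" "node ?j + 1 \<in> {1..r+1}" using i by auto
  have "wt_form r (simple_root (node ?j)) dual_hw = - chain_exp ?j r"
    using wt_pair_w0[OF j] unfolding wt_form_simple_root[OF i] by (simp add: dual_hw_def neg_weight_def)
  then show "wt_form r (simple_root (node ?j)) dual_hw = chain_exp j 0" using assms by (auto simp: chain_exp_def)
  have "wt_form r (simple_root (node ?j)) (w0_act r dual_hw) = - chain_exp ?j 0"
    using wt_hw[OF j] 1 unfolding wt_form_simple_root[OF i] by (simp only: w0_w0)
  then show "wt_form r (simple_root (node ?j)) (w0_act r dual_hw) = chain_exp j r" using assms by (auto simp: chain_exp_def)
qed

lemma chain_weight_vector:
  assumes "chain_module r Q X \<nu> b \<phi>" "k \<le> r"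
    and "\<And>j. j < r \<Longrightarrow> wt_form r (simple_root (\<nu> j)) \<mu> = chain_exp j k"
  shows "weight_vector r q X \<mu> (axis (b k) 1)"
proof -
  interpret X: chain_module r Q X \<nu> b \<phi> by (rule assms(1))
  have "uK X i *v axis (b k) 1 = complex_of_real (q powr wt_form r (simple_root i) \<mu>) *s axis (b k) 1"
    if i: "i \<in> {1..r}" for i
  proof -
    obtain j where "j < r" "i = \<nu> j" using X.node_cases[OF i] by blast
    then show ?thesis using assms(2,3) by (simp add: X.act_K Q_powr)
  qed
  then show ?thesis by (simp add: weight_vector_def)
qed

interpretation V: chain_module r Q V node chain_index chain_coeff by (rule V_chain)
interpretation D: chain_module r Q "uq_dual V" "\<lambda>k. node (r - 1 - k)" "\<lambda>l. chain_index (r - l)" "\<lambda>k. - (chain_coeff (r - 1 - k) / Q)"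
  by (rule V.chain_module_dual)

definition braid_scale :: complex where "braid_scale = qexp (w - 1)"

lemma braid_scale: "braid_scale \<noteq> 0" "braid_scale * Q = qexp w"
  using q_pos by (auto simp: braid_scale_def qexp_def Q_def powr_diff)

lemma R_VV_eq: "R_VV = V.hecke braid_scale"
  unfolding R_VV_def
proof (rule braiding_eqI[OF V_chain V_chain])
  show "uq_module_map r (uq_tensor V V) (uq_tensor V V) (V.hecke braid_scale)" by (rule V.hecke_module_map)
  show "weight_vector r q V (fund_weight r s) (axis (chain_index 0) 1)"
    by (rule chain_weight_vector[OF V_chain _ wt_hw]) auto
  show "weight_vector r q V (w0_act r (fund_weight r s)) (axis (chain_index r) 1)"
    by (rule chain_weight_vector[OF V_chain _ wt_pair_w0]) auto
  show "V.hecke braid_scale *v axis (chain_index 0, chain_index r) 1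
      = complex_of_real (q powr wt_form r (fund_weight r s) (w0_act r (fund_weight r s))) *s axis (chain_index r, chain_index 0) 1"
    using r_ge_1 by (simp add: V.hecke_column wt_w0 braid_scale_def qexp_def)
qed

lemma R_DD_eq: "R_DD = D.hecke braid_scale"
  unfolding R_DD_def
proof (rule braiding_eqI[OF V.chain_module_dual V.chain_module_dual])
  show "uq_module_map r (uq_tensor (uq_dual V) (uq_dual V)) (uq_tensor (uq_dual V) (uq_dual V)) (D.hecke braid_scale)"
    by (rule D.hecke_module_map)
  show "weight_vector r q (uq_dual V) dual_hw (axis (chain_index (r - 0)) 1)"
    by (rule chain_weight_vector[OF V.chain_module_dual _ wt_pair_dual(1)]) auto
  show "weight_vector r q (uq_dual V) (w0_act r dual_hw) (axis (chain_index (r - r)) 1)"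
    by (rule chain_weight_vector[OF V.chain_module_dual _ wt_pair_dual(2)]) auto
  show "D.hecke braid_scale *v axis (chain_index (r - 0), chain_index (r - r)) 1
      = complex_of_real (q powr wt_form r dual_hw (w0_act r dual_hw)) *s axis (chain_index (r - r), chain_index (r - 0)) 1"
    using r_ge_1 D.hecke_column[of 0 r braid_scale] by (simp add: wt_dual braid_scale_def qexp_def)
qed

lemma R_VD_eq: "R_VD = matrix_inv (V.mixed braid_scale)"
  unfolding R_VD_def
proof (rule braiding_eqI[OF V_chain V.chain_module_dual])
  note inv = V.mixed_invertible[OF braid_scale(1)]
  show "uq_module_map r (uq_tensor V (uq_dual V)) (uq_tensor (uq_dual V) V) (matrix_inv (V.mixed braid_scale))"
    by (rule uq_module_map_inverse[OF V.mixed_module_map inv])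
  show "weight_vector r q V (fund_weight r s) (axis (chain_index 0) 1)"
    by (rule chain_weight_vector[OF V_chain _ wt_hw]) auto
  show "weight_vector r q (uq_dual V) (w0_act r dual_hw) (axis (chain_index (r - r)) 1)"
    by (rule chain_weight_vector[OF V.chain_module_dual _ wt_pair_dual(2)]) auto
  have col: "V.mixed braid_scale *v axis (chain_index 0, chain_index 0) 1 = qexp w *s axis (chain_index 0, chain_index 0) 1"
    by (simp add: V.mixed_column braid_scale(2))
  have "matrix_inv (V.mixed braid_scale) *v (qexp w *s axis (chain_index 0, chain_index 0) 1) = matrix_inv (V.mixed braid_scale) *v (V.mixed braid_scale *v axis (chain_index 0, chain_index 0) 1)"
    by (simp only: col)
  also have "\<dots> = axis (chain_index 0, chain_index 0) 1"
    by (simp only: matrix_vector_mul_assoc inv matrix_vector_mul_lid)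
  finally have "matrix_inv (V.mixed braid_scale) *v (qexp w *s axis (chain_index 0, chain_index 0) 1) = axis (chain_index 0, chain_index 0) 1" .
  then have "qexp (- w) *s (qexp w *s (matrix_inv (V.mixed braid_scale) *v axis (chain_index 0, chain_index 0) 1)) = qexp (- w) *s axis (chain_index 0, chain_index 0) 1"
    by (simp only: mult_vec_linear)
  moreover have "qexp (- w) * qexp w = 1"
    using q_pos by (simp add: qexp_def of_real_mult[symmetric] powr_add[symmetric] del: of_real_mult)
  ultimately show "matrix_inv (V.mixed braid_scale) *v axis (chain_index 0, chain_index (r - r)) 1
      = complex_of_real (q powr wt_form r (fund_weight r s) (w0_act r dual_hw)) *s axis (chain_index (r - r), chain_index 0) 1"
    by (simp add: wt_dual vector_smult_assoc qexp_def)
qed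

definition ev_weight :: "'n \<Rightarrow> complex" where "ev_weight i = qexp (2 * wt_form r (lam i) (rho_weight r))"

theorem braiding_hk_matrices: "hk_matrices S St ev_weight (qexp w) (qexp a) (qexp m)"
proof -
  have e: "ev_weight (chain_index k) = qexp (real r - 2 * real k)" if "k \<le> r" for k
    using lam_rho[OF that] by (simp add: ev_weight_def)
  have "Q * ev_weight (chain_index (Suc l)) = ev_weight (chain_index l) / Q" if "l < r" for l
  proof -
    have "q * (q * q powr (real r - 2 * real (Suc l))) = q powr (1 + (1 + (real r - 2 * real (Suc l))))"
      using q_pos by (simp only: powr_add powr_one)
    also have "\<dots> = q powr (real r - 2 * real l)" by (simp add: algebra_simps)
    finally have "Q * (Q * ev_weight (chain_index (Suc l))) = ev_weight (chain_index l)"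
      using that by (simp add: e qexp_def Q_def of_real_mult[symmetric] del: of_real_mult)
    then show ?thesis using Q_facts by (simp add: field_simps)
  qed
  moreover have "ev_weight (chain_index 0) = qexp m" using e[of 0] by (simp add: m_eq)
  moreover have "qexp m \<noteq> 0" using q_pos by (simp add: qexp_def)
  moreover have "qexp a = Q\<^sup>2" using q_pos by (simp add: a_eq qexp_def Q_def powr_numeral)
  ultimately show ?thesis
    using V.hk_matrices_chain[of ev_weight braid_scale] braid_scale
    by (simp add: S_def St_def R_VV_eq R_DD_eq R_VD_eq)
qed

lemma R_VD_inverse: "matrix_inv R_VD ** R_VD = mat 1"
proof (rule matrix_inv_inverse(2))
  show "invertible R_VD"
    unfolding invertible_def R_VD_eq using V.mixed_invertible[OF braid_scale(1)] by blast
qed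

end

section \<open>The exterior derivative of a one-form\<close>

lemma act_map:
  fixes X :: "('n::finite, 'x::ab_group_add) fam4" and f :: "'x \<Rightarrow> 'y::ab_group_add"
  assumes "\<And>x y. f (x + y) = f x + f y"
    and "\<And>z i j k l. f (sc1 z (X i j k l)) = sc2 z (f (X i j k l))"
  shows "f (act123 sc1 A X i j k l) = act123 sc2 A (\<lambda>i j k l. f (X i j k l)) i j k l"
    "f (act234 sc1 A X i j k l) = act234 sc2 A (\<lambda>i j k l. f (X i j k l)) i j k l"
proof -
  have 0: "f 0 = 0" using assms(1)[of 0 0] by simp
  have s: "f (sum g I) = (\<Sum>i\<in>I. f (g i))" for g and I :: "('n \<times> 'n \<times> 'n) set"
    by (induction I rule: infinite_finite_induct) (simp_all add: 0 assms(1))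
  show "f (act123 sc1 A X i j k l) = act123 sc2 A (\<lambda>i j k l. f (X i j k l)) i j k l"
    "f (act234 sc1 A X i j k l) = act234 sc2 A (\<lambda>i j k l. f (X i j k l)) i j k l"
    by (simp_all add: act123_def act234_def s assms(2) case_prod_unfold)
qed

context universal_calculus
begin

definition \<pi>0 :: "'b \<Rightarrow> 'w" where "\<pi>0 x = proj (emb0 x)"
definition \<pi>1 :: "'u \<times> 'v \<Rightarrow> 'w" where "\<pi>1 x = proj (emb1 x)"

lemma proj_ring: "ring_map proj" "surj proj"
  using pi_quotient by (simp_all add: quotient_ring_map_def)

lemma emb_props: "ring_map emb0" "additive_map emb1" "emb1 (lO b x) = emb0 b * emb1 x" "emb1 (rO x b) = emb1 x * emb0 b"
  using T_tensor_algebra unfolding tensor_algebra_def by blast+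

lemma emb1_add: "emb1 (x + y) = emb1 x + emb1 y"
  using emb_props(2) unfolding additive_map_def by blast

lemmas proj_simps = ring_map_simps[OF proj_ring(1)]

lemma pi0_ring: "ring_map \<pi>0"
  using emb_props(1) by (auto simp: ring_map_def additive_map_def \<pi>0_def proj_simps)

lemma c_ring: "ring_map c" and c_central: "c z * b = b * c z"
  using B_presented by (simp_all add: presented_algebra_def complex_algebra_def)

lemma pi1_simps: "\<pi>1 (x + y) = \<pi>1 x + \<pi>1 y" "\<pi>1 (lO b x) = \<pi>0 b * \<pi>1 x" "\<pi>1 (rO x b) = \<pi>1 x * \<pi>0 b"
  by (simp_all add: \<pi>1_def \<pi>0_def proj_simps emb1_add emb_props)

lemma left_modules: "left_module lP" "left_module lM" "right_module rP" "right_module rM"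
  using plus_bimodule minus_bimodule by (simp_all add: bimodule_def)

lemma lO_simps: "lO b (x + y) = lO b x + lO b y" "lO (b * b') x = lO b (lO b' x)" "lO 1 x = x" "lO (b + b') x = lO b x + lO b' x"
  using left_modules by (simp_all add: lO_def left_module_def plus_prod_def prod_eq_iff)

lemma rO_simps: "rO (x + y) b = rO x b + rO y b" "rO x (b * b') = rO (rO x b) b'" "rO x (b + b') = rO x b + rO x b'"
    "rO (lO b x) b' = lO b (rO x b')" "lO (c z) x = rO x (c z)"
  using left_modules plus_bimodule minus_bimodule
  by (simp_all add: lO_def rO_def right_module_def plus_prod_def prod_eq_iff bimodule_def)

lemma d_simps: "d (x + y) = d x + d y" "d (c z) = 0" "d (x * y) = rO (d x) y + lO x (d y)"
    "del (x * y) = rO (del x) y + lO x (del y)" "delbar (x * y) = rO (delbar x) y + lO x (delbar y)"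
proof -
  have z: "lP b 0 = 0" "lM b 0 = 0" "rP 0 b = 0" "rM 0 b = 0" for b
    using left_modules unfolding left_module_def right_module_def by (metis add_cancel_left_left)+
  show "d (x + y) = d x + d y" "d (c z) = 0" "d (x * y) = rO (d x) y + lO x (d y)"
    "del (x * y) = rO (del x) y + lO x (del y)" "delbar (x * y) = rO (delbar x) y + lO x (delbar y)"
    using plus_derivation minus_derivation z
    by (auto simp: d_def del_def delbar_def lO_def rO_def derivation_def additive_map_def prod_eq_iff zero_prod_def)
qed

text \<open>
  \<open>ext x y\<close> expresses \<open>dx = y\<close>, computed from a presentation of \<open>x\<close> as a sum of terms \<open>a db\<close>.  A relation
  is used because differentiation is additive and satisfies the Leibniz rules at the level of presentations,
  and the defining property of the universal calculus then makes the value unique.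
\<close>

definition ext :: "'u \<times> 'v \<Rightarrow> 'w \<Rightarrow> bool" where
  "ext x t \<longleftrightarrow> (\<exists>xs. x = (\<Sum>(a, b)\<leftarrow>xs. lO a (d b)) \<and> t = (\<Sum>(a, b)\<leftarrow>xs. \<pi>1 (d a) * \<pi>1 (d b)))"

lemma ext_add: "ext x t \<Longrightarrow> ext y t' \<Longrightarrow> ext (x + y) (t + t')"
  unfolding ext_def by (elim exE conjE, rule_tac x = "xs @ xsa" in exI) simp

text \<open>
  This is the defining relation of the universal calculus.
\<close>

lemma ext_zero: "ext 0 t \<Longrightarrow> t = 0"
proof -
  assume "ext 0 t"
  then obtain xs where xs: "0 = (\<Sum>(a, b)\<leftarrow>xs. lO a (d b))" "t = (\<Sum>(a, b)\<leftarrow>xs. \<pi>1 (d a) * \<pi>1 (d b))"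
    unfolding ext_def by blast
  have "t = proj (\<Sum>(x, y)\<leftarrow>xs. emb1 (d x) * emb1 (d y))"
    unfolding xs(2) by (induction xs) (auto simp: proj_simps \<pi>1_def)
  moreover have "(\<Sum>(x, y)\<leftarrow>xs. emb1 (d x) * emb1 (d y)) \<in> two_sided_ideal hull
     {\<Sum>(x, y)\<leftarrow>xs. emb1 (d x) * emb1 (d y) | xs. (\<Sum>(x, y)\<leftarrow>xs. lO x (d y)) = 0}"
    using xs(1)[symmetric] by (intro hull_inc) blast
  ultimately show "t = 0"
    using pi_quotient by (simp add: quotient_ring_map_def)
qed

lemma ext_d: "ext (lO x (d y)) (\<pi>1 (d x) * \<pi>1 (d y))"
  unfolding ext_def by (rule exI[of _ "[(x, y)]"]) simp

lemma d_one: "d 1 = 0"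
  using d_simps(2)[of 1] ring_map_simps(3)[OF c_ring] by simp

lemma pi1_0: "\<pi>1 0 = 0"
  using pi1_simps(1)[of 0 0] by simp

lemma lO_minus: "lO (- b) x = - lO b x"
  using lO_simps(4)[of b "- b" x] lO_simps(4)[of 0 0 x] by (simp add: eq_neg_iff_add_eq_0 add.commute)

lemma d_minus: "d (- b) = - d b"
  using d_simps(1)[of b "- b"] d_simps(1)[of 0 0] by (simp add: eq_neg_iff_add_eq_0 add.commute)

lemma ext_lO: "ext x t \<Longrightarrow> ext (lO b x) (\<pi>1 (d b) * \<pi>1 x + \<pi>0 b * t)"
proof -
  assume "ext x t"
  then obtain xs where xs: "x = (\<Sum>(a, b)\<leftarrow>xs. lO a (d b))" "t = (\<Sum>(a, b)\<leftarrow>xs. \<pi>1 (d a) * \<pi>1 (d b))"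
    unfolding ext_def by blast
  have z: "lO b 0 = 0" for b using lO_simps(1)[of b 0 0] by simp
  have "lO b (\<Sum>(a, b)\<leftarrow>xs. lO a (d b)) = (\<Sum>(a, b)\<leftarrow>map (\<lambda>(x, y). (b * x, y)) xs. lO a (d b))"
    by (induction xs) (auto simp: lO_simps z)
  moreover have "\<pi>1 (d b) * \<pi>1 (\<Sum>(a, b)\<leftarrow>xs. lO a (d b)) + \<pi>0 b * (\<Sum>(a, b)\<leftarrow>xs. \<pi>1 (d a) * \<pi>1 (d b))
     = (\<Sum>(a, b)\<leftarrow>map (\<lambda>(x, y). (b * x, y)) xs. \<pi>1 (d a) * \<pi>1 (d b))"
    by (induction xs) (auto simp: pi1_0 pi1_simps d_simps algebra_simps)
  ultimately show ?thesis
    unfolding ext_def xs by blast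
qed

lemma ext_uminus: "ext x t \<Longrightarrow> ext (- x) (- t)"
proof -
  assume "ext x t"
  then have "ext (lO (c (- 1)) x) (\<pi>1 (d (c (- 1))) * \<pi>1 x + \<pi>0 (c (- 1)) * t)" by (rule ext_lO)
  then show ?thesis
    by (simp add: d_simps pi1_0 ring_map_simps[OF c_ring] ring_map_simps[OF pi0_ring] lO_minus lO_simps d_minus d_one)
qed

lemma ext_unique: "ext x t \<Longrightarrow> ext x t' \<Longrightarrow> t = t'"
  using ext_zero[of "t - t'"] ext_add[OF _ ext_uminus, of x t x t'] by simp

text \<open>
  On a single term, \<open>(a db) x = a d(bx) - (ab) dx\<close>.
\<close>

lemma ext_rO_d: "ext (rO (lO y (d b)) x) (\<pi>1 (d y) * \<pi>1 (d b) * \<pi>0 x - \<pi>0 y * \<pi>1 (d b) * \<pi>1 (d x))"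
proof -
  have eq: "rO (lO y (d b)) x = lO y (d (b * x)) + - lO (y * b) (d x)"
    by (simp add: rO_simps d_simps lO_simps)
  have t: "\<pi>1 (d y) * \<pi>1 (d b) * \<pi>0 x - \<pi>0 y * \<pi>1 (d b) * \<pi>1 (d x)
      = \<pi>1 (d y) * \<pi>1 (d (b * x)) + - (\<pi>1 (d (y * b)) * \<pi>1 (d x))"
    by (simp add: d_simps pi1_simps algebra_simps)
  show ?thesis unfolding eq t by (intro ext_add ext_uminus ext_d)
qed

lemma ext_rO: "ext x t \<Longrightarrow> ext (rO x b) (t * \<pi>0 b - \<pi>1 x * \<pi>1 (d b))"
proof -
  assume "ext x t"
  then obtain xs where xs: "x = (\<Sum>(a, b)\<leftarrow>xs. lO a (d b))" "t = (\<Sum>(a, b)\<leftarrow>xs. \<pi>1 (d a) * \<pi>1 (d b))"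
    unfolding ext_def by blast
  have z: "rO 0 b = 0" for b using rO_simps(1)[of 0 0 b] by simp
  have e0: "ext 0 0" unfolding ext_def by (rule exI[of _ "[]"]) simp
  show ?thesis
    unfolding xs
  proof (induction xs)
    case Nil
    then show ?case using e0 by (simp add: z pi1_0)
  next
    case (Cons y ys)
    show ?case
      using ext_add[OF ext_rO_d[of "fst y" "snd y" b] Cons]
      by (simp add: case_prod_unfold rO_simps pi1_simps algebra_simps)
  qed
qed

end

section \<open>Relations between generators\<close>

lemma free_eval_superset:
  assumes "ring_map c" "finite A" "Poly_Mapping.keys f \<subseteq> A"
  shows "free_eval c gen f = (\<Sum>xs\<in>A. c (Poly_Mapping.lookup f xs) * prod_list (map gen xs))"
  unfolding free_eval_def
  by (rule sum.mono_neutral_left[OF assms(2,3)]) (auto simp: in_keys_iff ring_map_simps[OF assms(1)])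

lemma free_eval_add:
  assumes "ring_map c"
  shows "free_eval c gen (f + g) = free_eval c gen f + free_eval c gen g"
proof -
  let ?A = "Poly_Mapping.keys f \<union> Poly_Mapping.keys g"
  have "Poly_Mapping.keys (f + g) \<subseteq> ?A" by (rule Poly_Mapping.keys_add)
  then show ?thesis
    by (simp add: free_eval_superset[OF assms, of ?A] lookup_add ring_map_simps[OF assms] distrib_right sum.distrib)
qed

lemma free_eval_single:
  assumes "ring_map c"
  shows "free_eval c gen (Poly_Mapping.single xs z) = c z * prod_list (map gen xs)"
  by (simp add: free_eval_superset[OF assms, of "{xs}"])

lemma free_gen_products:
  "free_const z * free_gen x = Poly_Mapping.single [x] z"
  "free_const z * (free_gen x * free_gen y) = Poly_Mapping.single [x, y] z"
  by (simp_all add: free_const_def free_gen_def mult_single plus_list_def)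

lemma presented_module_eval:
  fixes l :: "'b::ring_1 \<Rightarrow> 'x::ab_group_add \<Rightarrow> 'x" and gen :: "'g::finite \<Rightarrow> 'x"
  assumes "left_module l"
  shows "(\<Sum>g\<in>UNIV. l ((v + v') $ g) (gen g)) = (\<Sum>g\<in>UNIV. l (v $ g) (gen g)) + (\<Sum>g\<in>UNIV. l (v' $ g) (gen g))"
    "(\<Sum>g\<in>UNIV. l ((b *s v) $ g) (gen g)) = l b (\<Sum>g\<in>UNIV. l (v $ g) (gen g))"
    "(\<Sum>g\<in>UNIV. l (axis h 1 $ g) (gen g)) = gen h"
proof -
  note m = assms[unfolded left_module_def]
  have ml: "l b (x + y) = l b x + l b y" "l (b + b') x = l b x + l b' x" "l (b * b') x = l b (l b' x)" "l 1 x = x" for b b' x y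
    using m by blast+
  have z: "l b 0 = 0" "l 0 x = 0" for b x using ml(1)[of b 0 0] ml(2)[of 0 0 x] by simp_all
  have s: "l b (sum f I) = (\<Sum>i\<in>I. l b (f i))" for b f and I :: "'g set"
    by (induction I rule: infinite_finite_induct) (simp_all add: z ml)
  show "(\<Sum>g\<in>UNIV. l ((v + v') $ g) (gen g)) = (\<Sum>g\<in>UNIV. l (v $ g) (gen g)) + (\<Sum>g\<in>UNIV. l (v' $ g) (gen g))"
    by (simp add: ml sum.distrib)
  show "(\<Sum>g\<in>UNIV. l ((b *s v) $ g) (gen g)) = l b (\<Sum>g\<in>UNIV. l (v $ g) (gen g))"
    by (simp add: ml s)
  have "(\<Sum>g\<in>UNIV. l (axis h 1 $ g) (gen g)) = (\<Sum>g\<in>UNIV. if g = h then gen g else 0)"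
    by (intro sum.cong) (auto simp: axis_def z ml)
  then show "(\<Sum>g\<in>UNIV. l (axis h 1 $ g) (gen g)) = gen h" by simp
qed

text \<open>
  Evaluation of the free module is linear, so a relation of index-free form becomes an equation
  between families; \<open>h\<close> is the embedding of a summand into the module of one-forms.
\<close>

lemma (in qps_algebra) presented_relations:
  fixes l :: "'b \<Rightarrow> 'x::ab_group_add \<Rightarrow> 'x" and l' :: "'b \<Rightarrow> 'y::ab_group_add \<Rightarrow> 'y" and h :: "'x \<Rightarrow> 'y"
  assumes pres: "presented_left_module l (\<lambda>(i, j). D i j) rels"
    and h: "\<And>x y. h (x + y) = h x + h y" "\<And>b x. h (l b x) = l' b (h x)"
  defines "X \<equiv> (\<lambda>i j k l. l' (p i j) (h (D k l)))" and "PD \<equiv> (\<lambda>i j k l. p i j *s form_gen k l)"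
  shows "act123 form_scale A PD i j k n - form_scale z (PD i j k n) \<in> rels \<Longrightarrow>
      act123 (\<lambda>z. l' (c z)) A X i j k n = l' (c z) (X i j k n)"
    and "act234 form_scale A PD i j k n - form_scale z (PD i j k n) \<in> rels \<Longrightarrow>
      act234 (\<lambda>z. l' (c z)) A X i j k n = l' (c z) (X i j k n)"
    and "contractE' form_scale form_gen \<in> rels \<Longrightarrow>
      (\<Sum>i\<in>UNIV. l' (c (qexp (2 * wt_form r (lam i) (rho_weight r)))) (h (D i i))) = 0"
proof -
  define f where "f v = h (\<Sum>g\<in>UNIV. l (v $ g) ((\<lambda>(i, j). D i j) g))" for v
  have lm: "left_module l" using pres by (simp add: presented_left_module_def)
  note ev = presented_module_eval[OF lm]
  have h0: "h 0 = 0" using h(1)[of 0 0] by simp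
  have add: "f (x + y) = f x + f y" for x y unfolding f_def ev(1) by (rule h(1))
  have scale: "f (b *s v) = l' b (f v)" for b v unfolding f_def ev(2) by (rule h(2))
  have gen: "f (form_gen i j) = h (D i j)" for i j unfolding f_def form_gen_def ev(3) by simp
  have PD: "f (PD i j k l) = X i j k l" for i j k l by (simp add: PD_def X_def scale gen)
  have fsc: "f (form_scale z v) = l' (c z) (f v)" for z v unfolding form_scale_def by (rule scale)
  have rel: "f v = 0" if "v \<in> rels" for v
  proof -
    have "v \<in> left_submodule hull rels" using that by (rule hull_inc)
    then have "(\<Sum>g\<in>UNIV. l (v $ g) ((\<lambda>(i, j). D i j) g)) = 0"
      using pres unfolding presented_left_module_def by blast
    then show ?thesis unfolding f_def by (simp only: h0)
  qed
  have eq: "f x = f y" if "x - y \<in> rels" for x y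
    using add[of "x - y" y] rel[OF that] by simp
  show "act123 form_scale A PD i j k n - form_scale z (PD i j k n) \<in> rels \<Longrightarrow>
      act123 (\<lambda>z. l' (c z)) A X i j k n = l' (c z) (X i j k n)"
    using eq act_map(1)[of f form_scale PD "\<lambda>z. l' (c z)" A i j k n] add fsc by (simp add: PD)
  show "act234 form_scale A PD i j k n - form_scale z (PD i j k n) \<in> rels \<Longrightarrow>
      act234 (\<lambda>z. l' (c z)) A X i j k n = l' (c z) (X i j k n)"
    using eq act_map(2)[of f form_scale PD "\<lambda>z. l' (c z)" A i j k n] add fsc by (simp add: PD)
  have f0: "f 0 = 0" using add[of 0 0] by simp
  have fsum: "f (sum y I) = (\<Sum>i\<in>I. f (y i))" for y and I :: "'n set"
    by (induction I rule: infinite_finite_induct) (simp_all add: add f0)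
  show "(\<Sum>i\<in>UNIV. l' (c (qexp (2 * wt_form r (lam i) (rho_weight r)))) (h (D i i))) = 0"
    if "contractE' form_scale form_gen \<in> rels"
    using rel[OF that] by (simp add: contractE'_def fsum fsc gen)
qed

context universal_calculus
begin

lemma alg_rel:
  assumes "f \<in> alg_rels"
  shows "free_eval c (\<lambda>(i, j). p i j) f = 0"
  using B_presented hull_inc[OF assms, of two_sided_ideal] by (simp add: presented_algebra_def)

lemma S_pp: "act123 (left_mult c) S (\<lambda>i j k l. p i j * p k l) i j k l = c (qexp w) * (p i j * p k l)"
  and trace_p: "(\<Sum>i\<in>UNIV. c (ev_weight i) * p i i) = c (qexp m)"
proof -
  let ?ev = "free_eval c (\<lambda>(i, j). p i j)"
  let ?PP = "\<lambda>i j k l. free_gen (i, j) * free_gen (k, l) :: ('n \<times> 'n) free_alg"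
  note add = free_eval_add[OF c_ring]
  have diff: "?ev (x - y) = 0 \<Longrightarrow> ?ev x = ?ev y" for x y
    using add[of "\<lambda>(i, j). p i j" "x - y" y] by simp
  have sc: "?ev (free_scale z (?PP i j k l)) = c z * (p i j * p k l)"
    "?ev (free_scale z (free_gen (i, j))) = c z * p i j" for z i j k l
    by (simp_all add: free_scale_def free_gen_products free_eval_single[OF c_ring])
  have pp: "?ev (?PP i j k l) = p i j * p k l" for i j k l
    using free_eval_single[OF c_ring, of _ "[(i, j), (k, l)]" 1]
    by (simp add: free_gen_def mult_single plus_list_def ring_map_simps[OF c_ring])
  have "?ev (act123 free_scale S ?PP i j k l - free_scale (qexp w) (?PP i j k l)) = 0"
    by (rule alg_rel) (unfold alg_rels_def Let_def, blast)
  then have "?ev (act123 free_scale S ?PP i j k l) = c (qexp w) * (p i j * p k l)"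
    using diff sc by metis
  moreover have "?ev (act123 free_scale S ?PP i j k l) = act123 (left_mult c) S (\<lambda>i j k l. ?ev (?PP i j k l)) i j k l"
    by (rule act_map(1)[OF add]) (simp only: sc pp)
  ultimately show "act123 (left_mult c) S (\<lambda>i j k l. p i j * p k l) i j k l = c (qexp w) * (p i j * p k l)"
    by (simp only: pp)
  have "?ev (contractE' free_scale (\<lambda>i j. free_gen (i, j)) - free_const (qexp m)) = 0"
    by (rule alg_rel) (unfold alg_rels_def Let_def, blast)
  then have "?ev (contractE' free_scale (\<lambda>i j. free_gen (i, j))) = ?ev (free_const (qexp m))"
    by (rule diff)
  also have "\<dots> = c (qexp m)" by (simp add: free_const_def free_eval_single[OF c_ring])
  also have "?ev (contractE' free_scale (\<lambda>i j. free_gen (i, j))) = (\<Sum>i\<in>UNIV. ?ev (free_scale (ev_weight i) (free_gen (i, i))))"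
  proof -
    have "?ev 0 = 0" using add[of _ 0 0] by simp
    then have "?ev (sum f I) = (\<Sum>i\<in>I. ?ev (f i))" for f and I :: "'n set"
      by (induction I rule: infinite_finite_induct) (simp_all add: add)
    then show ?thesis by (simp add: contractE'_def ev_weight_def)
  qed
  finally show "(\<Sum>i\<in>UNIV. c (ev_weight i) * p i i) = c (qexp m)" by (simp only: sc)
qed

definition scO :: "complex \<Rightarrow> 'u \<times> 'v \<Rightarrow> 'u \<times> 'v" where "scO z = lO (c z)"

lemma embeddings:
  "(lP b u, 0) = lO b (u, 0)" "(0, lM b v) = lO b (0, v)"
proof -
  have "lP b 0 = 0" "lM b 0 = 0"
    using left_modules unfolding left_module_def by (metis add_cancel_left_left)+
  then show "(lP b u, 0) = lO b (u, 0)" "(0, lM b v) = lO b (0, v)" by (simp_all add: lO_def)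
qed

lemma St_del: "act234 scO St (\<lambda>i j k l. lO (p i j) (del (p k l))) i j k l = scO (qexp (- w)) (lO (p i j) (del (p k l)))"
  and trace_del: "(\<Sum>i\<in>UNIV. scO (ev_weight i) (del (p i i))) = 0"
proof -
  note rel = presented_relations[OF plus_presented, of "\<lambda>u. (u, 0 :: 'v)" lO, OF _ embeddings(1)]
  show "act234 scO St (\<lambda>i j k l. lO (p i j) (del (p k l))) i j k l = scO (qexp (- w)) (lO (p i j) (del (p k l)))"
    unfolding scO_def del_def by (rule rel(2)) (simp, unfold plus_rels_def Let_def, blast)
  show "(\<Sum>i\<in>UNIV. scO (ev_weight i) (del (p i i))) = 0"
    unfolding scO_def del_def ev_weight_def by (rule rel(3)) (simp, unfold plus_rels_def Let_def, blast)
qed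

lemma S_delbar: "act123 scO S (\<lambda>i j k l. lO (p i j) (delbar (p k l))) i j k l = scO (qexp w) (lO (p i j) (delbar (p k l)))"
  and trace_delbar: "(\<Sum>i\<in>UNIV. scO (ev_weight i) (delbar (p i i))) = 0"
proof -
  note rel = presented_relations[OF minus_presented, of "\<lambda>v. (0 :: 'u, v)" lO, OF _ embeddings(2)]
  show "act123 scO S (\<lambda>i j k l. lO (p i j) (delbar (p k l))) i j k l = scO (qexp w) (lO (p i j) (delbar (p k l)))"
    unfolding scO_def delbar_def by (rule rel(1)) (simp, unfold minus_rels_def Let_def, blast)
  show "(\<Sum>i\<in>UNIV. scO (ev_weight i) (delbar (p i i))) = 0"
    unfolding scO_def delbar_def ev_weight_def by (rule rel(3)) (simp, unfold minus_rels_def Let_def, blast)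
qed

lemma right_del: "rO (del (p i j)) (p k l) = scO (qexp a) (actT scO (\<lambda>i j k l. lO (p i j) (del (p k l))) i j k l)"
proof -
  let ?X = "\<lambda>i j k l. lP (p i j) (dP (p k l))"
  let ?h = "\<lambda>u. (u, 0 :: 'v)"
  have X: "?h (?X i j k l) = lO (p i j) (del (p k l))" for i j k l by (simp add: embeddings del_def)
  have h: "?h (x + y) = ?h x + ?h y" "?h (lP (c z) x) = scO z (?h x)" for x y z by (simp_all add: embeddings scO_def)
  have zero: "rM 0 b = 0" for b using left_modules(4) unfolding right_module_def by (metis add_cancel_left_left)
  have "rO (del (p i j)) (p k l) = ?h (lP (c (qexp a)) (actT (\<lambda>z. lP (c z)) ?X i j k l))"
    unfolding plus_right[symmetric] by (simp add: rO_def del_def zero)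
  also have "\<dots> = scO (qexp a) (act123 scO S (act234 scO St (\<lambda>i j k l. ?h (?X i j k l))) i j k l)"
    unfolding h actT_def act_map(1)[of ?h "\<lambda>z. lP (c z)" _ scO, OF h] act_map(2)[of ?h "\<lambda>z. lP (c z)" _ scO, OF h] by (rule refl)
  finally show ?thesis unfolding X actT_def .
qed

lemma right_delbar: "rO (delbar (p i j)) (p k l) = scO (qexp (- a)) (actT scO (\<lambda>i j k l. lO (p i j) (delbar (p k l))) i j k l)"
proof -
  let ?X = "\<lambda>i j k l. lM (p i j) (dM (p k l))"
  let ?h = "\<lambda>v. (0 :: 'u, v)"
  have X: "?h (?X i j k l) = lO (p i j) (delbar (p k l))" for i j k l by (simp add: embeddings delbar_def)
  have h: "?h (x + y) = ?h x + ?h y" "?h (lM (c z) x) = scO z (?h x)" for x y z by (simp_all add: embeddings scO_def)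
  have zero: "rP 0 b = 0" for b using left_modules(3) unfolding right_module_def by (metis add_cancel_left_left)
  have "rO (delbar (p i j)) (p k l) = ?h (lM (c (qexp (- a))) (actT (\<lambda>z. lM (c z)) ?X i j k l))"
    unfolding minus_right[symmetric] by (simp add: rO_def delbar_def zero)
  also have "\<dots> = scO (qexp (- a)) (act123 scO S (act234 scO St (\<lambda>i j k l. ?h (?X i j k l))) i j k l)"
    unfolding h actT_def act_map(1)[of ?h "\<lambda>z. lM (c z)" _ scO, OF h] act_map(2)[of ?h "\<lambda>z. lM (c z)" _ scO, OF h] by (rule refl)
  finally show ?thesis unfolding X actT_def .
qed

end

context universal_calculus
begin

section \<open>The relations in the universal calculus\<close>

definition scw :: "complex \<Rightarrow> 'w" where "scw z = \<pi>0 (c z)"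

text \<open>
  Images of the generators in the universal calculus, and the differential of \<open>wdelbar\<close>.
\<close>

definition wp :: "('n, 'w) fam2" where "wp i j = \<pi>0 (p i j)"
definition wdel :: "('n, 'w) fam2" where "wdel i j = \<pi>1 (del (p i j))"
definition wdelbar :: "('n, 'w) fam2" where "wdelbar i j = \<pi>1 (delbar (p i j))"
definition wddelbar :: "('n, 'w) fam2" where "wddelbar = contractE23 (tens (wdel + wdelbar) (wdel + wdelbar))"

lemma scw_ring: "ring_map scw"
  using c_ring pi0_ring by (simp add: ring_map_def additive_map_def scw_def)

lemma scw_central: "scw z * \<pi>1 x = \<pi>1 x * scw z" "scw z * \<pi>0 y = \<pi>0 y * scw z"
proof -
  show "scw z * \<pi>1 x = \<pi>1 x * scw z"
    unfolding scw_def pi1_simps[symmetric] rO_simps(5) by (rule refl)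
  show "scw z * \<pi>0 y = \<pi>0 y * scw z"
    unfolding scw_def ring_map_simps(2)[OF pi0_ring, symmetric] by (simp only: c_central)
qed

lemma pi1_scO: "\<pi>1 (scO z x) = scw z * \<pi>1 x"
  by (simp add: scO_def pi1_simps scw_def)

lemma ext_0: "ext 0 0"
  unfolding ext_def by (rule exI[of _ "[]"]) simp

lemma ext_sum: "(\<And>i. i \<in> I \<Longrightarrow> ext (f i) (g i)) \<Longrightarrow> ext (sum f I) (sum g I)"
  by (induction I rule: infinite_finite_induct) (simp_all add: ext_0 ext_add)

lemma ext_scO: "ext x t \<Longrightarrow> ext (scO z x) (scw z * t)"
  using ext_lO[of x t "c z"] by (simp add: scO_def d_simps pi1_0 scw_def)

lemma ext_act:
  fixes X :: "('n, 'u \<times> 'v) fam4"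
  assumes "\<And>i j k l. ext (X i j k l) (T i j k l)"
  shows "ext (act123 scO A X i j k l) (act123 (left_mult scw) A T i j k l)"
    "ext (act234 scO A X i j k l) (act234 (left_mult scw) A T i j k l)"
  unfolding act123_def act234_def case_prod_unfold
  by (intro ext_sum ext_scO assms)+

lemma scO_vector_space: "vector_space scO"
  by standard (simp_all add: scO_def lO_simps ring_map_simps[OF c_ring])

lemma c_vector_space: "vector_space (left_mult c)"
  by standard (simp_all add: ring_map_simps[OF c_ring] algebra_simps)

interpretation M: hk_matrices S St ev_weight "qexp w" "qexp a" "qexp m"
  by (rule braiding_hk_matrices)

lemma qexp_simps: "qexp (- x) = 1 / qexp x" "qexp (x + y) = qexp x * qexp y" "qexp (x - y) = qexp x / qexp y"
  "qexp (2 * x) = (qexp x)\<^sup>2" "qexp x \<noteq> 0"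
proof -
  show "qexp (- x) = 1 / qexp x" "qexp (x + y) = qexp x * qexp y" "qexp (x - y) = qexp x / qexp y" "qexp x \<noteq> 0"
    using q_pos by (simp_all add: qexp_def powr_minus powr_add powr_diff field_simps)
  show "qexp (2 * x) = (qexp x)\<^sup>2"
    using \<open>qexp (x + y) = qexp x * qexp y\<close> by (simp add: qexp_def powr_add[symmetric] power2_eq_square of_real_mult[symmetric] del: of_real_mult)
qed

text \<open>
  The family \<open>p\<close> is an idempotent matrix.
\<close>

lemma contract_pp: "(\<Sum>h\<in>UNIV. p i h * p h l) = p i l"
proof -
  have "contractE23 (\<lambda>i j k l. p i j * p k l) i l = c (1 / qexp m) * (\<Sum>k\<in>UNIV. c (ev_weight k) * (p k k * p i l))"
    by (rule M.contract_S_eigen[OF c_vector_space S_pp])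
  also have "\<dots> = c (1 / qexp m) * (c (qexp m) * p i l)"
    by (simp add: trace_p[symmetric] sum_distrib_right mult.assoc)
  also have "\<dots> = p i l"
    using qexp_simps(5)[of m] by (simp add: mult.assoc[symmetric] ring_map_simps(2)[OF c_ring, symmetric] ring_map_simps(3)[OF c_ring])
  finally show ?thesis by (simp add: contractE23_def)
qed

lemma lO_sum: "lO (sum f I) x = (\<Sum>i\<in>I. lO (f i) x)" "lO b (sum g I) = (\<Sum>i\<in>I. lO b (g i))"
proof -
  have z: "lO 0 x = 0" "lO b 0 = 0" for b x using lO_simps(4)[of 0 0 x] lO_simps(1)[of b 0 0] by simp_all
  show "lO (sum f I) x = (\<Sum>i\<in>I. lO (f i) x)" "lO b (sum g I) = (\<Sum>i\<in>I. lO b (g i))"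
    by (induction I rule: infinite_finite_induct) (simp_all add: z lO_simps)
qed

lemma contract_p_delbar: "(\<Sum>h\<in>UNIV. lO (p i h) (delbar (p h l))) = delbar (p i l)"
proof -
  have "contractE23 (\<lambda>i j k l. lO (p i j) (delbar (p k l))) i l
      = scO (1 / qexp m) (\<Sum>k\<in>UNIV. scO (ev_weight k) (lO (p k k) (delbar (p i l))))"
    by (rule M.contract_S_eigen[OF scO_vector_space S_delbar])
  also have "\<dots> = lO (c (1 / qexp m) * (\<Sum>k\<in>UNIV. c (ev_weight k) * p k k)) (delbar (p i l))"
    by (simp add: scO_def lO_simps lO_sum)
  also have "\<dots> = delbar (p i l)"
    using qexp_simps(5)[of m] by (simp add: trace_p ring_map_simps(2)[OF c_ring, symmetric] ring_map_simps(3)[OF c_ring] lO_simps)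
  finally show ?thesis by (simp add: contractE23_def)
qed

lemma contract_p_del: "(\<Sum>h\<in>UNIV. lO (p i h) (del (p h l))) = 0"
proof -
  have z: "lO b 0 = 0" for b using lO_simps(1)[of b 0 0] by simp
  have scw: "scO z (lO b x) = lO b (scO z x)" for z b x
    by (simp add: scO_def lO_simps(2)[symmetric] c_central)
  have "contractE23 (\<lambda>i j k l. lO (p i j) (del (p k l))) i l
      = scO (1 / qexp m) (\<Sum>k\<in>UNIV. scO (ev_weight k) (lO (p i l) (del (p k k))))"
    by (rule M.contract_St_eigen[OF scO_vector_space St_del[unfolded qexp_simps(1)]])
  also have "\<dots> = 0"
    unfolding scw lO_sum(2)[symmetric] trace_del by (simp add: scO_def z)
  finally show ?thesis by (simp add: contractE23_def)
qed

lemma pi1_d: "\<pi>1 (d (p i j)) = (wdel + wdelbar) i j"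
  by (simp add: d_def pi1_simps wdel_def wdelbar_def)

text \<open>
  By the two contractions above \<open>\<partial>'p = E\<^sub>2\<^sub>3 p dp\<close>, which is a presentation that can be differentiated.
\<close>

lemma ext_delbar: "ext (delbar (p i j)) (wddelbar i j)"
proof -
  have "delbar (p i j) = (\<Sum>h\<in>UNIV. lO (p i h) (d (p h j)))"
    using contract_p_delbar contract_p_del by (simp add: d_def lO_simps sum.distrib)
  moreover have "ext (\<Sum>h\<in>UNIV. lO (p i h) (d (p h j))) (\<Sum>h\<in>UNIV. \<pi>1 (d (p i h)) * \<pi>1 (d (p h j)))"
    by (intro ext_sum ext_d)
  ultimately show ?thesis by (simp add: pi1_d wddelbar_def contractE23_def tens_def)
qed

lemma ext_del: "ext (del (p i j)) (- wddelbar i j)"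
proof -
  have "ext (d (p i j)) 0" using ext_d[of 1 "p i j"] by (simp add: lO_simps d_one pi1_0)
  then have "ext (d (p i j) + - delbar (p i j)) (0 + - wddelbar i j)"
    by (intro ext_add ext_uminus ext_delbar)
  then show ?thesis by (simp add: d_def)
qed

lemma ext_p_del: "ext (lO (p i j) (del (p k l))) ((tens (wdel + wdelbar) wdel - tens wp wddelbar) i j k l)"
  using ext_lO[OF ext_del, of "p i j" k l] unfolding pi1_d by (simp add: tens_def wdel_def wp_def)

lemma ext_p_delbar: "ext (lO (p i j) (delbar (p k l))) ((tens (wdel + wdelbar) wdelbar + tens wp wddelbar) i j k l)"
  using ext_lO[OF ext_delbar, of "p i j" k l] unfolding pi1_d by (simp add: tens_def wdelbar_def wp_def)

lemma ext_del_p: "ext (rO (del (p i j)) (p k l)) ((- tens wddelbar wp - tens wdel (wdel + wdelbar)) i j k l)"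
  using ext_rO[OF ext_del, of i j "p k l"] unfolding pi1_d by (simp add: tens_def wdel_def wp_def)

lemma ext_delbar_p: "ext (rO (delbar (p i j)) (p k l)) ((tens wddelbar wp - tens wdelbar (wdel + wdelbar)) i j k l)"
  using ext_rO[OF ext_delbar, of i j "p k l"] unfolding pi1_d by (simp add: tens_def wdelbar_def wp_def)

lemma quotient_two_forms: "hk_two_forms S St ev_weight (qexp w) (qexp a) (qexp m) scw wp wdel wdelbar"
proof
  show "ring_map scw" by (rule scw_ring)
  show "scw z * wp i j = wp i j * scw z" "scw z * wdel i j = wdel i j * scw z" "scw z * wdelbar i j = wdelbar i j * scw z" for z i j
    by (simp_all add: wp_def wdel_def wdelbar_def scw_central)
  show "act123 (left_mult scw) S (act234 (left_mult scw) St X) = act234 (left_mult scw) St (act123 (left_mult scw) S X)"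
    for X :: "('n, 'w) fam4"
    unfolding S_def St_def by (rule act_conjugate_commute[OF scw_ring R_VD_inverse])
qed

interpretation F: hk_two_forms S St ev_weight "qexp w" "qexp a" "qexp m" scw wp wdel wdelbar
  by (rule quotient_two_forms)

lemma pi1_act:
  "\<pi>1 (act123 scO A X i j k l) = act123 (left_mult scw) A (\<lambda>i j k l. \<pi>1 (X i j k l)) i j k l"
  "\<pi>1 (act234 scO A X i j k l) = act234 (left_mult scw) A (\<lambda>i j k l. \<pi>1 (X i j k l)) i j k l"
  by (rule act_map; simp add: pi1_simps pi1_scO)+

lemma pi0_add: "\<pi>0 (x + y) = \<pi>0 x + \<pi>0 y" and pi0_mult: "\<pi>0 (x * y) = \<pi>0 x * \<pi>0 y"
  by (simp_all add: ring_map_simps[OF pi0_ring])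

lemma pi1_sum: "\<pi>1 (sum f I) = (\<Sum>i\<in>I. \<pi>1 (f i))"
  by (induction I rule: infinite_finite_induct) (simp_all add: pi1_0 pi1_simps)

lemma pi1_tens: "\<pi>1 (lO (p i j) (del (p k l))) = tens wp wdel i j k l" "\<pi>1 (lO (p i j) (delbar (p k l))) = tens wp wdelbar i j k l"
   "\<pi>1 (rO (del (p i j)) (p k l)) = tens wdel wp i j k l" "\<pi>1 (rO (delbar (p i j)) (p k l)) = tens wdelbar wp i j k l"
  by (simp_all add: pi1_simps tens_def wp_def wdel_def wdelbar_def)

text \<open>
  The relations of first order are images of relations between one-forms; the others are obtained by
  differentiating both sides, whose differentials agree by uniqueness.
\<close>

lemma quotient_relations: "hk_relations S St ev_weight (qexp w) (qexp a) (qexp m) scw wp wdel wdelbar wddelbar"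
proof (intro hk_relations.intro quotient_two_forms hk_relations_axioms.intro)
  show "act123 (left_mult scw) S (tens wp wp) = F.smul (qexp w) (tens wp wp)"
  proof (intro ext)
    fix i j k l
    have "\<pi>0 (act123 (left_mult c) S (\<lambda>i j k l. p i j * p k l) i j k l)
        = act123 (left_mult scw) S (\<lambda>i j k l. \<pi>0 (p i j * p k l)) i j k l"
      by (rule act_map(1)) (simp_all add: pi0_add pi0_mult scw_def)
    then show "act123 (left_mult scw) S (tens wp wp) i j k l = F.smul (qexp w) (tens wp wp) i j k l"
      unfolding S_pp by (simp add: tens_def wp_def pi0_mult F.smul_def scw_def)
  qed
  have "(\<Sum>i\<in>UNIV. scw (ev_weight i) * wp i i) = \<pi>0 (\<Sum>i\<in>UNIV. c (ev_weight i) * p i i)"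
    by (simp add: ring_map_simps(7)[OF pi0_ring] pi0_mult scw_def wp_def)
  then show "(\<Sum>i\<in>UNIV. scw (ev_weight i) * wp i i) = scw (qexp m)" by (simp add: trace_p scw_def)
  have "(\<Sum>i\<in>UNIV. scw (ev_weight i) * wdel i i) = \<pi>1 (\<Sum>i\<in>UNIV. scO (ev_weight i) (del (p i i)))"
    by (simp add: pi1_sum pi1_scO wdel_def)
  then show "(\<Sum>i\<in>UNIV. scw (ev_weight i) * wdel i i) = 0" by (simp add: trace_del pi1_0)
  have "(\<Sum>i\<in>UNIV. scw (ev_weight i) * wdelbar i i) = \<pi>1 (\<Sum>i\<in>UNIV. scO (ev_weight i) (delbar (p i i)))"
    by (simp add: pi1_sum pi1_scO wdelbar_def)
  then show "(\<Sum>i\<in>UNIV. scw (ev_weight i) * wdelbar i i) = 0" by (simp add: trace_delbar pi1_0)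
  have "ext (\<Sum>i\<in>UNIV. scO (ev_weight i) (delbar (p i i))) (\<Sum>i\<in>UNIV. scw (ev_weight i) * wddelbar i i)"
    by (intro ext_sum ext_scO ext_delbar)
  then show "(\<Sum>i\<in>UNIV. scw (ev_weight i) * wddelbar i i) = 0" by (simp add: trace_delbar ext_zero)
  show "act234 (left_mult scw) St (tens wp wdel) = F.smul (1 / qexp w) (tens wp wdel)"
  proof (intro ext)
    fix i j k l
    have "act234 (left_mult scw) St (\<lambda>i j k l. tens wp wdel i j k l) i j k l = scw (1 / qexp w) * tens wp wdel i j k l"
      unfolding pi1_tens[symmetric] pi1_act[symmetric] St_del pi1_scO qexp_simps by (rule refl)
    then show "act234 (left_mult scw) St (tens wp wdel) i j k l = F.smul (1 / qexp w) (tens wp wdel) i j k l"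
      by (simp add: F.smul_def)
  qed
  show "act123 (left_mult scw) S (tens wp wdelbar) = F.smul (qexp w) (tens wp wdelbar)"
  proof (intro ext)
    fix i j k l
    have "act123 (left_mult scw) S (\<lambda>i j k l. tens wp wdelbar i j k l) i j k l = scw (qexp w) * tens wp wdelbar i j k l"
      unfolding pi1_tens[symmetric] pi1_act[symmetric] S_delbar pi1_scO by (rule refl)
    then show "act123 (left_mult scw) S (tens wp wdelbar) i j k l = F.smul (qexp w) (tens wp wdelbar) i j k l"
      by (simp add: F.smul_def)
  qed
  show "tens wdel wp = F.smul (qexp a) (act123 (left_mult scw) S (act234 (left_mult scw) St (tens wp wdel)))"
  proof (intro ext)
    fix i j k l
    have "tens wdel wp i j k l = scw (qexp a) * act123 (left_mult scw) S (act234 (left_mult scw) St (\<lambda>i j k l. tens wp wdel i j k l)) i j k l"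
      unfolding pi1_tens(3)[symmetric] right_del actT_def pi1_scO pi1_act pi1_tens by (rule refl)
    then show "tens wdel wp i j k l = F.smul (qexp a) (act123 (left_mult scw) S (act234 (left_mult scw) St (tens wp wdel))) i j k l"
      by (simp add: F.smul_def)
  qed
  show "tens wdelbar wp = F.smul (1 / qexp a) (act123 (left_mult scw) S (act234 (left_mult scw) St (tens wp wdelbar)))"
  proof (intro ext)
    fix i j k l
    have "tens wdelbar wp i j k l = scw (1 / qexp a) * act123 (left_mult scw) S (act234 (left_mult scw) St (\<lambda>i j k l. tens wp wdelbar i j k l)) i j k l"
      unfolding pi1_tens(4)[symmetric] right_delbar actT_def pi1_scO pi1_act pi1_tens qexp_simps(1) by (rule refl)
    then show "tens wdelbar wp i j k l = F.smul (1 / qexp a) (act123 (left_mult scw) S (act234 (left_mult scw) St (tens wp wdelbar))) i j k l"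
      by (simp add: F.smul_def)
  qed
  have l: "(\<Sum>h\<in>UNIV. rO (del (p i h)) (p h l) + lO (p i h) (del (p h l))) = del (p i l)"
    "(\<Sum>h\<in>UNIV. rO (delbar (p i h)) (p h l) + lO (p i h) (delbar (p h l))) = delbar (p i l)" for i l
  proof -
    have add: "del (x + y) = del x + del y" "delbar (x + y) = delbar x + delbar y" for x y
      using plus_derivation minus_derivation by (simp_all add: del_def delbar_def derivation_def additive_map_def)
    have z: "del 0 = 0" "delbar 0 = 0" using add(1)[of 0 0] add(2)[of 0 0] by simp_all
    have s: "del (sum f I) = (\<Sum>i\<in>I. del (f i))" "delbar (sum f I) = (\<Sum>i\<in>I. delbar (f i))" for f and I :: "'n set"
      by (induction I rule: infinite_finite_induct) (simp_all add: add z)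
    show "(\<Sum>h\<in>UNIV. rO (del (p i h)) (p h l) + lO (p i h) (del (p h l))) = del (p i l)"
      "(\<Sum>h\<in>UNIV. rO (delbar (p i h)) (p h l) + lO (p i h) (delbar (p h l))) = delbar (p i l)"
      unfolding d_simps(4,5)[symmetric] s[symmetric] contract_pp by (rule refl)+
  qed
  show "contractE23 (tens wdel wp) + contractE23 (tens wp wdel) = wdel"
    "contractE23 (tens wdelbar wp) + contractE23 (tens wp wdelbar) = wdelbar"
    unfolding fun_eq_iff plus_fun_def contractE23_def sum.distrib[symmetric] pi1_tens[symmetric] pi1_simps(1)[symmetric] pi1_sum[symmetric] l
    by (simp_all add: wdel_def wdelbar_def)
  let ?XU = "\<lambda>i j k l. lO (p i j) (del (p k l))" and ?TU = "tens (wdel + wdelbar) wdel - tens wp wddelbar"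
  let ?XW = "\<lambda>i j k l. lO (p i j) (delbar (p k l))" and ?TW = "tens (wdel + wdelbar) wdelbar + tens wp wddelbar"
  have U: "ext (?XU i j k l) (?TU i j k l)" and W: "ext (?XW i j k l) (?TW i j k l)" for i j k l
    by (rule ext_p_del ext_p_delbar)+
  have StU: "ext (act234 scO St ?XU i j k l) (F.opSt ?TU i j k l)"
    and StW: "ext (act234 scO St ?XW i j k l) (F.opSt ?TW i j k l)"
    and SW: "ext (act123 scO S ?XW i j k l) (F.opS ?TW i j k l)" for i j k l
    by (rule ext_act, rule U W)+
  have SStU: "ext (act123 scO S (act234 scO St ?XU) i j k l) (F.opS (F.opSt ?TU) i j k l)"
    and SStW: "ext (act123 scO S (act234 scO St ?XW) i j k l) (F.opS (F.opSt ?TW) i j k l)" for i j k l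
    by (rule ext_act, rule StU StW)+
  have "F.opSt ?TU i j k l = scw (qexp (- w)) * ?TU i j k l" for i j k l
    using StU[of i j k l] ext_scO[OF U] unfolding St_del by (rule ext_unique)
  then show "F.opSt ?TU = F.smul (1 / qexp w) ?TU"
    unfolding F.smul_def qexp_simps(1) by (intro ext) simp
  have "F.opS ?TW i j k l = scw (qexp w) * ?TW i j k l" for i j k l
    using SW[of i j k l] ext_scO[OF W] unfolding S_delbar by (rule ext_unique)
  then show "F.opS ?TW = F.smul (qexp w) ?TW"
    unfolding F.smul_def by (intro ext) simp
  have "(- tens wddelbar wp - tens wdel (wdel + wdelbar)) i j k l = scw (qexp a) * F.opS (F.opSt ?TU) i j k l" for i j k l
    using ext_del_p[of i j k l] ext_scO[OF SStU] unfolding right_del actT_def by (rule ext_unique)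
  then show "- tens wddelbar wp - tens wdel (wdel + wdelbar) = F.smul (qexp a) (F.opS (F.opSt ?TU))"
    unfolding F.smul_def by (intro ext) simp
  have "(tens wddelbar wp - tens wdelbar (wdel + wdelbar)) i j k l = scw (qexp (- a)) * F.opS (F.opSt ?TW) i j k l" for i j k l
    using ext_delbar_p[of i j k l] ext_scO[OF SStW] unfolding right_delbar actT_def by (rule ext_unique)
  then show "tens wddelbar wp - tens wdelbar (wdel + wdelbar) = F.smul (1 / qexp a) (F.opS (F.opSt ?TW))"
    unfolding F.smul_def qexp_simps(1) by (intro ext) simp
  show "wddelbar = contractE23 (tens (wdel + wdelbar) (wdel + wdelbar))" by (rule wddelbar_def)
qed

interpretation R: hk_relations S St ev_weight "qexp w" "qexp a" "qexp m" scw wp wdel wdelbar wddelbar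
  by (rule quotient_relations)

lemma proj_t_scale: "proj (t_scale z x) = scw z * proj x"
  by (simp add: t_scale_def proj_simps scw_def \<pi>0_def)

lemma proj_act:
  "proj (act123 t_scale A X i j k l) = act123 (left_mult scw) A (\<lambda>i j k l. proj (X i j k l)) i j k l"
  "proj (act234 t_scale A X i j k l) = act234 (left_mult scw) A (\<lambda>i j k l. proj (X i j k l)) i j k l"
  by (rule act_map; simp add: proj_simps proj_t_scale)+

lemma proj_forms:
  "proj (del_del i j k l) = tens wdel wdel i j k l" "proj (delbar_delbar i j k l) = tens wdelbar wdelbar i j k l"
  "proj (del_delbar i j k l) = tens wdel wdelbar i j k l" "proj (delbar_del i j k l) = tens wdelbar wdel i j k l"
  by (simp_all add: del_del_def delbar_delbar_def del_delbar_def delbar_del_def tens_def wdel_def wdelbar_def \<pi>1_def proj_simps)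

lemma proj_g: "proj g_minus_plus = R.g" "proj g_plus_minus = - R.g"
proof -
  have t: "(\<Sum>i\<in>UNIV. scw (ev_weight i) * R.alpha i i) + R.g = 0"
    using R.trace_Theta unfolding R.Theta_alpha_beta R.g_def by (simp add: distrib_left sum.distrib)
  show "proj g_minus_plus = R.g"
    by (simp add: g_minus_plus_def contractE'_def contractE23_def ev_weight_def[symmetric] proj_simps proj_t_scale proj_forms R.g_def R.beta_def)
  have "proj g_plus_minus = (\<Sum>i\<in>UNIV. scw (ev_weight i) * R.alpha i i)"
    by (simp add: g_plus_minus_def contractE'_def contractE23_def ev_weight_def[symmetric] proj_simps proj_t_scale proj_forms R.alpha_def)
  then show "proj g_plus_minus = - R.g" using t by (simp add: eq_neg_iff_add_eq_0)
qed

lemma omega_induct: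
  assumes "\<And>b i j. Pr (lO b (del (p i j)))" "\<And>b i j. Pr (lO b (delbar (p i j)))"
    and add: "\<And>x y. Pr x \<Longrightarrow> Pr y \<Longrightarrow> Pr (x + y)" and "Pr 0"
  shows "Pr x"
proof -
  have s: "Pr (sum f I)" if "\<And>g. Pr (f g)" for f and I :: "('n \<times> 'n) set"
    by (induction I rule: infinite_finite_induct) (simp_all add: assms that)
  have add_pair: "(sum f I, 0) = (\<Sum>g\<in>I. (f g, 0))" "(0, sum f' I) = (\<Sum>g\<in>I. (0, f' g))"
    for f :: "'n \<times> 'n \<Rightarrow> 'u" and f' :: "'n \<times> 'n \<Rightarrow> 'v" and I
    by (simp_all add: prod_eq_iff fst_sum snd_sum)
  obtain a1 where 1: "fst x = (\<Sum>g\<in>UNIV. lP (a1 $ g) ((\<lambda>(i, j). dP (p i j)) g))"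
    using plus_presented unfolding presented_left_module_def by blast
  obtain a2 where 2: "snd x = (\<Sum>g\<in>UNIV. lM (a2 $ g) ((\<lambda>(i, j). dM (p i j)) g))"
    using minus_presented unfolding presented_left_module_def by blast
  have "Pr (fst x, 0)"
    unfolding 1 add_pair by (rule s) (use assms(1) in \<open>simp add: embeddings del_def case_prod_unfold\<close>)
  moreover have "Pr (0, snd x)"
    unfolding 2 add_pair by (rule s) (use assms(2) in \<open>simp add: embeddings delbar_def case_prod_unfold\<close>)
  ultimately show ?thesis using add[of "(fst x, 0)" "(0, snd x)"] by simp
qed

end

lemma additive_subgroup_hull: "additive_subgroup (additive_subgroup hull G)"
  by (rule hull_in) (auto simp: additive_subgroup_def)

context generalized_braiding
begin

interpretation R: hk_relations S St ev_weight "qexp w" "qexp a" "qexp m" scw wp wdel wdelbar wddelbar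
  by (rule quotient_relations)

lemma tensor_square_mem: "emb1 x * emb1 y \<in> tensor_square emb1"
  unfolding tensor_square_def by (rule hull_inc) blast

lemma wedge_generators:
  "proj (del_del i j k l + \<sigma> (del_del i j k l)) = 0"
  "proj (delbar_delbar i j k l + \<sigma> (delbar_delbar i j k l)) = 0"
  "proj (del_delbar i j k l + \<sigma> (del_delbar i j k l)) = 0"
  "proj (delbar_del i j k l + \<sigma> (delbar_del i j k l)) = 0"
proof -
  note simps = proj_simps proj_t_scale proj_act proj_forms proj_g qexp_simps
  have pp: "proj (emb0 (p i j)) = wp i j" for i j by (simp add: wp_def \<pi>0_def)
  note pw = fun_cong[OF fun_cong[OF fun_cong[OF fun_cong]], of _ _ i j k l]
  show "proj (del_del i j k l + \<sigma> (del_del i j k l)) = 0"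
    using pw[OF R.wedge_UU] unfolding sigma_del_del by (simp add: simps R.smul_def)
  show "proj (delbar_delbar i j k l + \<sigma> (delbar_delbar i j k l)) = 0"
    using pw[OF R.wedge_WW] unfolding sigma_delbar_delbar by (simp add: simps R.smul_def)
  show "proj (del_delbar i j k l + \<sigma> (del_delbar i j k l)) = 0"
    using pw[OF R.wedge_UW] unfolding sigma_del_delbar
    by (simp add: simps pp R.smul_def tens_def[of _ wp] add.assoc)
  show "proj (delbar_del i j k l + \<sigma> (delbar_del i j k l)) = 0"
    using pw[OF R.wedge_WU] unfolding sigma_delbar_del
    by (simp add: simps pp R.smul_def tens_def[of _ wp] add.assoc)
qed

text \<open>
  The products of generators span the tensor square as a left module and \<open>\<sigma>\<close> is left linear, so the four
  relations between generators suffice.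
\<close>

theorem wedge_sigma:
  assumes "\<eta> \<in> tensor_square emb1"
  shows "proj (\<eta> + \<sigma> \<eta>) = 0"
proof -
  let ?K = "{\<eta> \<in> tensor_square emb1. proj (\<eta> + \<sigma> \<eta>) = 0}"
  have T: "additive_subgroup (tensor_square emb1)"
    unfolding tensor_square_def by (rule additive_subgroup_hull)
  have T0: "0 \<in> tensor_square emb1" and Tadd: "\<And>x y. x \<in> tensor_square emb1 \<Longrightarrow> y \<in> tensor_square emb1 \<Longrightarrow> x + y \<in> tensor_square emb1"
    and Tneg: "\<And>x. x \<in> tensor_square emb1 \<Longrightarrow> - x \<in> tensor_square emb1"
    using T unfolding additive_subgroup_def by blast+
  have s0: "\<sigma> 0 = 0" using sigma_add[OF T0 T0] by simp
  have sneg: "\<sigma> (- x) = - \<sigma> x" if "x \<in> tensor_square emb1" for x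
    using sigma_add[OF that Tneg[OF that]] s0 by (simp add: eq_neg_iff_add_eq_0 add.commute)
  have K0: "0 \<in> ?K" using T0 by (simp add: s0 proj_simps)
  have Kadd: "x + y \<in> ?K" if "x \<in> ?K" "y \<in> ?K" for x y
    using that by (simp add: Tadd sigma_add proj_simps) (metis add.commute add.left_commute add_0)
  have Kneg: "- x \<in> ?K" if "x \<in> ?K" for x
    using that by (simp add: Tneg sneg proj_simps) (metis add_eq_0_iff neg_eq_iff_add_eq_0)
  have K: "additive_subgroup ?K"
    unfolding additive_subgroup_def using K0 Kadd Kneg by blast
  have emb1_0: "emb1 0 = 0" using emb1_add[of 0 0] by simp
  \<comment> \<open>Coefficients on the left are pulled out by left linearity; a coefficient between the two factors is
    first moved into the left one.\<close>
  have step: "emb1 (lO b x) * emb1 y \<in> ?K" if "emb1 x * emb1 y \<in> ?K" for b x y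
  proof -
    have eq: "emb1 (lO b x) * emb1 y = emb0 b * (emb1 x * emb1 y)"
      by (simp add: emb_props mult.assoc)
    have "proj (emb0 b * (emb1 x * emb1 y) + \<sigma> (emb0 b * (emb1 x * emb1 y)))
        = proj (emb0 b) * proj (emb1 x * emb1 y + \<sigma> (emb1 x * emb1 y))"
      unfolding sigma_left[OF tensor_square_mem] proj_simps(2)[symmetric] by (simp add: distrib_left)
    then have "proj (emb1 (lO b x) * emb1 y + \<sigma> (emb1 (lO b x) * emb1 y)) = 0"
      unfolding eq using that by simp
    then show ?thesis using tensor_square_mem by blast
  qed
  have gens: "emb1 (del (p i j)) * emb1 (del (p k l)) \<in> ?K" "emb1 (delbar (p i j)) * emb1 (delbar (p k l)) \<in> ?K"
    "emb1 (del (p i j)) * emb1 (delbar (p k l)) \<in> ?K" "emb1 (delbar (p i j)) * emb1 (del (p k l)) \<in> ?K" for i j k l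
    using wedge_generators[of i j k l] tensor_square_mem
    by (simp_all add: del_del_def delbar_delbar_def del_delbar_def delbar_del_def)
  have left: "emb1 x * emb1 (del (p k l)) \<in> ?K" "emb1 x * emb1 (delbar (p k l)) \<in> ?K" for x k l
  proof -
    show "emb1 x * emb1 (del (p k l)) \<in> ?K"
      by (induction x rule: omega_induct)
        (use step gens Kadd K0 in \<open>simp_all only: emb1_add distrib_right emb1_0 mult_zero_left\<close>)
    show "emb1 x * emb1 (delbar (p k l)) \<in> ?K"
      by (induction x rule: omega_induct)
        (use step gens Kadd K0 in \<open>simp_all only: emb1_add distrib_right emb1_0 mult_zero_left\<close>)
  qed
  have move: "emb1 x * emb1 (lO b y) = emb1 (rO x b) * emb1 y" for x b y
    by (simp add: emb_props mult.assoc)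
  have "emb1 x * emb1 y \<in> ?K" for x y
    by (induction y rule: omega_induct)
      (use left Kadd K0 in \<open>simp_all only: move emb1_add distrib_left emb1_0 mult_zero_right\<close>)
  then have "{emb1 x * emb1 y | x y. True} \<subseteq> ?K" by blast
  then have "additive_subgroup hull {emb1 x * emb1 y | x y. True} \<subseteq> ?K"
    by (rule hull_minimal) (rule K)
  then show ?thesis using assms unfolding tensor_square_def by blast
qed

end

theorem corollary3p6:
  fixes r s :: nat and q :: real and V :: "('n::finite) uq_mod" and lam :: "'n \<Rightarrow> weight"
    and c :: "complex \<Rightarrow> 'b::ring_1" and p :: "'n \<Rightarrow> 'n \<Rightarrow> 'b"
    and lP :: "'b \<Rightarrow> 'u::ab_group_add \<Rightarrow> 'u" and rP :: "'u \<Rightarrow> 'b \<Rightarrow> 'u" and dP :: "'b \<Rightarrow> 'u"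
    and lM :: "'b \<Rightarrow> 'v::ab_group_add \<Rightarrow> 'v" and rM :: "'v \<Rightarrow> 'b \<Rightarrow> 'v" and dM :: "'b \<Rightarrow> 'v"
    and emb0 :: "'b \<Rightarrow> 't::ring_1" and emb1 :: "'u \<times> 'v \<Rightarrow> 't" and proj :: "'t \<Rightarrow> 'w::ring_1"
    and \<sigma> :: "'t \<Rightarrow> 't"
  assumes "generalized_braiding r s q V lam c p lP rP dP lM rM dM emb0 emb1 proj \<sigma>"
  shows "\<forall>\<xi>\<in>tensor_square emb1. proj (\<xi> + \<sigma> \<xi>) = 0"
  using generalized_braiding.wedge_sigma[OF assms] by blast

end
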